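(* Every edge in $\mathrm{QB}(W^J)$ lifts to a downward Bruhat cover in $\Omega_J^\infty$, and every cover in $\Omega_J^\infty$ projects to an edge in $\mathrm{QB}(W^J)$. More precisely: (1) For any edge $w\xrightarrow{\alpha}\lfloor wr_\alpha\rfloor$ in $\mathrm{QB}(W^J)$, and any $\mu\in Q^\vee$ that is $J$-superantidominant and $J$-adjusted with $\pi_J(t_\mu)=zt_\mu$, there is a covering relation $y\lessdot x$ in $\Omega_J^\infty$, where $$x=wzt_\mu,\qquad y=xr_{\tilde\alpha}=wr_\alpha t_{\chi\alpha^\vee}zt_\mu,\qquad \tilde\alpha=z^{-1}\alpha+(\chi+\langle\mu,z^{-1}\alpha\rangle)\delta\in\Phi^{\mathrm{af}-},$$ and $\chi$ is $0$ or $1$ according as the edge in $\mathrm{QB}(W^J)$ is of Bruhat or quantum type, respectively. (2) Suppose $y\lessdot x$ is an arbitrary covering relation in $\Omega_J^\infty$. Then we can write $x=wzt_\mu$ with $w\in W^J$, $z=z_\mu\in W_J$, and $\mu\in Q^\vee$ $J$-superantidominant and $J$-adjusted, as well as $y=xr_\gamma$ with $\gamma=z^{-1}\alpha+n\delta\in\Phi^{\mathrm{af}}$, $\alpha\in\Phi^+\setminus\Phi_J^+$, and $n\in\mathbb Z$. With the notation $\chi:=n-\langle\mu,z^{-1}\alpha\rangle$, we have $$\chi\in\{0,1\},\qquad \gamma=z^{-1}\alpha+(\chi+\langle\mu,z^{-1}\alpha\rangle)\delta\in\Phi^{\mathrm{af}-};$$ furthermore, there is an edge $wz\xrightarrow{z^{-1}\alpha}wr_\alpha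 z$ in $\mathrm{QB}(W)$ and an edge $w\xrightarrow{\alpha}\lfloor wr_\alpha\rfloor$ in $\mathrm{QB}(W^J)$, where both edges are of Bruhat type if $\chi=0$ and of quantum type if $\chi=1$.
   Context: Let $\mathfrak g$ be a finite-dimensional simple Lie algebra with roots $\Phi\supset\Phi^+$, coroot lattice $Q^\vee$, weight lattice $X$, Weyl group $W$ (reflections $r_\alpha$, length $\ell$), $\rho$ half the sum of the positive roots. The untwisted affine Weyl group is $W_{\mathrm{af}}=W\ltimes Q^\vee$, with $t_\mu$ the translation by $\mu\in Q^\vee$. The real affine roots are $\Phi^{\mathrm{af}}=\{\alpha+n\delta\}$ ($\alpha\in\Phi$, $n\in\mathbb Z$, $\delta$ the null root), $\Phi^{\mathrm{af}+}=\Phi^+\cup\{\alpha+n\delta:n>0\}$, $\Phi^{\mathrm{af}-}=-\Phi^{\mathrm{af}+}$; the action is $wt_\mu(\alpha+n\delta)=w\alpha+(n-\langle\mu,\alpha\rangle)\delta$, and $r_{\alpha+n\delta}=r_\alpha t_{n\alpha^\vee}$. The classical part of $\alpha+n\delta$ is $\alpha$. Fix a dominant $\lambda\in X$; $J=\{i:\langle\alpha_i^\vee,\lambda\rangle=0\}$, $W_J$ is the stabilizer of $\lambda$ (generated by the simple reflections $r_i$, $i\in J$), $\Phi_J\supset\Phi_J^+$ its roots and positive roots, $\rho_J$ half the sum of $\Phi_J^+$, $Q_J^\vee=\bigoplus_{i\in J}\mathbb Z\alpha_i^\vee$, $W^J$ the set of minimal-length representatives of $W/W_J$, and $\lfloor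 v\rfloor$ the minimal-length element of $vW_J$. Let $(W_J)_{\mathrm{af}}=W_J\ltimes Q_J^\vee\subset W_{\mathrm{af}}$, $\Phi_J^{\mathrm{af}+}=\{\beta\in\Phi^{\mathrm{af}+}:\text{the classical part of }\beta\text{ is in }\Phi_J\}$ and $(W^J)_{\mathrm{af}}=\{x\in W_{\mathrm{af}}:x\beta>0\ \text{for all }\beta\in\Phi_J^{\mathrm{af}+}\}$. Every $w\in W_{\mathrm{af}}$ factors uniquely as $w=w_1w_2$ with $w_1\in(W^J)_{\mathrm{af}}$, $w_2\in(W_J)_{\mathrm{af}}$; put $\pi_J(w)=w_1$. An element $\mu\in Q^\vee$ is $J$-adjusted if $\pi_J(t_\mu)=z_\mu t_\mu$ with $z_\mu\in W$. An element $\mu\in Q^\vee$ is $J$-superantidominant if $\mu$ is antidominant (that is, $\langle\mu,\alpha\rangle\le0$ for all $\alpha\in\Phi^+$) and $\langle\mu,\alpha\rangle\ll0$ for all $\alpha\in\Phi^+\setminus\Phi_J^+$. $\Omega_J^\infty\subset W_{\mathrm{af}}$ is the set of elements of the form $w\pi_J(t_\mu)$ with $w\in W^J$ and $\mu\in Q^\vee$ $J$-superantidominant and $J$-adjusted. Its covering relations $y\lessdot x$ are the Bruhat covers of $W_{\mathrm{af}}$ between elements $x,y\in\Omega_J^\infty$ for which the connecting root (the root $\gamma$ with $y=xr_\gamma$) has classical part in $\Phi\setminus\Phi_J$. Parabolic quantum Bruhat graph $\mathrm{QB}(W^J)$: the directed graph with vertex set $W^J$ and edges $w\xrightarrow{\alpha}\lfloor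 wr_\alpha\rfloor$ for $w\in W^J$, $\alpha\in\Phi^+\setminus\Phi_J^+$ such that either (Bruhat edge) $wr_\alpha$ covers $w$ in Bruhat order (then $wr_\alpha\in W^J$), or (quantum edge) $\ell(\lfloor wr_\alpha\rfloor)=\ell(w)+1-\langle\alpha^\vee,2\rho-2\rho_J\rangle$. $\mathrm{QB}(W)$ is the case $J=\emptyset$ (vertex set $W$, $\rho_J=0$). *)

theory Defs
  imports "HOL-Analysis.Analysis"
begin

section \<open>Root systems\<close>

text \<open>
  The root datum of a finite-dimensional simple Lie algebra enters only through its root system,
  which is an irreducible reduced crystallographic root system in a Euclidean space
  \<open>'a\<close>. The inner product identifies the space containing the roots and weights with the one
  containing the coroots, so all pairings \<open>\<langle>\<mu>, \<alpha>\<rangle>\<close> are inner products in \<open>'a\<close>.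
\<close>

definition coroot :: "'a::euclidean_space \<Rightarrow> 'a" where
  "coroot \<alpha> = (2 / (\<alpha> \<bullet> \<alpha>)) *\<^sub>R \<alpha>"

definition refl_root :: "'a::euclidean_space \<Rightarrow> 'a \<Rightarrow> 'a" where
  "refl_root \<alpha> v = v - (v \<bullet> coroot \<alpha>) *\<^sub>R \<alpha>"

definition root_system :: "'a::euclidean_space set \<Rightarrow> bool" where
  "root_system \<Phi> \<longleftrightarrow>
     finite \<Phi> \<and> span \<Phi> = UNIV \<and> 0 \<notin> \<Phi> \<and>
     (\<forall>\<alpha>\<in>\<Phi>. \<forall>\<beta>\<in>\<Phi>. refl_root \<alpha> \<beta> \<in> \<Phi> \<and> \<beta> \<bullet> coroot \<alpha> \<in> \<int>) \<and>
     (\<forall>\<alpha>\<in>\<Phi>. \<forall>c. c *\<^sub>R \<alpha> \<in> \<Phi> \<longrightarrow> c = 1 \<or> c = -1)"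

definition irreducible_root_system :: "'a::euclidean_space set \<Rightarrow> bool" where
  "irreducible_root_system \<Phi> \<longleftrightarrow>
     root_system \<Phi> \<and> \<Phi> \<noteq> {} \<and>
     \<not> (\<exists>A B. A \<noteq> {} \<and> B \<noteq> {} \<and> A \<union> B = \<Phi> \<and> (\<forall>\<alpha>\<in>A. \<forall>\<beta>\<in>B. \<alpha> \<bullet> \<beta> = 0))"

definition nat_span :: "'a::real_vector set \<Rightarrow> 'a set" where
  "nat_span S = {\<Sum>\<alpha>\<in>S. real (c \<alpha>) *\<^sub>R \<alpha> | c :: 'a \<Rightarrow> nat. True}"

definition int_span :: "'a::real_vector set \<Rightarrow> 'a set" where
  "int_span S = {\<Sum>\<alpha>\<in>S. real_of_int (c \<alpha>) *\<^sub>R \<alpha> | c :: 'a \<Rightarrow> int. True}"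

text \<open>
  The positive system is given by its simple roots \<open>\<Delta>\<close>, which also serve as the index set of the
  simple roots; subsets \<open>J\<close> of the index set are thus sets of simple roots.
\<close>

definition simple_system :: "'a::euclidean_space set \<Rightarrow> 'a set \<Rightarrow> bool" where
  "simple_system \<Phi> \<Delta> \<longleftrightarrow>
     \<Delta> \<subseteq> \<Phi> \<and> independent \<Delta> \<and> (\<forall>\<beta>\<in>\<Phi>. \<beta> \<in> nat_span \<Delta> \<or> - \<beta> \<in> nat_span \<Delta>)"

definition pos_roots :: "'a::euclidean_space set \<Rightarrow> 'a set \<Rightarrow> 'a set" where
  "pos_roots \<Phi> \<Delta> = \<Phi> \<inter> nat_span \<Delta>"

definition coroot_lattice :: "'a::euclidean_space set \<Rightarrow> 'a set" where
  "coroot_lattice S = int_span (coroot ` S)"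

definition weight_lattice :: "'a::euclidean_space set \<Rightarrow> 'a set" where
  "weight_lattice \<Phi> = {lam. \<forall>\<alpha>\<in>\<Phi>. coroot \<alpha> \<bullet> lam \<in> \<int>}"

definition dominant :: "'a::euclidean_space set \<Rightarrow> 'a \<Rightarrow> bool" where
  "dominant \<Delta> lam \<longleftrightarrow> (\<forall>\<alpha>\<in>\<Delta>. coroot \<alpha> \<bullet> lam \<ge> 0)"

text \<open>The highest root, that is, the root from which every root differs by a sum of simple roots.\<close>

definition highest_root :: "'a::euclidean_space set \<Rightarrow> 'a set \<Rightarrow> 'a" where
  "highest_root \<Phi> \<Delta> = (THE \<theta>. \<theta> \<in> \<Phi> \<and> (\<forall>\<beta>\<in>\<Phi>. \<theta> - \<beta> \<in> nat_span \<Delta>))"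


section \<open>Length and Bruhat order\<close>

text \<open>
  All groups below are groups of transformations of \<open>'a\<close> under composition, and all generating sets
  consist of involutions, so that words need no inverse letters.
\<close>

definition word_prod :: "('a \<Rightarrow> 'a) list \<Rightarrow> 'a \<Rightarrow> 'a" where
  "word_prod ss = foldr (\<circ>) ss id"

definition generated :: "('a \<Rightarrow> 'a) set \<Rightarrow> ('a \<Rightarrow> 'a) set" where
  "generated S = {word_prod ss | ss. set ss \<subseteq> S}"

definition word_length :: "('a \<Rightarrow> 'a) set \<Rightarrow> ('a \<Rightarrow> 'a) \<Rightarrow> nat" where
  "word_length S x = (LEAST n. \<exists>ss. length ss = n \<and> set ss \<subseteq> S \<and> x = word_prod ss)"

text \<open>
  Strict Bruhat order and its covers in the group generated by \<open>S\<close>, where \<open>T\<close> is the set of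
  all reflections of that group.
\<close>

definition bruhat_less ::
    "('a \<Rightarrow> 'a) set \<Rightarrow> ('a \<Rightarrow> 'a) set \<Rightarrow> ('a \<Rightarrow> 'a) \<Rightarrow> ('a \<Rightarrow> 'a) \<Rightarrow> bool" where
  "bruhat_less S T =
     (\<lambda>u v. u \<in> generated S \<and> (\<exists>t\<in>T. v = u \<circ> t) \<and> word_length S u < word_length S v)\<^sup>+\<^sup>+"

definition bruhat_cover ::
    "('a \<Rightarrow> 'a) set \<Rightarrow> ('a \<Rightarrow> 'a) set \<Rightarrow> ('a \<Rightarrow> 'a) \<Rightarrow> ('a \<Rightarrow> 'a) \<Rightarrow> bool" where
  "bruhat_cover S T u v \<longleftrightarrow>
     bruhat_less S T u v \<and> \<not> (\<exists>z. bruhat_less S T u z \<and> bruhat_less S T z v)"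


section \<open>The finite Weyl group and its parabolic subgroups\<close>

definition Weyl :: "'a::euclidean_space set \<Rightarrow> ('a \<Rightarrow> 'a) set" where
  "Weyl \<Phi> = generated (refl_root ` \<Phi>)"

definition Weyl_length :: "'a::euclidean_space set \<Rightarrow> ('a \<Rightarrow> 'a) \<Rightarrow> nat" where
  "Weyl_length \<Delta> = word_length (refl_root ` \<Delta>)"

definition Weyl_cover ::
    "'a::euclidean_space set \<Rightarrow> 'a set \<Rightarrow> ('a \<Rightarrow> 'a) \<Rightarrow> ('a \<Rightarrow> 'a) \<Rightarrow> bool" where
  "Weyl_cover \<Phi> \<Delta> = bruhat_cover (refl_root ` \<Delta>) (refl_root ` \<Phi>)"

definition par_Weyl :: "'a::euclidean_space set \<Rightarrow> ('a \<Rightarrow> 'a) set" where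
  "par_Weyl J = generated (refl_root ` J)"

definition par_roots :: "'a::euclidean_space set \<Rightarrow> 'a set \<Rightarrow> 'a set" where
  "par_roots \<Phi> J = \<Phi> \<inter> int_span J"

definition par_pos_roots :: "'a::euclidean_space set \<Rightarrow> 'a set \<Rightarrow> 'a set \<Rightarrow> 'a set" where
  "par_pos_roots \<Phi> \<Delta> J = par_roots \<Phi> J \<inter> pos_roots \<Phi> \<Delta>"

definition rho :: "'a::euclidean_space set \<Rightarrow> 'a set \<Rightarrow> 'a" where
  "rho \<Phi> \<Delta> = (1 / 2) *\<^sub>R (\<Sum>\<beta>\<in>pos_roots \<Phi> \<Delta>. \<beta>)"

definition par_rho :: "'a::euclidean_space set \<Rightarrow> 'a set \<Rightarrow> 'a set \<Rightarrow> 'a" where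
  "par_rho \<Phi> \<Delta> J = (1 / 2) *\<^sub>R (\<Sum>\<beta>\<in>par_pos_roots \<Phi> \<Delta> J. \<beta>)"

definition min_reps :: "'a::euclidean_space set \<Rightarrow> 'a set \<Rightarrow> 'a set \<Rightarrow> ('a \<Rightarrow> 'a) set" where
  "min_reps \<Phi> \<Delta> J =
     {w \<in> Weyl \<Phi>. \<forall>u\<in>par_Weyl J. Weyl_length \<Delta> w \<le> Weyl_length \<Delta> (w \<circ> u)}"

definition min_rep ::
    "'a::euclidean_space set \<Rightarrow> 'a set \<Rightarrow> 'a set \<Rightarrow> ('a \<Rightarrow> 'a) \<Rightarrow> 'a \<Rightarrow> 'a" where
  "min_rep \<Phi> \<Delta> J v = (THE w. w \<in> min_reps \<Phi> \<Delta> J \<and> (\<exists>u\<in>par_Weyl J. w = v \<circ> u))"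


section \<open>The parabolic quantum Bruhat graph\<close>

text \<open>
  Edges of the two types from \<open>w\<close> to \<open>v\<close> with label \<open>\<alpha>\<close>. The graph \<open>QB(W)\<close> is the case \<open>J = {}\<close>.
\<close>

definition QB_bruhat_edge ::
    "'a::euclidean_space set \<Rightarrow> 'a set \<Rightarrow> 'a set \<Rightarrow> ('a \<Rightarrow> 'a) \<Rightarrow> 'a \<Rightarrow> ('a \<Rightarrow> 'a) \<Rightarrow> bool" where
  "QB_bruhat_edge \<Phi> \<Delta> J w \<alpha> v \<longleftrightarrow>
     w \<in> min_reps \<Phi> \<Delta> J \<and> \<alpha> \<in> pos_roots \<Phi> \<Delta> - par_pos_roots \<Phi> \<Delta> J \<and>
     v = min_rep \<Phi> \<Delta> J (w \<circ> refl_root \<alpha>) \<and>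
     Weyl_cover \<Phi> \<Delta> w (w \<circ> refl_root \<alpha>)"

definition QB_quantum_edge ::
    "'a::euclidean_space set \<Rightarrow> 'a set \<Rightarrow> 'a set \<Rightarrow> ('a \<Rightarrow> 'a) \<Rightarrow> 'a \<Rightarrow> ('a \<Rightarrow> 'a) \<Rightarrow> bool" where
  "QB_quantum_edge \<Phi> \<Delta> J w \<alpha> v \<longleftrightarrow>
     w \<in> min_reps \<Phi> \<Delta> J \<and> \<alpha> \<in> pos_roots \<Phi> \<Delta> - par_pos_roots \<Phi> \<Delta> J \<and>
     v = min_rep \<Phi> \<Delta> J (w \<circ> refl_root \<alpha>) \<and>
     real (Weyl_length \<Delta> v) =
       real (Weyl_length \<Delta> w) + 1 - coroot \<alpha> \<bullet> (2 *\<^sub>R rho \<Phi> \<Delta> - 2 *\<^sub>R par_rho \<Phi> \<Delta> J)"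


section \<open>The affine Weyl group\<close>

text \<open>
  The semidirect product \<open>W \<ltimes> Q\<^sup>\<or>\<close> is realised as a group of affine transformations, the product
  being composition; the affine root \<open>\<alpha> + n\<delta>\<close> is the pair \<open>(\<alpha>, n)\<close> with \<open>n\<close> an integral real.
\<close>

definition transl :: "'a::euclidean_space \<Rightarrow> 'a \<Rightarrow> 'a" where
  "transl \<mu> v = v + \<mu>"

definition aff_Weyl :: "'a::euclidean_space set \<Rightarrow> ('a \<Rightarrow> 'a) set" where
  "aff_Weyl \<Phi> = {w \<circ> transl \<mu> | w \<mu>. w \<in> Weyl \<Phi> \<and> \<mu> \<in> coroot_lattice \<Phi>}"

definition aff_roots :: "'a::euclidean_space set \<Rightarrow> ('a \<times> real) set" where
  "aff_roots \<Phi> = {(\<alpha>, n). \<alpha> \<in> \<Phi> \<and> n \<in> \<int>}"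

definition aff_pos_roots :: "'a::euclidean_space set \<Rightarrow> 'a set \<Rightarrow> ('a \<times> real) set" where
  "aff_pos_roots \<Phi> \<Delta> =
     {(\<alpha>, 0) | \<alpha>. \<alpha> \<in> pos_roots \<Phi> \<Delta>} \<union> {(\<alpha>, n). \<alpha> \<in> \<Phi> \<and> n \<in> \<int> \<and> n > 0}"

definition aff_neg_roots :: "'a::euclidean_space set \<Rightarrow> 'a set \<Rightarrow> ('a \<times> real) set" where
  "aff_neg_roots \<Phi> \<Delta> = uminus ` aff_pos_roots \<Phi> \<Delta>"

text \<open>The action of \<open>w t\<^sub>\<mu>\<close> on affine roots.\<close>

definition aff_act ::
    "('a::euclidean_space \<Rightarrow> 'a) \<Rightarrow> 'a \<Rightarrow> 'a \<times> real \<Rightarrow> 'a \<times> real" where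
  "aff_act w \<mu> \<beta> = (w (fst \<beta>), snd \<beta> - \<mu> \<bullet> fst \<beta>)"

definition aff_refl :: "'a::euclidean_space \<times> real \<Rightarrow> 'a \<Rightarrow> 'a" where
  "aff_refl \<beta> = refl_root (fst \<beta>) \<circ> transl (snd \<beta> *\<^sub>R coroot (fst \<beta>))"

text \<open>The affine simple root is \<open>\<alpha>\<^sub>0 = - \<theta> + \<delta>\<close>.\<close>

definition aff_simple_refls :: "'a::euclidean_space set \<Rightarrow> 'a set \<Rightarrow> ('a \<Rightarrow> 'a) set" where
  "aff_simple_refls \<Phi> \<Delta> = insert (aff_refl (- highest_root \<Phi> \<Delta>, 1)) (refl_root ` \<Delta>)"

definition aff_cover ::
    "'a::euclidean_space set \<Rightarrow> 'a set \<Rightarrow> ('a \<Rightarrow> 'a) \<Rightarrow> ('a \<Rightarrow> 'a) \<Rightarrow> bool" where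
  "aff_cover \<Phi> \<Delta> = bruhat_cover (aff_simple_refls \<Phi> \<Delta>) (aff_refl ` aff_roots \<Phi>)"


section \<open>Parabolic factorization and the set \<open>\<Omega>\<^sub>J\<^sup>\<infinity>\<close>\<close>

text \<open>\<open>(W\<^sub>J)\<^sub>a\<^sub>f\<close>:\<close>

definition par_aff_Weyl :: "'a::euclidean_space set \<Rightarrow> ('a \<Rightarrow> 'a) set" where
  "par_aff_Weyl J = {w \<circ> transl \<mu> | w \<mu>. w \<in> par_Weyl J \<and> \<mu> \<in> coroot_lattice J}"

definition par_aff_pos_roots ::
    "'a::euclidean_space set \<Rightarrow> 'a set \<Rightarrow> 'a set \<Rightarrow> ('a \<times> real) set" where
  "par_aff_pos_roots \<Phi> \<Delta> J = {\<beta> \<in> aff_pos_roots \<Phi> \<Delta>. fst \<beta> \<in> par_roots \<Phi> J}"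

text \<open>\<open>(W\<^sup>J)\<^sub>a\<^sub>f\<close>:\<close>

definition aff_min_reps :: "'a::euclidean_space set \<Rightarrow> 'a set \<Rightarrow> 'a set \<Rightarrow> ('a \<Rightarrow> 'a) set" where
  "aff_min_reps \<Phi> \<Delta> J =
     {w \<circ> transl \<mu> | w \<mu>. w \<in> Weyl \<Phi> \<and> \<mu> \<in> coroot_lattice \<Phi> \<and>
        (\<forall>\<beta>\<in>par_aff_pos_roots \<Phi> \<Delta> J. aff_act w \<mu> \<beta> \<in> aff_pos_roots \<Phi> \<Delta>)}"

definition aff_proj ::
    "'a::euclidean_space set \<Rightarrow> 'a set \<Rightarrow> 'a set \<Rightarrow> ('a \<Rightarrow> 'a) \<Rightarrow> 'a \<Rightarrow> 'a" where
  "aff_proj \<Phi> \<Delta> J x =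
     (THE x1. x1 \<in> aff_min_reps \<Phi> \<Delta> J \<and> (\<exists>x2\<in>par_aff_Weyl J. x = x1 \<circ> x2))"

definition J_adjusted :: "'a::euclidean_space set \<Rightarrow> 'a set \<Rightarrow> 'a set \<Rightarrow> 'a \<Rightarrow> bool" where
  "J_adjusted \<Phi> \<Delta> J \<mu> \<longleftrightarrow>
     \<mu> \<in> coroot_lattice \<Phi> \<and> (\<exists>z\<in>Weyl \<Phi>. aff_proj \<Phi> \<Delta> J (transl \<mu>) = z \<circ> transl \<mu>)"

text \<open>
  The condition \<open>\<langle>\<mu>, \<alpha>\<rangle> \<lless> 0\<close> is made precise by a threshold \<open>N\<close>, read as
  \<open>\<langle>\<mu>, \<alpha>\<rangle> \<le> - N\<close>; statements about superantidominant elements are to be made for all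
  sufficiently large \<open>N\<close>.
\<close>

definition J_superantidominant ::
    "'a::euclidean_space set \<Rightarrow> 'a set \<Rightarrow> 'a set \<Rightarrow> nat \<Rightarrow> 'a \<Rightarrow> bool" where
  "J_superantidominant \<Phi> \<Delta> J N \<mu> \<longleftrightarrow>
     \<mu> \<in> coroot_lattice \<Phi> \<and> (\<forall>\<alpha>\<in>pos_roots \<Phi> \<Delta>. \<mu> \<bullet> \<alpha> \<le> 0) \<and>
     (\<forall>\<alpha>\<in>pos_roots \<Phi> \<Delta> - par_pos_roots \<Phi> \<Delta> J. \<mu> \<bullet> \<alpha> \<le> - real N)"

definition Omega ::
    "'a::euclidean_space set \<Rightarrow> 'a set \<Rightarrow> 'a set \<Rightarrow> nat \<Rightarrow> ('a \<Rightarrow> 'a) set" where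
  "Omega \<Phi> \<Delta> J N =
     {w \<circ> aff_proj \<Phi> \<Delta> J (transl \<mu>) | w \<mu>.
        w \<in> min_reps \<Phi> \<Delta> J \<and> J_superantidominant \<Phi> \<Delta> J N \<mu> \<and> J_adjusted \<Phi> \<Delta> J \<mu>}"

definition Omega_cover ::
    "'a::euclidean_space set \<Rightarrow> 'a set \<Rightarrow> 'a set \<Rightarrow> nat \<Rightarrow> ('a \<Rightarrow> 'a) \<Rightarrow> ('a \<Rightarrow> 'a) \<Rightarrow> bool" where
  "Omega_cover \<Phi> \<Delta> J N y x \<longleftrightarrow>
     x \<in> Omega \<Phi> \<Delta> J N \<and> y \<in> Omega \<Phi> \<Delta> J N \<and> aff_cover \<Phi> \<Delta> y x \<and>
     (\<exists>\<gamma>\<in>aff_roots \<Phi>. y = x \<circ> aff_refl \<gamma> \<and> fst \<gamma> \<in> \<Phi> - par_roots \<Phi> J)"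

end

theory Submission
  imports Defs
begin

text \<open>
  For \<open>w \<in> W\<^sup>J\<close> and \<open>\<mu>\<close> that is \<open>J\<close>-adjusted and \<open>J\<close>-superantidominant, counting inversions gives
  \<open>\<ell>(wz\<^sub>\<mu>t\<^sub>\<mu>) = - \<langle>\<mu>, 2\<rho> - 2\<rho>\<^sub>J\<rangle> - \<ell>(w)\<close>. Indeed \<open>\<mu>\<close> is adjusted with \<open>z\<close> exactly if \<open>z \<in> W\<^sub>J\<close> and, for
  \<open>\<gamma> \<in> \<Phi>\<^sub>J\<^sup>+\<close>, the pairing \<open>\<langle>\<mu>, \<gamma>\<rangle>\<close> is \<open>-1\<close> or \<open>0\<close> according as \<open>z\<gamma>\<close> is negative or positive, so that the
  roots of \<open>\<Phi>\<^sub>J\<close> contribute nothing. Replacing \<open>x = wzt\<^sub>\<mu>\<close> by \<open>wr\<^sub>\<alpha>t\<^bsub>\<chi>\<alpha>\<^sup>\<or>\<^esub>zt\<^sub>\<mu>\<close> changes the length, if the result is again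
  of this form, by \<open>\<ell>(w) - \<ell>(\<lfloor>wr\<^sub>\<alpha>\<rfloor>) - \<chi>\<langle>\<alpha>\<^sup>\<or>, 2\<rho> - 2\<rho>\<^sub>J\<rangle>\<close>, and a drop by one is the edge condition.
\<close>

section \<open>Groups generated by involutions\<close>

text \<open>Length is defined by words and covers by the absence of intermediate elements, so
  neither is an inversion count from the outset. The exchange condition and the refinement of steps
  that are not covers bridge this gap; they are proved once for an abstract action on roots and used
  for both \<open>Weyl \<Phi>\<close> and \<open>aff_Weyl \<Phi>\<close>. The group (W_J)_af is not
  a further instance, as \<Phi>_J may be reducible; uniqueness of the factorization comes instead
  from a vanishing argument for lattice elements whose pairings with \<Phi>_J are at most 1 in
  absolute value. In the quantum case the translation part moves from \<mu> to
  \<open>\<mu> + coroot (inv z \<alpha>)\<close>. The move also raises pairings with roots outside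
  \<Phi>_J, by at most the maximum \<open>d\<close> of the pairings of coroots with roots. This is
  why lifting starts from the threshold \<open>N + d\<close> to arrive at \<open>N\<close>. The
  bound \<open>N \<ge> 2\<close> makes the connecting root negative once its classical part is taken
  positive.\<close>

lemma word_prod_Nil [simp]: "word_prod [] = id"
  by (simp add: word_prod_def)

lemma word_prod_Cons [simp]: "word_prod (s # ss) = s \<circ> word_prod ss"
  by (simp add: word_prod_def)

lemma word_prod_append [simp]: "word_prod (ss @ ts) = word_prod ss \<circ> word_prod ts"
  by (induction ss) (simp_all add: comp_assoc)

lemma generated_id [simp]: "id \<in> generated S"
  unfolding generated_def by (auto intro!: exI[of _ "[]"])

lemma generated_base: "s \<in> S \<Longrightarrow> s \<in> generated S"
  unfolding generated_def by (auto intro!: exI[of _ "[s]"])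

lemma generated_comp: "x \<in> generated S \<Longrightarrow> y \<in> generated S \<Longrightarrow> x \<circ> y \<in> generated S"
  unfolding generated_def
proof clarsimp
  fix ss ts assume "set ss \<subseteq> S" "set ts \<subseteq> S"
  then show "\<exists>us. word_prod ss \<circ> word_prod ts = word_prod us \<and> set us \<subseteq> S"
    by (intro exI[of _ "ss @ ts"]) simp
qed

lemma generated_induct [consumes 1, case_names id comp]:
  assumes "x \<in> generated S" and "Q id"
    and "\<And>s y. s \<in> S \<Longrightarrow> y \<in> generated S \<Longrightarrow> Q y \<Longrightarrow> Q (s \<circ> y)"
  shows "Q x"
proof -
  have "set ss \<subseteq> S \<Longrightarrow> Q (word_prod ss)" for ss
  proof (induction ss)
    case (Cons s ss)
    then have "s \<in> S" "word_prod ss \<in> generated S" "Q (word_prod ss)"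
      by (auto simp: generated_def)
    then show ?case unfolding word_prod_Cons by (rule assms(3))
  qed (simp add: assms(2))
  then show ?thesis using assms(1) by (auto simp: generated_def)
qed

lemma generated_subset: "S \<subseteq> generated T \<Longrightarrow> generated S \<subseteq> generated T"
proof
  fix x assume "S \<subseteq> generated T" "x \<in> generated S"
  from this(2,1) show "x \<in> generated T"
    by (induction rule: generated_induct) (auto intro: generated_comp)
qed

lemma generated_inverse:
  assumes "\<And>s. s \<in> S \<Longrightarrow> s \<circ> s = id" and "x \<in> generated S"
  obtains y where "y \<in> generated S" "x \<circ> y = id" "y \<circ> x = id"
proof -
  have "\<exists>y\<in>generated S. x \<circ> y = id \<and> y \<circ> x = id"
    using assms(2)
  proof (induction rule: generated_induct)
    case id
    show ?case by (rule bexI[of _ id]) auto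
  next
    case (comp s y)
    then obtain y' where y': "y' \<in> generated S" "y \<circ> y' = id" "y' \<circ> y = id" by blast
    have ss: "s \<circ> s = id" by (rule assms(1)) (rule comp)
    have "(s \<circ> y) \<circ> (y' \<circ> s) = s \<circ> (y \<circ> y') \<circ> s" "(y' \<circ> s) \<circ> (s \<circ> y) = y' \<circ> (s \<circ> s) \<circ> y"
      by (simp_all add: comp_assoc)
    then have "(s \<circ> y) \<circ> (y' \<circ> s) = id" "(y' \<circ> s) \<circ> (s \<circ> y) = id"
      using y' ss by simp_all
    moreover have "y' \<circ> s \<in> generated S"
      by (rule generated_comp[OF y'(1) generated_base[OF comp(1)]])
    ultimately show ?case by blast
  qed
  then show ?thesis using that by blast
qed

lemma generated_inv:
  assumes "\<And>s. s \<in> S \<Longrightarrow> s \<circ> s = id" and "x \<in> generated S"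
  shows "bij x" "inv x \<in> generated S"
proof -
  obtain y where y: "y \<in> generated S" "x \<circ> y = id" "y \<circ> x = id"
    using generated_inverse[OF assms] by blast
  then show "bij x" using o_bij by blast
  have "inv x = y" by (rule inv_unique_comp) (use y in auto)
  then show "inv x \<in> generated S" using y by simp
qed


lemma word_length_attained:
  assumes "x \<in> generated S"
  obtains ss where "length ss = word_length S x" "set ss \<subseteq> S" "x = word_prod ss"
proof -
  have "\<exists>n ss. length ss = n \<and> set ss \<subseteq> S \<and> x = word_prod ss"
    using assms by (auto simp: generated_def)
  then have "\<exists>ss. length ss = word_length S x \<and> set ss \<subseteq> S \<and> x = word_prod ss"
    unfolding word_length_def by (rule LeastI_ex)
  then show ?thesis using that by blast
qed

lemma word_length_le:
  "set ss \<subseteq> S \<Longrightarrow> word_length S (word_prod ss) \<le> length ss"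
  unfolding word_length_def by (rule Least_le) auto

section \<open>Length and Bruhat covers from an action on roots\<close>

text \<open>Isolates what W acting on \<Phi> and W_af acting on the affine roots have in common.
  \<open>act\<close> is a parameter because an affine transformation does not act on affine roots by
  application, and \<open>P\<close> may be infinite. The decisive axioms are
  \<open>refl_generated\<close> and \<open>simple_perm\<close>; the others are mostly
  formal.\<close>

locale reflection_action =
  fixes act :: "('a \<Rightarrow> 'a) \<Rightarrow> 'r::group_add \<Rightarrow> 'r"
    and refl :: "'r \<Rightarrow> 'a \<Rightarrow> 'a"
    and P D :: "'r set"
  assumes pos_not_neg: "\<beta> \<in> P \<Longrightarrow> - \<beta> \<notin> P"
    and simple_pos: "D \<subseteq> P"
    and refl_generated: "\<beta> \<in> P \<Longrightarrow> refl \<beta> \<in> generated (refl ` D)"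
    and act_id [simp]: "act id \<beta> = \<beta>"
    and act_comp: "x \<in> generated (refl ` D) \<Longrightarrow> y \<in> generated (refl ` D) \<Longrightarrow>
          act (x \<circ> y) \<beta> = act x (act y \<beta>)"
    and act_uminus: "x \<in> generated (refl ` D) \<Longrightarrow> act x (- \<beta>) = - act x \<beta>"
    and act_root: "x \<in> generated (refl ` D) \<Longrightarrow> \<beta> \<in> P \<Longrightarrow> act x \<beta> \<in> P \<or> - act x \<beta> \<in> P"
    and refl_invol: "\<beta> \<in> P \<Longrightarrow> refl \<beta> \<circ> refl \<beta> = id"
    and act_refl: "\<beta> \<in> P \<Longrightarrow> act (refl \<beta>) \<beta> = - \<beta>"
    and conj_refl: "x \<in> generated (refl ` D) \<Longrightarrow> \<beta> \<in> P \<Longrightarrow> x \<circ> refl \<beta> = refl (act x \<beta>) \<circ> x"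
    and simple_perm: "a \<in> D \<Longrightarrow> \<beta> \<in> P \<Longrightarrow> \<beta> \<noteq> a \<Longrightarrow> act (refl a) \<beta> \<in> P"
begin

abbreviation "G \<equiv> generated (refl ` D)"
abbreviation "len \<equiv> word_length (refl ` D)"

definition inversions :: "('a \<Rightarrow> 'a) \<Rightarrow> 'r set" where
  "inversions x = {\<beta> \<in> P. act x \<beta> \<notin> P}"

lemma simple_invol: "s \<in> refl ` D \<Longrightarrow> s \<circ> s = id"
  using refl_invol simple_pos by blast

lemma simple_G: "a \<in> D \<Longrightarrow> refl a \<in> G"
  by (rule generated_base) auto

lemma refl_comp_refl: "\<beta> \<in> P \<Longrightarrow> x \<circ> refl \<beta> \<circ> refl \<beta> = x"
  by (simp add: comp_assoc refl_invol)

lemma act_refl_refl: "\<beta> \<in> P \<Longrightarrow> act (refl \<beta>) (act (refl \<beta>) \<gamma>) = \<gamma>"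
  by (metis act_comp act_id refl_generated refl_invol)

lemma act_comp_refl: "x \<in> G \<Longrightarrow> \<beta> \<in> P \<Longrightarrow> act (x \<circ> refl \<beta>) \<beta> = - act x \<beta>"
  by (simp add: act_comp refl_generated act_refl act_uminus)

lemma act_comp_refl_pos_iff:
  "x \<in> G \<Longrightarrow> \<beta> \<in> P \<Longrightarrow> act (x \<circ> refl \<beta>) \<beta> \<in> P \<longleftrightarrow> act x \<beta> \<notin> P"
  using act_root[of x \<beta>] pos_not_neg[of "act x \<beta>"] by (auto simp: act_comp_refl)

text \<open>\<open>refl a\<close> permutes \<open>P - {a}\<close>, so an ascent at \<open>a\<close>
  keeps the old inversions, moved by \<open>refl a\<close>, and adds only \<open>a\<close>.\<close>

lemma inversions_simple:
  assumes x: "x \<in> G" and a: "a \<in> D" and up: "act x a \<in> P"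
  shows "inversions (x \<circ> refl a) = insert a (act (refl a) ` inversions x)"
proof -
  have aP: "a \<in> P" using a simple_pos by blast
  note c = act_comp[OF x simple_G[OF a]]
  show ?thesis
  proof (intro equalityI subsetI)
    fix \<beta> assume "\<beta> \<in> inversions (x \<circ> refl a)"
    then have \<beta>: "\<beta> \<in> P" "act x (act (refl a) \<beta>) \<notin> P" by (auto simp: inversions_def c)
    show "\<beta> \<in> insert a (act (refl a) ` inversions x)"
    proof (cases "\<beta> = a")
      case False
      then have "act (refl a) \<beta> \<in> inversions x" using \<beta> simple_perm[OF a] by (auto simp: inversions_def)
      moreover have "\<beta> = act (refl a) (act (refl a) \<beta>)" using act_refl_refl[OF aP] by simp
      ultimately show ?thesis by blast
    qed simp
  next
    fix \<beta> assume "\<beta> \<in> insert a (act (refl a) ` inversions x)"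
    then consider "\<beta> = a" | \<gamma> where "\<gamma> \<in> inversions x" "\<beta> = act (refl a) \<gamma>" by blast
    then show "\<beta> \<in> inversions (x \<circ> refl a)"
    proof cases
      case 1
      then show ?thesis using act_comp_refl_pos_iff[OF x aP] up aP by (auto simp: inversions_def)
    next
      case 2
      then have "\<gamma> \<noteq> a" using up by (auto simp: inversions_def)
      then show ?thesis using 2 simple_perm[OF a] act_refl_refl[OF aP] by (auto simp: inversions_def c)
    qed
  qed
qed

lemma card_inversions_simple:
  assumes x: "x \<in> G" and a: "a \<in> D" and up: "act x a \<in> P" and fin: "finite (inversions x)"
  shows "finite (inversions (x \<circ> refl a))" "card (inversions (x \<circ> refl a)) = Suc (card (inversions x))"
proof -
  have aP: "a \<in> P" using a simple_pos by blast
  show "finite (inversions (x \<circ> refl a))" by (simp add: inversions_simple[OF x a up] fin)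
  have "a \<notin> act (refl a) ` inversions x"
  proof
    assume "a \<in> act (refl a) ` inversions x"
    then obtain \<gamma> where "\<gamma> \<in> P" "a = act (refl a) \<gamma>" by (auto simp: inversions_def)
    then have "- a \<in> P" using act_refl_refl[OF aP] act_refl[OF aP] by metis
    then show False using aP pos_not_neg by blast
  qed
  moreover have "inj_on (act (refl a)) (inversions x)"
    by (rule inj_on_inverseI[of _ "act (refl a)"]) (rule act_refl_refl[OF aP])
  ultimately show "card (inversions (x \<circ> refl a)) = Suc (card (inversions x))"
    by (simp add: inversions_simple[OF x a up] fin card_image)
qed

lemma len_id [simp]: "len id = 0"
  using word_length_le[of "[]"] by simp

text \<open>Strong exchange: while \<beta> is carried through the word from the right, its image
  turns negative at some letter \<open>refl a\<close>. By \<open>simple_perm\<close> the image just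
  before that letter is \<open>a\<close>, so conjugation carries \<open>refl \<beta>\<close> to this
  letter and cancels it.\<close>

lemma exchange:
  "set ss \<subseteq> refl ` D \<Longrightarrow> \<beta> \<in> P \<Longrightarrow> act (word_prod ss) \<beta> \<notin> P \<Longrightarrow>
    \<exists>ts. set ts \<subseteq> refl ` D \<and> length ts < length ss \<and> word_prod ss \<circ> refl \<beta> = word_prod ts"
proof (induction ss)
  case (Cons s ss)
  then obtain a where a: "a \<in> D" "s = refl a" by auto
  let ?y = "word_prod ss"
  have y: "?y \<in> G" using Cons.prems by (auto simp: generated_def)
  show ?case
  proof (cases "act ?y \<beta> \<in> P")
    case True
    have "act (refl a) (act ?y \<beta>) \<notin> P"
      using Cons.prems(3) unfolding word_prod_Cons a(2) act_comp[OF simple_G[OF a(1)] y] .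
    then have "act ?y \<beta> = a" using simple_perm[OF a(1) True] by blast
    then have "s \<circ> ?y \<circ> refl \<beta> = s \<circ> s \<circ> ?y"
      using conj_refl[OF y Cons.prems(2)] a by (simp add: comp_assoc)
    also have "\<dots> = ?y" using simple_invol[of s] Cons.prems(1) by simp
    finally have "word_prod (s # ss) \<circ> refl \<beta> = ?y" by simp
    then show ?thesis using Cons.prems(1) by (intro exI[of _ ss]) (simp del: word_prod_Cons)
  next
    case False
    then obtain ts where ts: "set ts \<subseteq> refl ` D" "length ts < length ss" "?y \<circ> refl \<beta> = word_prod ts"
      using Cons.IH Cons.prems by (metis set_subset_Cons subset_trans)
    then have "word_prod (s # ss) \<circ> refl \<beta> = word_prod (s # ts)" by (simp add: comp_assoc)
    moreover have "set (s # ts) \<subseteq> refl ` D" "length (s # ts) < length (s # ss)"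
      using ts Cons.prems by auto
    ultimately show ?thesis by blast
  qed
qed simp

lemma len_refl_less:
  assumes x: "x \<in> G" and \<beta>: "\<beta> \<in> P" and neg: "act x \<beta> \<notin> P"
  shows "len (x \<circ> refl \<beta>) < len x"
proof -
  obtain ss where ss: "length ss = len x" "set ss \<subseteq> refl ` D" "x = word_prod ss"
    using word_length_attained[OF x] by metis
  then obtain ts where "set ts \<subseteq> refl ` D" "length ts < length ss" "x \<circ> refl \<beta> = word_prod ts"
    using exchange[OF ss(2) \<beta>] neg by auto
  then show ?thesis using word_length_le[of ts "refl ` D"] ss by simp
qed

text \<open>The converse applies \<open>len_refl_less\<close> to
  \<open>x \<circ> refl \<beta>\<close>, which has the opposite sign at \<beta>.\<close>

lemma len_refl_less_iff:
  assumes x: "x \<in> G" and \<beta>: "\<beta> \<in> P"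
  shows "len (x \<circ> refl \<beta>) < len x \<longleftrightarrow> act x \<beta> \<notin> P"
proof
  assume *: "len (x \<circ> refl \<beta>) < len x"
  show "act x \<beta> \<notin> P"
  proof
    assume "act x \<beta> \<in> P"
    then have "len (x \<circ> refl \<beta> \<circ> refl \<beta>) < len (x \<circ> refl \<beta>)"
      using act_comp_refl_pos_iff[OF x \<beta>] generated_comp[OF x refl_generated[OF \<beta>]]
      by (intro len_refl_less \<beta>) auto
    with * show False by (simp add: refl_comp_refl \<beta>)
  qed
qed (rule len_refl_less[OF x \<beta>])

lemma len_less_refl_iff:
  assumes x: "x \<in> G" and \<beta>: "\<beta> \<in> P"
  shows "len x < len (x \<circ> refl \<beta>) \<longleftrightarrow> act x \<beta> \<in> P"
  using len_refl_less_iff[OF generated_comp[OF x refl_generated[OF \<beta>]] \<beta>]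
  by (simp add: refl_comp_refl \<beta> act_comp_refl_pos_iff x)

lemma len_simple_le:
  assumes x: "x \<in> G" and a: "a \<in> D"
  shows "len (x \<circ> refl a) \<le> Suc (len x)"
proof -
  obtain ss where ss: "length ss = len x" "set ss \<subseteq> refl ` D" "x = word_prod ss"
    using word_length_attained[OF x] by metis
  then show ?thesis using word_length_le[of "ss @ [refl a]" "refl ` D"] a by auto
qed

text \<open>One letter changes the length by at most one, and the sign of \<open>act x a\<close>
  gives the direction. The second form avoids truncated subtraction: it also records that
  \<open>len x\<close> is positive at a descent.\<close>

lemma len_simple:
  assumes x: "x \<in> G" and a: "a \<in> D"
  shows "len (x \<circ> refl a) = (if act x a \<in> P then len x + 1 else len x - 1)"
    and "act x a \<notin> P \<Longrightarrow> len x = Suc (len (x \<circ> refl a))"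
proof -
  have aP: "a \<in> P" using a simple_pos by blast
  have xa: "x \<circ> refl a \<in> G" using generated_comp[OF x simple_G[OF a]] .
  have 1: "len (x \<circ> refl a) \<le> Suc (len x)" "len x \<le> Suc (len (x \<circ> refl a))"
    using len_simple_le[OF x a] len_simple_le[OF xa a] by (simp_all add: refl_comp_refl aP)
  note len_refl_less_iff[OF x aP] len_less_refl_iff[OF x aP]
  with 1 show "len (x \<circ> refl a) = (if act x a \<in> P then len x + 1 else len x - 1)"
    "act x a \<notin> P \<Longrightarrow> len x = Suc (len (x \<circ> refl a))"
    by (cases "act x a \<in> P"; auto)+
qed

text \<open>The last letter of a reduced word is a descent, because deleting it shortens the
  word.\<close>

lemma simple_descent:
  assumes x: "x \<in> G" and "x \<noteq> id"
  obtains a where "a \<in> D" "act x a \<notin> P"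
proof -
  obtain ss where ss: "length ss = len x" "set ss \<subseteq> refl ` D" "x = word_prod ss"
    using word_length_attained[OF x] by metis
  with \<open>x \<noteq> id\<close> have "ss \<noteq> []" by auto
  then obtain ts s where ts: "ss = ts @ [s]" by (metis append_butlast_last_id)
  then obtain a where a: "a \<in> D" "s = refl a" using ss by auto
  have aP: "a \<in> P" using a simple_pos by blast
  have "x \<circ> refl a = word_prod ts"
    using ss ts a by (simp add: comp_assoc refl_invol aP)
  then have "len (x \<circ> refl a) < len x"
    using word_length_le[of ts "refl ` D"] ss ts by auto
  then show ?thesis using that[OF a(1)] len_refl_less_iff[OF x aP] by blast
qed

text \<open>Induction on length, removing a descent at each step. Finiteness is proved along with
  the count, since \<open>P\<close> itself may be infinite.\<close>

lemma finite_card_inversions: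
  assumes "x \<in> G"
  shows "finite (inversions x) \<and> card (inversions x) = len x"
  using assms
proof (induction "len x" arbitrary: x rule: less_induct)
  case less
  show ?case
  proof (cases "x = id")
    case True
    have "inversions id = {}" by (auto simp: inversions_def)
    then show ?thesis using True by simp
  next
    case False
    then obtain a where a: "a \<in> D" "act x a \<notin> P" using simple_descent less.prems by blast
    have aP: "a \<in> P" using a simple_pos by blast
    let ?y = "x \<circ> refl a"
    have y: "?y \<in> G" using generated_comp[OF less.prems simple_G[OF a(1)]] .
    have l: "len x = Suc (len ?y)" using len_simple(2)[OF less.prems a] .
    have up: "act ?y a \<in> P" using act_comp_refl_pos_iff[OF less.prems aP] a by simp
    have "finite (inversions ?y) \<and> card (inversions ?y) = len ?y" using less.hyps y l by simp
    then show ?thesis using card_inversions_simple[OF y a(1) up] l by (simp add: refl_comp_refl aP)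
  qed
qed

lemma len_eq_card: "x \<in> G \<Longrightarrow> len x = card {\<beta> \<in> P. act x \<beta> \<notin> P}"
  using finite_card_inversions by (simp add: inversions_def)

lemma eq_id_if_pos: "x \<in> G \<Longrightarrow> (\<And>\<beta>. \<beta> \<in> P \<Longrightarrow> act x \<beta> \<in> P) \<Longrightarrow> x = id"
  using simple_descent simple_pos by blast

section \<open>Bruhat order: lifting property, chain property and covers\<close>

abbreviation "edge u v \<equiv> u \<in> G \<and> (\<exists>t\<in>refl ` P. v = u \<circ> t) \<and> len u < len v"
abbreviation "lessB \<equiv> bruhat_less (refl ` D) (refl ` P)"

lemma lessB_edge: "edge u v \<Longrightarrow> lessB u v"
  unfolding bruhat_less_def by (rule tranclp.r_into_trancl)

lemma lessB_trans: "lessB u v \<Longrightarrow> lessB v w \<Longrightarrow> lessB u w"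
  unfolding bruhat_less_def by (rule tranclp_trans)

lemma lessB_induct [consumes 1, case_names edge trans]:
  assumes "lessB u v" and "\<And>u v. edge u v \<Longrightarrow> Q u v"
    and "\<And>u v w. lessB u v \<Longrightarrow> lessB v w \<Longrightarrow> Q u v \<Longrightarrow> Q v w \<Longrightarrow> Q u w"
  shows "Q u v"
  using assms unfolding bruhat_less_def by (rule tranclp_trans_induct)

lemma lessB_len: "lessB u v \<Longrightarrow> u \<in> G \<and> v \<in> G \<and> len u < len v"
  by (induction rule: lessB_induct) (auto intro: generated_comp refl_generated)

lemma edge_refl_iff: "u \<in> G \<Longrightarrow> \<beta> \<in> P \<Longrightarrow> edge u (u \<circ> refl \<beta>) \<longleftrightarrow> act u \<beta> \<in> P"
  using len_less_refl_iff by auto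

lemma edge_simple_left: "u \<in> G \<Longrightarrow> a \<in> D \<Longrightarrow> act u a \<in> P \<Longrightarrow> edge u (u \<circ> refl a)"
  using edge_refl_iff simple_pos by blast

lemma edge_simple_right:
  assumes u: "u \<in> G" and a: "a \<in> D" and "act u a \<notin> P"
  shows "edge (u \<circ> refl a) u"
proof -
  have aP: "a \<in> P" using a simple_pos by blast
  have "edge (u \<circ> refl a) (u \<circ> refl a \<circ> refl a)"
    using act_comp_refl_pos_iff[OF u aP] assms(3)
    by (intro edge_simple_left generated_comp[OF u] simple_G a) blast
  then show ?thesis unfolding refl_comp_refl[OF aP] .
qed

lemma edge_cases:
  assumes "edge u v"
  obtains \<beta> where "\<beta> \<in> P" "v = u \<circ> refl \<beta>" "u \<in> G" "v \<in> G" "act u \<beta> \<in> P"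
  using assms edge_refl_iff generated_comp refl_generated by blast

text \<open>Right multiplication by \<open>refl a\<close> turns \<beta> into its image under
  \<open>refl a\<close>, which is still positive as \<beta> differs from \<open>a\<close>; and
  \<open>u \<circ> refl a\<close> sends that image to \<open>act u \<beta>\<close> again.\<close>

lemma edge_shift:
  assumes u: "u \<in> G" and \<beta>: "\<beta> \<in> P" "act u \<beta> \<in> P" and a: "a \<in> D" "\<beta> \<noteq> a"
  shows "edge (u \<circ> refl a) (u \<circ> refl \<beta> \<circ> refl a)"
proof -
  have aP: "a \<in> P" using a simple_pos by blast
  let ?\<gamma> = "act (refl a) \<beta>"
  have g: "?\<gamma> \<in> P" using simple_perm[OF a(1) \<beta>(1) a(2)] .
  have "refl a \<circ> refl ?\<gamma> = refl \<beta> \<circ> refl a"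
    using conj_refl[OF simple_G[OF a(1)] g] by (simp add: act_refl_refl aP)
  then have 1: "u \<circ> refl \<beta> \<circ> refl a = u \<circ> refl a \<circ> refl ?\<gamma>" by (simp add: comp_assoc)
  have "act (u \<circ> refl a) ?\<gamma> = act u \<beta>"
    by (simp add: act_comp[OF u simple_G[OF a(1)]] act_refl_refl aP)
  then show ?thesis
    unfolding 1 using edge_refl_iff[OF generated_comp[OF u simple_G[OF a(1)]] g] \<beta>(2) by simp
qed

text \<open>The larger of \<open>x\<close> and \<open>x \<circ> refl a\<close> in Bruhat order; it
  serves to transport chains upwards across a descent.\<close>

definition lift :: "'r \<Rightarrow> ('a \<Rightarrow> 'a) \<Rightarrow> 'a \<Rightarrow> 'a" where
  "lift a x = (if act x a \<in> P then x \<circ> refl a else x)"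

text \<open>Checked on single reflection steps. If the step is by \<open>a\<close> itself, both ends
  lift to the same element, which is why equality is allowed; otherwise \<open>edge_shift\<close>
  gives the shifted step, and the signs of \<open>act u a\<close> and \<open>act v a\<close> decide
  which steps are composed.\<close>

lemma lift_mono:
  assumes "lessB u v" and a: "a \<in> D"
  shows "lessB (lift a u) (lift a v) \<or> lift a u = lift a v"
  using assms(1)
proof (induction rule: lessB_induct)
  case (edge u v)
  from edge_cases[OF edge] obtain \<beta> where
    \<beta>: "\<beta> \<in> P" "v = u \<circ> refl \<beta>" "u \<in> G" "v \<in> G" "act u \<beta> \<in> P" by metis
  have aP: "a \<in> P" using a simple_pos by blast
  show ?case
  proof (cases "\<beta> = a")
    case True
    then have "act v a \<notin> P" using \<beta> act_comp_refl_pos_iff aP by metis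
    moreover have "act u a \<in> P" using True \<beta> by simp
    ultimately have "lift a u = u \<circ> refl a" "lift a v = v" unfolding lift_def by metis+
    then show ?thesis using True \<beta> by metis
  next
    case False
    have 1: "lessB (u \<circ> refl a) (v \<circ> refl a)"
      using edge_shift[OF \<beta>(3,1,5) a False] \<beta>(2) lessB_edge by blast
    have down: "act v a \<notin> P \<Longrightarrow> lessB (v \<circ> refl a) v"
      using edge_simple_right[OF \<beta>(4) a] lessB_edge by blast
    have up: "act v a \<in> P \<Longrightarrow> lessB v (v \<circ> refl a)"
      using edge_simple_left[OF \<beta>(4) a] lessB_edge by blast
    note 4 = lessB_edge[OF edge]
    consider "act u a \<in> P" "act v a \<in> P" | "act u a \<in> P" "act v a \<notin> P"
      | "act u a \<notin> P" "act v a \<in> P" | "act u a \<notin> P" "act v a \<notin> P" by blast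
    then have "lessB (lift a u) (lift a v)"
    proof cases
      case 2
      with lessB_trans[OF 1 down] show ?thesis by (simp add: lift_def)
    next
      case 3
      with lessB_trans[OF 4 up] show ?thesis by (simp add: lift_def)
    qed (use 1 4 in \<open>simp_all only: lift_def if_True if_False\<close>)
    then show ?thesis ..
  qed
next
  case (trans u v w)
  then show ?case using lessB_trans by metis
qed

text \<open>Leads from the absence of intermediate elements to a length difference of one. Take a
  descent \<open>a\<close> of \<open>v\<close>. If \<open>a\<close> is an ascent of
  \<open>u\<close>, then \<open>u \<circ> refl a\<close> lies between; otherwise the shorter pair
  \<open>u \<circ> refl a\<close>, \<open>v \<circ> refl a\<close> is refined by induction and its
  intermediate element is lifted back.\<close>

lemma chain_property:
  assumes "edge u v" and "len v \<noteq> Suc (len u)"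
  shows "\<exists>z. lessB u z \<and> lessB z v"
  using assms
proof (induction "len v" arbitrary: u v rule: less_induct)
  case less
  from edge_cases[OF less.prems(1)] obtain \<beta> where
    \<beta>: "\<beta> \<in> P" "v = u \<circ> refl \<beta>" "u \<in> G" "v \<in> G" "act u \<beta> \<in> P" by metis
  have "v \<noteq> id" using less.prems(1) by auto
  then obtain a where a: "a \<in> D" "act v a \<notin> P" using simple_descent[OF \<beta>(4)] by metis
  have aP: "a \<in> P" using a simple_pos by blast
  \<comment> \<open>Equality would make the length difference one.\<close>
  have ne: "\<beta> \<noteq> a"
    using less.prems(2) len_simple(1)[OF \<beta>(3) a(1)] \<beta> by auto
  let ?u = "u \<circ> refl a" and ?v = "v \<circ> refl a"
  have e: "edge ?u ?v" using edge_shift[OF \<beta>(3,1,5) a(1) ne] \<beta>(2) by simp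
  have ev: "edge ?v v" using edge_simple_right[OF \<beta>(4) a] .
  show ?case
  proof (cases "act u a \<in> P")
    case True
    then have "lessB u ?u" using edge_simple_left[OF \<beta>(3) a(1)] lessB_edge by blast
    moreover have "lessB ?u v" using lessB_trans[OF lessB_edge[OF e] lessB_edge[OF ev]] .
    ultimately show ?thesis by blast
  next
    case False
    have lens: "len u = Suc (len ?u)" "len v = Suc (len ?v)"
      using len_simple(2)[OF \<beta>(3) a(1) False] len_simple(2)[OF \<beta>(4) a] by auto
    then obtain z where z: "lessB ?u z" "lessB z ?v"
      using less.hyps[OF _ e] less.prems(2) by auto
    have "lift a ?u = u" "lift a ?v = v"
      using act_comp_refl_pos_iff[OF _ aP] \<beta> a False by (auto simp: lift_def refl_comp_refl aP)
    then have m: "lessB u (lift a z) \<or> u = lift a z" "lessB (lift a z) v \<or> lift a z = v"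
      using lift_mono[OF z(1) a(1)] lift_mono[OF z(2) a(1)] by auto
    have zG: "z \<in> G" "len ?u < len z" "len z < len ?v" using lessB_len z by blast+
    have "len (lift a z) \<le> Suc (len z)" using len_simple_le[OF zG(1) a(1)] by (auto simp: lift_def)
    then have nv: "lift a z \<noteq> v" using zG lens by auto
    show ?thesis
    proof (cases "u = lift a z")
      case True
      \<comment> \<open>\<open>z\<close> is \<open>u\<close> or \<open>u \<circ> refl a\<close>, and
        its length excludes the latter. Then \<open>v \<circ> refl a\<close> serves as the
        intermediate element instead.\<close>
      then have "z = u"
        using zG(2) refl_comp_refl[OF aP, of z] unfolding lift_def by (metis less_irrefl)
      then show ?thesis using z(2) lessB_edge[OF ev] by blast
    next
      case False
      then show ?thesis using m nv by blast
    qed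
  qed
qed

text \<open>A cover is a single reflection step, since the last step of a longer chain would leave
  an intermediate element, and \<open>chain_property\<close> fixes its length. Conversely, Bruhat
  order strictly increases length, so a difference of one leaves no room.\<close>

lemma cover_iff:
  "bruhat_cover (refl ` D) (refl ` P) u v \<longleftrightarrow>
    u \<in> G \<and> (\<exists>\<beta>\<in>P. v = u \<circ> refl \<beta>) \<and> len v = Suc (len u)"
proof
  assume c: "bruhat_cover (refl ` D) (refl ` P) u v"
  then have l: "lessB u v" and no: "\<not> (\<exists>z. lessB u z \<and> lessB z v)" by (auto simp: bruhat_cover_def)
  have "edge u v"
    using l unfolding bruhat_less_def
  proof (cases rule: tranclp.cases)
    case (trancl_into_trancl b)
    then have "lessB u b \<and> lessB b v" using lessB_edge unfolding bruhat_less_def by blast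
    with no show ?thesis by blast
  qed
  moreover from this chain_property no have "len v = Suc (len u)" by blast
  ultimately show "u \<in> G \<and> (\<exists>\<beta>\<in>P. v = u \<circ> refl \<beta>) \<and> len v = Suc (len u)" by auto
next
  assume *: "u \<in> G \<and> (\<exists>\<beta>\<in>P. v = u \<circ> refl \<beta>) \<and> len v = Suc (len u)"
  then have "lessB u v" by (intro lessB_edge) auto
  moreover have "\<not> (lessB u z \<and> lessB z v)" for z
  proof
    assume "lessB u z \<and> lessB z v"
    then have "len u < len z" "len z < len v" using lessB_len by blast+
    then show False using * by simp
  qed
  ultimately show "bruhat_cover (refl ` D) (refl ` P) u v" unfolding bruhat_cover_def by blast
qed

end


section \<open>Finite root systems\<close>

lemma int_span_0: "0 \<in> int_span S"
  unfolding int_span_def by (intro CollectI exI[of _ "\<lambda>_. 0"]) simp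

lemma int_span_add: "x \<in> int_span S \<Longrightarrow> y \<in> int_span S \<Longrightarrow> x + y \<in> int_span S"
  unfolding int_span_def
proof clarify
  fix c d :: "'a \<Rightarrow> int"
  show "\<exists>e. (\<Sum>\<alpha>\<in>S. real_of_int (c \<alpha>) *\<^sub>R \<alpha>) + (\<Sum>\<alpha>\<in>S. real_of_int (d \<alpha>) *\<^sub>R \<alpha>) =
      (\<Sum>\<alpha>\<in>S. real_of_int (e \<alpha>) *\<^sub>R \<alpha>) \<and> True"
    by (intro exI[of _ "\<lambda>a. c a + d a"]) (simp add: sum.distrib scaleR_add_left)
qed

lemma int_span_uminus: "x \<in> int_span S \<Longrightarrow> - x \<in> int_span S"
  unfolding int_span_def
proof clarify
  fix c :: "'a \<Rightarrow> int"
  show "\<exists>e. - (\<Sum>\<alpha>\<in>S. real_of_int (c \<alpha>) *\<^sub>R \<alpha>) = (\<Sum>\<alpha>\<in>S. real_of_int (e \<alpha>) *\<^sub>R \<alpha>) \<and> True"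
    by (intro exI[of _ "\<lambda>a. - c a"]) (simp add: sum_negf)
qed

lemma int_span_diff: "x \<in> int_span S \<Longrightarrow> y \<in> int_span S \<Longrightarrow> x - y \<in> int_span S"
  using int_span_add[of x S "- y"] int_span_uminus by auto

lemma int_span_base: "finite S \<Longrightarrow> s \<in> S \<Longrightarrow> s \<in> int_span S"
  unfolding int_span_def
proof (intro CollectI exI conjI TrueI)
  assume "finite S" "s \<in> S"
  then show "s = (\<Sum>\<alpha>\<in>S. real_of_int (if \<alpha> = s then 1 else 0) *\<^sub>R \<alpha>)"
    by (subst sum.remove[of S s]) (auto intro!: sum.neutral)
qed

lemma int_span_induct [consumes 1, case_names zero base add uminus]:
  assumes "x \<in> int_span S" and 0: "Q 0" and b: "\<And>s. s \<in> S \<Longrightarrow> Q s"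
    and a: "\<And>x y. Q x \<Longrightarrow> Q y \<Longrightarrow> Q (x + y)" and m: "\<And>x. Q x \<Longrightarrow> Q (- x)"
  shows "Q x"
proof -
  obtain c where x: "x = (\<Sum>s\<in>S. real_of_int (c s) *\<^sub>R s)" using assms(1) by (auto simp: int_span_def)
  have n: "Q (real n *\<^sub>R s)" if "s \<in> S" for n s
    by (induction n) (auto simp: 0 scaleR_add_left intro: a b that)
  have "Q (real_of_int k *\<^sub>R s)" if "s \<in> S" for k s
    using n[OF that, of "nat k"] m[OF n[OF that, of "nat (- k)"]] by (cases "k \<ge> 0") auto
  moreover have "(\<And>s. s \<in> S \<Longrightarrow> Q (f s)) \<Longrightarrow> Q (sum f S)" for f
    by (induction S rule: infinite_finite_induct) (auto simp: 0 intro: a)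
  ultimately show ?thesis by (simp add: x)
qed

lemma int_span_scale:
  assumes "x \<in> int_span S" "k \<in> \<int>" shows "k *\<^sub>R x \<in> int_span S"
proof -
  obtain i where "k = real_of_int i" using assms(2) by (auto elim: Ints_cases)
  moreover obtain c where "x = (\<Sum>s\<in>S. real_of_int (c s) *\<^sub>R s)" using assms(1) by (auto simp: int_span_def)
  ultimately have "k *\<^sub>R x = (\<Sum>s\<in>S. real_of_int (i * c s) *\<^sub>R s)"
    by (simp add: scaleR_right.sum)
  then show ?thesis unfolding int_span_def by (intro CollectI exI[of _ "\<lambda>s. i * c s"]) simp
qed

lemma int_span_linear_image:
  assumes "linear f" "\<And>s. s \<in> S \<Longrightarrow> f s \<in> int_span T" "x \<in> int_span S"
  shows "f x \<in> int_span T"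
  using assms(3)
  by (induction rule: int_span_induct)
    (auto simp: linear_0[OF assms(1)] linear_add[OF assms(1)] linear_neg[OF assms(1)]
      intro: int_span_0 int_span_add int_span_uminus assms(2))

lemma nat_span_0: "0 \<in> nat_span S"
  unfolding nat_span_def by (intro CollectI exI[of _ "\<lambda>_. 0"]) simp

lemma nat_span_add: "x \<in> nat_span S \<Longrightarrow> y \<in> nat_span S \<Longrightarrow> x + y \<in> nat_span S"
  unfolding nat_span_def
proof clarify
  fix c d :: "'a \<Rightarrow> nat"
  show "\<exists>e. (\<Sum>\<alpha>\<in>S. real (c \<alpha>) *\<^sub>R \<alpha>) + (\<Sum>\<alpha>\<in>S. real (d \<alpha>) *\<^sub>R \<alpha>) =
      (\<Sum>\<alpha>\<in>S. real (e \<alpha>) *\<^sub>R \<alpha>) \<and> True"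
    by (intro exI[of _ "\<lambda>a. c a + d a"]) (simp add: sum.distrib scaleR_add_left)
qed

lemma nat_span_base: "finite S \<Longrightarrow> s \<in> S \<Longrightarrow> s \<in> nat_span S"
  unfolding nat_span_def
proof (intro CollectI exI conjI TrueI)
  assume "finite S" "s \<in> S"
  then show "s = (\<Sum>\<alpha>\<in>S. real (if \<alpha> = s then 1 else 0) *\<^sub>R \<alpha>)"
    by (subst sum.remove[of S s]) (auto intro!: sum.neutral)
qed

lemma nat_span_induct [consumes 1, case_names zero base add]:
  assumes "x \<in> nat_span S" and 0: "Q 0" and b: "\<And>s. s \<in> S \<Longrightarrow> Q s"
    and a: "\<And>x y. Q x \<Longrightarrow> Q y \<Longrightarrow> Q (x + y)"
  shows "Q x"
proof -
  obtain c where x: "x = (\<Sum>s\<in>S. real (c s) *\<^sub>R s)" using assms(1) by (auto simp: nat_span_def)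
  have "Q (real n *\<^sub>R s)" if "s \<in> S" for n s
    by (induction n) (auto simp: 0 scaleR_add_left intro: a b that)
  moreover have "(\<And>s. s \<in> S \<Longrightarrow> Q (f s)) \<Longrightarrow> Q (sum f S)" for f
    by (induction S rule: infinite_finite_induct) (auto simp: 0 intro: a)
  ultimately show ?thesis by (simp add: x)
qed

lemma nat_span_subset_int_span: "nat_span S \<subseteq> int_span S"
proof
  fix x assume "x \<in> nat_span S"
  then obtain c where "x = (\<Sum>s\<in>S. real_of_int (int (c s)) *\<^sub>R s)" by (auto simp: nat_span_def)
  then show "x \<in> int_span S" unfolding int_span_def by (intro CollectI exI[of _ "\<lambda>s. int (c s)"]) simp
qed

lemma int_span_subset_span: "int_span S \<subseteq> span S"
proof
  fix x assume "x \<in> int_span S"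
  then show "x \<in> span S"
    by (induction rule: int_span_induct) (auto intro: span_0 span_base span_add span_neg)
qed

section \<open>Coroots and reflections in a Euclidean space\<close>

lemma coroot_uminus: "coroot (- \<alpha>) = - coroot \<alpha>"
  by (simp add: coroot_def)

lemma inner_coroot_self: "\<alpha> \<noteq> 0 \<Longrightarrow> \<alpha> \<bullet> coroot \<alpha> = 2"
  by (simp add: coroot_def)

lemma inner_coroot: "v \<bullet> coroot \<alpha> = 2 * (v \<bullet> \<alpha>) / (\<alpha> \<bullet> \<alpha>)"
  by (simp add: coroot_def)

lemma inner_coroot_pos_iff: "\<alpha> \<noteq> 0 \<Longrightarrow> v \<bullet> coroot \<alpha> > 0 \<longleftrightarrow> v \<bullet> \<alpha> > 0"
  using inner_ge_zero[of \<alpha>] by (auto simp: inner_coroot zero_less_divide_iff not_less[symmetric] simp del: inner_ge_zero)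

lemma inner_coroot_nonneg_iff: "\<alpha> \<noteq> 0 \<Longrightarrow> v \<bullet> coroot \<alpha> \<ge> 0 \<longleftrightarrow> v \<bullet> \<alpha> \<ge> 0"
  using inner_coroot_pos_iff[of \<alpha> "- v"] by auto

text \<open>Lets a reflection subtract a multiple of the coroot instead of the root, which keeps
  computations inside the coroot lattice.\<close>

lemma inner_scale_coroot: "(v \<bullet> coroot \<alpha>) *\<^sub>R \<alpha> = (v \<bullet> \<alpha>) *\<^sub>R coroot \<alpha>"
  by (simp add: coroot_def)

lemma refl_root_uminus: "refl_root (- \<alpha>) = refl_root \<alpha>"
  by (rule ext) (simp add: refl_root_def coroot_uminus)

lemma refl_root_self: "\<alpha> \<noteq> 0 \<Longrightarrow> refl_root \<alpha> \<alpha> = - \<alpha>"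
  by (simp add: refl_root_def inner_coroot_self scaleR_2)

lemma linear_refl_root: "linear (refl_root \<alpha>)"
  by (rule linearI) (simp_all add: refl_root_def inner_add_left algebra_simps)

lemma refl_root_inner: "refl_root \<alpha> v \<bullet> refl_root \<alpha> w = v \<bullet> w"
proof (cases "\<alpha> = 0")
  case False
  then show ?thesis
    by (simp add: refl_root_def inner_diff_left inner_diff_right inner_coroot inner_commute field_simps)
qed (simp add: refl_root_def)

lemma refl_root_orthogonal: "orthogonal_transformation (refl_root \<alpha>)"
  unfolding orthogonal_transformation_def using linear_refl_root refl_root_inner by blast

lemma refl_root_invol: "refl_root \<alpha> \<circ> refl_root \<alpha> = id"
proof
  fix v
  show "(refl_root \<alpha> \<circ> refl_root \<alpha>) v = id v"
    by (cases "\<alpha> = 0")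
      (simp_all add: refl_root_def inner_diff_left inner_coroot_self algebra_simps)
qed

lemma refl_root_invol_apply [simp]: "refl_root \<alpha> (refl_root \<alpha> v) = v"
  using refl_root_invol[of \<alpha>] by (metis comp_apply id_apply)

lemma coroot_orthogonal:
  assumes "orthogonal_transformation w" shows "coroot (w \<alpha>) = w (coroot \<alpha>)"
  using assms by (simp add: coroot_def orthogonal_transformation_def linear_scale)

lemma orthogonal_comp_refl_root:
  assumes "orthogonal_transformation w" shows "w \<circ> refl_root \<alpha> = refl_root (w \<alpha>) \<circ> w"
proof
  fix v
  have "linear w" "w v \<bullet> w (coroot \<alpha>) = v \<bullet> coroot \<alpha>"
    using assms by (auto simp: orthogonal_transformation_def)
  then show "(w \<circ> refl_root \<alpha>) v = (refl_root (w \<alpha>) \<circ> w) v"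
    by (simp add: refl_root_def coroot_orthogonal[OF assms] linear_diff linear_scale)
qed

text \<open>The conditions are those that pass to the subsystem \<Phi>_J, which need not span the
  space and may be reducible: \<open>par_roots \<Phi> J\<close> with the simple roots
  \<open>J\<close> is interpreted below as another instance in the same space.\<close>

locale based_roots =
  fixes \<Phi> \<Delta> :: "'a::euclidean_space set"
  assumes fin: "finite \<Phi>" and zero_notin: "0 \<notin> \<Phi>"
    and refl_closed: "\<alpha> \<in> \<Phi> \<Longrightarrow> \<beta> \<in> \<Phi> \<Longrightarrow> refl_root \<alpha> \<beta> \<in> \<Phi>"
    and integral: "\<alpha> \<in> \<Phi> \<Longrightarrow> \<beta> \<in> \<Phi> \<Longrightarrow> \<beta> \<bullet> coroot \<alpha> \<in> \<int>"
    and reduced: "\<alpha> \<in> \<Phi> \<Longrightarrow> c *\<^sub>R \<alpha> \<in> \<Phi> \<Longrightarrow> c = 1 \<or> c = -1"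
    and base: "\<Delta> \<subseteq> \<Phi>" and indep: "independent \<Delta>"
    and sign: "\<beta> \<in> \<Phi> \<Longrightarrow> \<beta> \<in> nat_span \<Delta> \<or> - \<beta> \<in> nat_span \<Delta>"
begin

abbreviation "P \<equiv> pos_roots \<Phi> \<Delta>"

lemma finite_base: "finite \<Delta>"
  using base fin finite_subset by blast

lemma nonzero: "\<alpha> \<in> \<Phi> \<Longrightarrow> \<alpha> \<noteq> 0"
  using zero_notin by blast

lemma uminus_root: "\<alpha> \<in> \<Phi> \<Longrightarrow> - \<alpha> \<in> \<Phi>"
  using refl_closed[of \<alpha> \<alpha>] refl_root_self[of \<alpha>] nonzero by auto

lemma uminus_root_iff [simp]: "- \<alpha> \<in> \<Phi> \<longleftrightarrow> \<alpha> \<in> \<Phi>"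
  using uminus_root[of \<alpha>] uminus_root[of "- \<alpha>"] by auto

lemma pos_subset: "P \<subseteq> \<Phi>"
  by (auto simp: pos_roots_def)

lemma finite_pos: "finite P"
  using fin pos_subset finite_subset by blast

lemma pos_root: "\<beta> \<in> P \<Longrightarrow> \<beta> \<in> \<Phi>"
  by (simp add: pos_roots_def)

lemma simple_pos: "\<Delta> \<subseteq> P"
  using base nat_span_base[OF finite_base] by (auto simp: pos_roots_def)

text \<open>Coordinates with respect to \<Delta>, extended linearly to the whole space by choice.
  Off \<open>span \<Delta>\<close> the values are arbitrary, so the coordinate functions of \<Delta>
  and those of the subsystem with base \<open>J\<close> can be compared only on
  \<open>span J\<close>.\<close>

definition coef :: "'a \<Rightarrow> 'a \<Rightarrow> real" where
  "coef a = (SOME f. linear f \<and> (\<forall>b\<in>\<Delta>. f b = (if b = a then 1 else 0)))"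

lemma coef_spec: "linear (coef a) \<and> (\<forall>b\<in>\<Delta>. coef a b = (if b = a then 1 else 0))"
proof -
  have "\<exists>f. linear f \<and> (\<forall>b\<in>\<Delta>. f b = (if b = a then 1 else 0 :: real))"
    using linear_independent_extend[OF indep, of "\<lambda>b. if b = a then 1 else 0 :: real"] by blast
  from someI_ex[OF this] show ?thesis unfolding coef_def .
qed

lemma linear_coef: "linear (coef a)" and coef_base: "b \<in> \<Delta> \<Longrightarrow> coef a b = (if b = a then 1 else 0)"
  using coef_spec by auto

lemmas coef_simps = linear_0[OF linear_coef] linear_add[OF linear_coef] linear_diff[OF linear_coef]
  linear_neg[OF linear_coef] linear_scale[OF linear_coef]

lemma coef_expansion: "v \<in> span \<Delta> \<Longrightarrow> v = (\<Sum>a\<in>\<Delta>. coef a v *\<^sub>R a)"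
proof (induction rule: span_induct)
  case base
  show ?case
  proof (rule subspaceI)
    fix c :: real and x assume "x \<in> {v. v = (\<Sum>a\<in>\<Delta>. coef a v *\<^sub>R a)}"
    then have "x = (\<Sum>a\<in>\<Delta>. coef a x *\<^sub>R a)" by (rule CollectD)
    then have "c *\<^sub>R x = c *\<^sub>R (\<Sum>a\<in>\<Delta>. coef a x *\<^sub>R a)" by (rule arg_cong)
    also have "\<dots> = (\<Sum>a\<in>\<Delta>. coef a (c *\<^sub>R x) *\<^sub>R a)" by (simp add: coef_simps scaleR_right.sum)
    finally show "c *\<^sub>R x \<in> {v. v = (\<Sum>a\<in>\<Delta>. coef a v *\<^sub>R a)}" by (rule CollectI)
  qed (simp_all add: coef_simps scaleR_add_left sum.distrib)
next
  case (step b)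
  then show ?case
    using finite_base by (subst sum.remove[of \<Delta> b]) (auto simp: coef_base split: if_splits intro!: sum.neutral)
qed

lemma int_span_coef: "v \<in> int_span \<Delta> \<Longrightarrow> coef a v \<in> \<int>"
  by (induction rule: int_span_induct) (auto simp: coef_simps coef_base)

lemma nat_span_coef: "v \<in> nat_span \<Delta> \<Longrightarrow> coef a v \<ge> 0"
  by (induction rule: nat_span_induct) (auto simp: coef_simps coef_base)

lemma root_int_span: "\<beta> \<in> \<Phi> \<Longrightarrow> \<beta> \<in> int_span \<Delta>"
  using sign[of \<beta>] int_span_uminus[of "- \<beta>" \<Delta>] nat_span_subset_int_span by auto

lemma root_span: "\<beta> \<in> \<Phi> \<Longrightarrow> \<beta> \<in> span \<Delta>"
  using root_int_span int_span_subset_span by blast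

lemma root_coef: "\<beta> \<in> \<Phi> \<Longrightarrow> coef a \<beta> \<in> \<int>"
  using int_span_coef root_int_span by blast

lemma pos_coef: "\<beta> \<in> P \<Longrightarrow> coef a \<beta> \<ge> 0"
  using nat_span_coef by (auto simp: pos_roots_def)

lemma pos_or_neg: "\<beta> \<in> \<Phi> \<Longrightarrow> \<beta> \<in> P \<or> - \<beta> \<in> P"
  using sign by (auto simp: pos_roots_def)

lemma pos_if_coef: "\<beta> \<in> \<Phi> \<Longrightarrow> coef a \<beta> > 0 \<Longrightarrow> \<beta> \<in> P"
  using pos_or_neg[of \<beta>] pos_coef[of "- \<beta>" a] by (auto simp: coef_simps)

lemma coef_nonzero:
  assumes "v \<in> span \<Delta>" "v \<noteq> 0" obtains a where "a \<in> \<Delta>" "coef a v \<noteq> 0"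
proof -
  have "\<exists>a\<in>\<Delta>. coef a v \<noteq> 0"
  proof (rule ccontr)
    assume "\<not> ?thesis"
    then have "(\<Sum>a\<in>\<Delta>. coef a v *\<^sub>R a) = 0" by simp
    then show False using coef_expansion assms by simp
  qed
  then show ?thesis using that by blast
qed

lemma pos_not_neg: "\<beta> \<in> P \<Longrightarrow> - \<beta> \<notin> P"
proof
  assume b: "\<beta> \<in> P" "- \<beta> \<in> P"
  then obtain a where "coef a \<beta> \<noteq> 0"
    using coef_nonzero[OF root_span[OF pos_root[OF b(1)]] nonzero[OF pos_root[OF b(1)]]] by metis
  then show False using pos_coef[OF b(1), of a] pos_coef[OF b(2), of a] by (simp add: coef_simps)
qed

lemma neg_iff: "\<beta> \<in> \<Phi> \<Longrightarrow> - \<beta> \<in> P \<longleftrightarrow> \<beta> \<notin> P"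
  using pos_or_neg pos_not_neg by blast

lemma coef_refl: "coef b (refl_root a v) = coef b v - (v \<bullet> coroot a) * coef b a"
  by (simp add: refl_root_def coef_simps)

text \<open>By reducedness a positive root other than \<open>a\<close> has a positive coefficient at
  another simple root, and \<open>refl_root a\<close> leaves that coefficient unchanged.\<close>

lemma simple_perm:
  assumes a: "a \<in> \<Delta>" and \<beta>: "\<beta> \<in> P" "\<beta> \<noteq> a"
  shows "refl_root a \<beta> \<in> P"
proof -
  have r: "\<beta> \<in> \<Phi>" "a \<in> \<Phi>" using \<beta> pos_subset a base by auto
  have "\<exists>b\<in>\<Delta>. b \<noteq> a \<and> coef b \<beta> \<noteq> 0"
  proof (rule ccontr)
    assume "\<not> ?thesis"
    then have "(\<Sum>b\<in>\<Delta>. coef b \<beta> *\<^sub>R b) = coef a \<beta> *\<^sub>R a"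
      using a finite_base by (subst sum.remove[of \<Delta> a]) (auto intro!: sum.neutral)
    then have e: "\<beta> = coef a \<beta> *\<^sub>R a" using coef_expansion[OF root_span[OF r(1)]] by metis
    then have "coef a \<beta> = 1 \<or> coef a \<beta> = - 1" using reduced[of a "coef a \<beta>"] r by simp
    then show False using e \<beta>(2) pos_coef[OF \<beta>(1), of a] by auto
  qed
  then obtain b where b: "b \<in> \<Delta>" "b \<noteq> a" "coef b \<beta> > 0" using pos_coef[OF \<beta>(1)] less_eq_real_def by metis
  then show ?thesis
    using pos_if_coef[OF refl_closed[OF r(2) r(1)], of b] a by (simp add: coef_refl coef_base)
qed

text \<open>The expansion of \<open>v \<bullet> v\<close> as the sum of the
  \<open>coef a v * (v \<bullet> a)\<close> is positive, hence has a positive term.\<close>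

lemma pos_inner_simple:
  assumes "v \<in> span \<Delta>" "v \<noteq> 0" "\<And>a. a \<in> \<Delta> \<Longrightarrow> coef a v \<ge> 0"
  obtains a where "a \<in> \<Delta>" "coef a v > 0" "v \<bullet> coroot a > 0"
proof -
  have "\<exists>a\<in>\<Delta>. coef a v * (v \<bullet> a) > 0"
  proof (rule ccontr)
    assume "\<not> ?thesis"
    then have "(\<Sum>a\<in>\<Delta>. coef a v * (v \<bullet> a)) \<le> 0" by (intro sum_nonpos) force
    moreover have "v \<bullet> v = v \<bullet> (\<Sum>a\<in>\<Delta>. coef a v *\<^sub>R a)"
      by (rule arg_cong[OF coef_expansion[OF assms(1)]])
    ultimately have "v \<bullet> v \<le> 0" by (simp add: inner_sum_right)
    then show False using assms(2) by (metis inner_gt_zero_iff not_le)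
  qed
  then obtain a where a: "a \<in> \<Delta>" "coef a v * (v \<bullet> a) > 0" by blast
  moreover have "coef a v \<ge> 0" using assms a by blast
  ultimately have "coef a v > 0" "v \<bullet> a > 0" by (auto simp: zero_less_mult_iff)
  then show ?thesis using that[OF a(1)] inner_coroot_pos_iff[of a] a base nonzero by blast
qed

definition height :: "'a \<Rightarrow> real" where "height v = (\<Sum>a\<in>\<Delta>. coef a v)"

lemma height_refl: "a \<in> \<Delta> \<Longrightarrow> height (refl_root a v) = height v - v \<bullet> coroot a"
  using finite_base
  by (simp add: height_def coef_refl coef_base sum_subtractf flip: sum_distrib_left)

lemma height_diff: "height (v - w) = height v - height w"
  by (simp add: height_def coef_simps sum_subtractf)

lemma height_neg: "height (- v) = - height v"
  by (simp add: height_def coef_simps sum_negf)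

lemma height_nat_span: "v \<in> nat_span \<Delta> \<Longrightarrow> height v \<ge> 0"
  by (simp add: height_def sum_nonneg nat_span_coef)

lemma height_pos: "\<beta> \<in> P \<Longrightarrow> height \<beta> \<ge> 0"
  by (simp add: height_nat_span pos_roots_def)

text \<open>A positive root pairs positively with some simple \<open>a\<close>; unless it equals
  \<open>a\<close>, reflecting in \<open>a\<close> keeps it positive and lowers the height by at
  least one, as pairings are integral.\<close>

lemma pos_root_induct [consumes 1, case_names simple refl]:
  assumes "\<beta> \<in> P" and simple: "\<And>a. a \<in> \<Delta> \<Longrightarrow> Q a"
    and refl: "\<And>a \<beta>. a \<in> \<Delta> \<Longrightarrow> \<beta> \<in> P \<Longrightarrow> Q \<beta> \<Longrightarrow> Q (refl_root a \<beta>)"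
  shows "Q \<beta>"
  using assms(1)
proof (induction "nat \<lfloor>height \<beta>\<rfloor>" arbitrary: \<beta> rule: less_induct)
  case less
  have r: "\<beta> \<in> \<Phi>" using less.prems pos_subset by blast
  obtain a where a: "a \<in> \<Delta>" "\<beta> \<bullet> coroot a > 0"
    using pos_inner_simple[OF root_span[OF r] nonzero[OF r]] pos_coef[OF less.prems] by metis
  show ?case
  proof (cases "\<beta> = a")
    case False
    let ?\<gamma> = "refl_root a \<beta>"
    have g: "?\<gamma> \<in> P" using simple_perm[OF a(1) less.prems False] .
    obtain k where k: "\<beta> \<bullet> coroot a = real_of_int k" using integral[OF _ r, of a] a base by (auto elim: Ints_cases)
    then have "height ?\<gamma> \<le> height \<beta> - 1" using height_refl[OF a(1)] a(2) by simp
    then have "nat \<lfloor>height ?\<gamma>\<rfloor> < nat \<lfloor>height \<beta>\<rfloor>" using height_pos[OF g] by linarith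
    then have "Q ?\<gamma>" using less.hyps g by blast
    then show ?thesis using refl[OF a(1) g] by simp
  qed (use simple a in simp)
qed

section \<open>The finite Weyl group: generation by simple reflections, isometry, length\<close>

lemma refl_root_generated: "\<beta> \<in> P \<Longrightarrow> refl_root \<beta> \<in> generated (refl_root ` \<Delta>)"
proof (induction rule: pos_root_induct)
  case (simple a)
  then show ?case by (intro generated_base) auto
next
  case (refl a \<beta>)
  have "refl_root (refl_root a \<beta>) = refl_root (refl_root a \<beta>) \<circ> refl_root a \<circ> refl_root a"
    by (simp add: comp_assoc refl_root_invol)
  also have "\<dots> = refl_root a \<circ> refl_root \<beta> \<circ> refl_root a"
    unfolding orthogonal_comp_refl_root[OF refl_root_orthogonal, of a \<beta>] ..
  finally have "refl_root (refl_root a \<beta>) = refl_root a \<circ> refl_root \<beta> \<circ> refl_root a" .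
  moreover have "refl_root a \<in> generated (refl_root ` \<Delta>)" using refl(1) by (intro generated_base) simp
  ultimately show ?case using refl(3) generated_comp by metis
qed

lemma pos_abs: "\<beta> \<in> \<Phi> \<Longrightarrow> \<exists>\<gamma>\<in>P. refl_root \<beta> = refl_root \<gamma>"
  using pos_or_neg[of \<beta>] refl_root_uminus by metis

lemma refl_root_image: "refl_root ` \<Phi> = refl_root ` P"
  using pos_abs pos_subset by blast

lemma Weyl_eq: "Weyl \<Phi> = generated (refl_root ` \<Delta>)"
proof
  show "Weyl \<Phi> \<subseteq> generated (refl_root ` \<Delta>)"
    unfolding Weyl_def by (rule generated_subset) (use refl_root_generated refl_root_image in auto)
  show "generated (refl_root ` \<Delta>) \<subseteq> Weyl \<Phi>"
    unfolding Weyl_def by (rule generated_subset) (use base generated_base in blast)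
qed

lemma refl_Weyl: "\<beta> \<in> \<Phi> \<Longrightarrow> refl_root \<beta> \<in> Weyl \<Phi>"
  unfolding Weyl_def by (rule generated_base) simp

lemma Weyl_comp: "u \<in> Weyl \<Phi> \<Longrightarrow> v \<in> Weyl \<Phi> \<Longrightarrow> u \<circ> v \<in> Weyl \<Phi>"
  unfolding Weyl_def by (rule generated_comp)

lemma Weyl_id: "id \<in> Weyl \<Phi>"
  unfolding Weyl_def by simp

lemma Weyl_orthogonal: "w \<in> Weyl \<Phi> \<Longrightarrow> orthogonal_transformation w"
  unfolding Weyl_def
proof (induction rule: generated_induct)
  case id
  show ?case by (simp add: orthogonal_transformation_def linear_id)
next
  case (comp s y)
  then show ?case using orthogonal_transformation_compose[of s y] refl_root_orthogonal by blast
qed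

lemma Weyl_root: "w \<in> Weyl \<Phi> \<Longrightarrow> \<beta> \<in> \<Phi> \<Longrightarrow> w \<beta> \<in> \<Phi>"
  unfolding Weyl_def
  by (induction arbitrary: \<beta> rule: generated_induct) (auto intro: refl_closed)

lemma Weyl_linear: "w \<in> Weyl \<Phi> \<Longrightarrow> linear w"
  using Weyl_orthogonal orthogonal_transformation_linear by blast

lemma Weyl_inner: "w \<in> Weyl \<Phi> \<Longrightarrow> w u \<bullet> w v = u \<bullet> v"
  using Weyl_orthogonal by (auto simp: orthogonal_transformation_def)

lemma Weyl_inv:
  assumes "w \<in> Weyl \<Phi>" shows "inv w \<in> Weyl \<Phi>" "bij w" "inv w (w v) = v" "w (inv w v) = v"
    "w \<circ> inv w = id" "inv w \<circ> w = id"
proof -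
  have 1: "s \<in> refl_root ` \<Phi> \<Longrightarrow> s \<circ> s = id" for s using refl_root_invol by auto
  show "inv w \<in> Weyl \<Phi>" "bij w"
    using generated_inv[OF 1, of _ w] assms by (auto simp: Weyl_def)
  then show "inv w (w v) = v" "w (inv w v) = v" "w \<circ> inv w = id" "inv w \<circ> w = id"
    by (simp_all add: bij_is_inj bij_is_surj surj_f_inv_f surj_iff[symmetric] inj_iff[symmetric])
qed

lemma Weyl_comp_refl:
  "w \<in> Weyl \<Phi> \<Longrightarrow> w \<circ> refl_root \<beta> = refl_root (w \<beta>) \<circ> w"
  using Weyl_orthogonal orthogonal_comp_refl_root by blast

lemma Weyl_coroot: "w \<in> Weyl \<Phi> \<Longrightarrow> coroot (w \<beta>) = w (coroot \<beta>)"
  using Weyl_orthogonal coroot_orthogonal by blast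

sublocale fin: reflection_action "\<lambda>w. w" refl_root "pos_roots \<Phi> \<Delta>" \<Delta>
proof unfold_locales
  fix x y :: "'a \<Rightarrow> 'a" and \<beta> assume *: "x \<in> generated (refl_root ` \<Delta>)"
  then have x: "x \<in> Weyl \<Phi>" using Weyl_eq by simp
  show "x (- \<beta>) = - x \<beta>" using Weyl_linear[OF x] linear_neg by blast
  show "x \<beta> \<in> P \<or> - x \<beta> \<in> P" if "\<beta> \<in> P"
    using pos_or_neg Weyl_root[OF x] that pos_subset by blast
  show "x \<circ> refl_root \<beta> = refl_root (x \<beta>) \<circ> x" by (rule Weyl_comp_refl[OF x])
next
  fix \<beta> assume "\<beta> \<in> P"
  then show "refl_root \<beta> \<beta> = - \<beta>" using refl_root_self nonzero pos_root by blast
qed (use pos_not_neg simple_pos refl_root_generated refl_root_invol simple_perm in auto)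

abbreviation "lenW \<equiv> Weyl_length \<Delta>"

lemma Weyl_length_eq: "w \<in> Weyl \<Phi> \<Longrightarrow> lenW w = card {\<beta> \<in> P. w \<beta> \<notin> P}"
  unfolding Weyl_length_def using fin.len_eq_card Weyl_eq by simp

lemma Weyl_cover_iff:
  "Weyl_cover \<Phi> \<Delta> u v \<longleftrightarrow>
    u \<in> Weyl \<Phi> \<and> (\<exists>\<beta>\<in>P. v = u \<circ> refl_root \<beta>) \<and> lenW v = Suc (lenW u)"
  unfolding Weyl_cover_def Weyl_length_def refl_root_image Weyl_eq by (rule fin.cover_iff)

lemma Weyl_length_refl:
  assumes "w \<in> Weyl \<Phi>" "\<beta> \<in> P"
  shows "lenW (w \<circ> refl_root \<beta>) < lenW w \<longleftrightarrow> w \<beta> \<notin> P"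
    and "lenW w < lenW (w \<circ> refl_root \<beta>) \<longleftrightarrow> w \<beta> \<in> P"
  using fin.len_refl_less_iff fin.len_less_refl_iff assms Weyl_eq unfolding Weyl_length_def by auto

lemma Weyl_eq_id: "w \<in> Weyl \<Phi> \<Longrightarrow> (\<And>\<beta>. \<beta> \<in> P \<Longrightarrow> w \<beta> \<in> P) \<Longrightarrow> w = id"
  using fin.eq_id_if_pos Weyl_eq by simp

text \<open>Used for the subsystem with base \<open>J\<close>: \<open>coroot_lattice J\<close> is
  spanned by the coroots of simple roots alone and must be seen to contain the coroot of every root
  of \<Phi>_J. A simple reflection changes a coroot by an integral multiple of a simple
  coroot.\<close>

lemma coroot_base_int_span: "\<beta> \<in> \<Phi> \<Longrightarrow> coroot \<beta> \<in> int_span (coroot ` \<Delta>)"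
proof -
  have fin': "finite (coroot ` \<Delta>)" using finite_base by blast
  have pos: "coroot \<beta> \<in> int_span (coroot ` \<Delta>)" if "\<beta> \<in> P" for \<beta>
    using that
  proof (induction rule: pos_root_induct)
    case (simple a)
    then show ?case using int_span_base[OF fin'] by blast
  next
    case (refl a \<beta>)
    have "coroot (refl_root a \<beta>) = refl_root a (coroot \<beta>)"
      by (rule coroot_orthogonal[OF refl_root_orthogonal])
    also have "\<dots> = coroot \<beta> - (a \<bullet> coroot \<beta>) *\<^sub>R coroot a"
      by (simp add: refl_root_def inner_scale_coroot inner_commute)
    also have "\<dots> \<in> int_span (coroot ` \<Delta>)"
      using refl integral[of \<beta> a] base pos_subset int_span_base[OF fin', of "coroot a"]
      by (intro int_span_diff int_span_scale) auto
    finally show ?case .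
  qed
  show "\<beta> \<in> \<Phi> \<Longrightarrow> coroot \<beta> \<in> int_span (coroot ` \<Delta>)"
    using pos[of \<beta>] pos[of "- \<beta>"] pos_or_neg[of \<beta>] int_span_uminus[of "- coroot \<beta>"]
    by (auto simp: coroot_uminus)
qed

section \<open>Angles, splittings and heights, in preparation for the highest root\<close>

lemma simple_inner_nonpos:
  assumes "a \<in> \<Delta>" "b \<in> \<Delta>" "a \<noteq> b" shows "a \<bullet> b \<le> 0"
proof -
  have r: "refl_root b a \<in> \<Phi>" using refl_closed assms base by blast
  have "refl_root b a \<in> P" using simple_perm assms simple_pos by blast
  then have "coef b (refl_root b a) \<ge> 0" by (rule pos_coef)
  then have "a \<bullet> coroot b \<le> 0" using assms by (simp add: coef_refl coef_base)
  then show ?thesis using inner_coroot_pos_iff[of b a] assms nonzero base not_less by blast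
qed

text \<open>If both Cartan integers were at least 2, then \<alpha> - \<beta> would have nonpositive
  square norm. So one of them is 1, and the corresponding reflection produces the difference up to
  sign.\<close>

lemma inner_pos_diff_root:
  assumes \<alpha>: "\<alpha> \<in> \<Phi>" and \<beta>: "\<beta> \<in> \<Phi>" and pos: "\<alpha> \<bullet> \<beta> > 0" and "\<alpha> \<noteq> \<beta>"
  shows "\<alpha> - \<beta> \<in> \<Phi>"
proof -
  obtain k l where k: "\<alpha> \<bullet> coroot \<beta> = real_of_int k" and l: "\<beta> \<bullet> coroot \<alpha> = real_of_int l"
    using integral[OF \<alpha> \<beta>] integral[OF \<beta> \<alpha>] by (auto elim!: Ints_cases)
  have "k > 0" "l > 0" using inner_coroot_pos_iff[of \<beta> \<alpha>] inner_coroot_pos_iff[of \<alpha> \<beta>] pos k l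
    nonzero \<alpha> \<beta> by (auto simp: inner_commute)
  moreover have "\<not> (k \<ge> 2 \<and> l \<ge> 2)"
  proof
    assume "k \<ge> 2 \<and> l \<ge> 2"
    then have "2 * (\<alpha> \<bullet> \<beta>) / (\<beta> \<bullet> \<beta>) \<ge> 2" "2 * (\<alpha> \<bullet> \<beta>) / (\<alpha> \<bullet> \<alpha>) \<ge> 2"
      using k l by (auto simp: inner_coroot inner_commute)
    then have "\<alpha> \<bullet> \<beta> \<ge> \<beta> \<bullet> \<beta>" "\<alpha> \<bullet> \<beta> \<ge> \<alpha> \<bullet> \<alpha>"
      using nonzero \<alpha> \<beta> by (auto simp: field_simps inner_gt_zero_iff)
    then have "(\<alpha> - \<beta>) \<bullet> (\<alpha> - \<beta>) \<le> 0" by (simp add: algebra_simps inner_commute)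
    then show False using \<open>\<alpha> \<noteq> \<beta>\<close> by (metis inner_gt_zero_iff not_le right_minus_eq)
  qed
  ultimately consider "k = 1" | "l = 1" by linarith
  then show ?thesis
  proof cases
    case 1
    then have "refl_root \<beta> \<alpha> = \<alpha> - \<beta>" using k by (simp add: refl_root_def)
    then show ?thesis using refl_closed[OF \<beta> \<alpha>] by simp
  next
    case 2
    then have "refl_root \<alpha> \<beta> = - (\<alpha> - \<beta>)" using l by (simp add: refl_root_def)
    then show ?thesis using refl_closed[OF \<alpha> \<beta>] uminus_root[of "- (\<alpha> - \<beta>)"] by simp
  qed
qed

text \<open>A simple reflection from one side preserves the span of that side and fixes the roots in
  the span of the other, being orthogonal to them. This turns an orthogonal splitting of \<Delta>
  into one of \<Phi>.\<close>

lemma simple_split: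
  assumes "K \<subseteq> \<Delta>" and orth: "\<And>a b. a \<in> K \<Longrightarrow> b \<in> \<Delta> - K \<Longrightarrow> a \<bullet> b = 0" and "\<beta> \<in> \<Phi>"
  shows "\<beta> \<in> span K \<or> \<beta> \<in> span (\<Delta> - K)"
proof -
  have orth': "x \<bullet> y = 0" if "x \<in> span K" "y \<in> span (\<Delta> - K)" for x y
  proof -
    have 1: "x \<bullet> b = 0" if "b \<in> \<Delta> - K" for b
      using \<open>x \<in> span K\<close>
      by (induction rule: span_induct) (auto intro!: subspaceI simp: inner_add_left orth[OF _ that])
    show ?thesis using \<open>y \<in> span (\<Delta> - K)\<close>
      by (induction rule: span_induct) (auto intro!: subspaceI simp: inner_add_right 1)
  qed
  have pos: "\<beta> \<in> span K \<or> \<beta> \<in> span (\<Delta> - K)" if "\<beta> \<in> P" for \<beta>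
    using that
  proof (induction rule: pos_root_induct)
    case (simple a)
    then show ?case by (cases "a \<in> K") (auto intro: span_base)
  next
    case (refl a \<beta>)
    have same: "refl_root a \<beta> \<in> span S" if "a \<in> S" "\<beta> \<in> span S" for S
      unfolding refl_root_def
      by (rule span_diff[OF that(2) span_scale[OF span_base[OF that(1)]]])
    have diff: "refl_root a \<beta> = \<beta>" if "\<beta> \<bullet> a = 0"
      using that by (simp add: refl_root_def inner_coroot)
    show ?case
    proof (cases "a \<in> K")
      case True
      then show ?thesis using refl(3) same[of K] diff orth'[OF span_base[OF True], of \<beta>]
        by (auto simp: inner_commute)
    next
      case False
      then have "a \<in> \<Delta> - K" using refl(1) by simp
      then show ?thesis using refl(3) same[of "\<Delta> - K"] diff orth'[OF _ span_base[of a], of \<beta>] by auto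
    qed
  qed
  show ?thesis
    using pos[of \<beta>] pos[of "- \<beta>"] pos_or_neg[OF assms(3)] span_neg[of "- \<beta>"] by auto
qed

lemma nat_span_antisym: "v \<in> nat_span \<Delta> \<Longrightarrow> - v \<in> nat_span \<Delta> \<Longrightarrow> v = 0"
proof (rule ccontr)
  assume v: "v \<in> nat_span \<Delta>" "- v \<in> nat_span \<Delta>" "v \<noteq> 0"
  then obtain a where "coef a v \<noteq> 0"
    using coef_nonzero nat_span_subset_int_span int_span_subset_span by (metis subsetD)
  then show False using nat_span_coef[OF v(1), of a] nat_span_coef[OF v(2), of a] by (simp add: coef_simps)
qed

lemma height_pos_strict:
  assumes "\<beta> \<in> P" shows "height \<beta> > 0"
proof -
  obtain a where "a \<in> \<Delta>" "coef a \<beta> \<noteq> 0"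
    using coef_nonzero[OF root_span nonzero, of \<beta>] assms pos_root by metis
  then show ?thesis
    unfolding height_def using pos_coef[OF assms] by (intro sum_pos2[of _ a] finite_base) (auto simp: less_le)
qed

text \<open>Reflecting in a simple root with negative pairing raises the height, so at an element of
  maximal height no pairing is negative.\<close>

lemma max_height_dominant:
  assumes "M \<subseteq> \<Phi>" "M \<noteq> {}"
    and closed: "\<And>\<gamma> a. \<gamma> \<in> M \<Longrightarrow> a \<in> \<Delta> \<Longrightarrow> \<gamma> \<bullet> coroot a < 0 \<Longrightarrow> refl_root a \<gamma> \<in> M"
  obtains \<theta> where "\<theta> \<in> M" "\<And>\<gamma>. \<gamma> \<in> M \<Longrightarrow> height \<gamma> \<le> height \<theta>"
    "\<And>a. a \<in> \<Delta> \<Longrightarrow> \<theta> \<bullet> coroot a \<ge> 0"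
proof -
  have "finite M" using assms(1) fin finite_subset by blast
  then obtain \<theta> where \<theta>: "\<theta> \<in> M" "height \<theta> = Max (height ` M)"
    using assms(2) Max_in[of "height ` M"] by (metis (no_types, lifting) finite_imageI image_iff image_is_empty)
  then have max: "height \<gamma> \<le> height \<theta>" if "\<gamma> \<in> M" for \<gamma> using that \<open>finite M\<close> by simp
  have "\<theta> \<bullet> coroot a \<ge> 0" if "a \<in> \<Delta>" for a
    using max[OF closed[OF \<theta>(1) that]] height_refl[OF that, of \<theta>] by linarith
  then show ?thesis using that \<theta>(1) max by blast
qed

end

section \<open>The highest root\<close>

locale irreducible_roots = based_roots +
  assumes nonempty: "\<Phi> \<noteq> {}"
    and irreducible: "A \<noteq> {} \<Longrightarrow> B \<noteq> {} \<Longrightarrow> A \<union> B = \<Phi> \<Longrightarrow> \<exists>\<alpha>\<in>A. \<exists>\<beta>\<in>B. \<alpha> \<bullet> \<beta> \<noteq> 0"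
begin

lemma dominant_pos:
  assumes "\<theta> \<in> \<Phi>" "\<And>a. a \<in> \<Delta> \<Longrightarrow> \<theta> \<bullet> coroot a \<ge> 0" shows "\<theta> \<in> P"
proof (rule ccontr)
  assume "\<theta> \<notin> P"
  then have n: "- \<theta> \<in> P" using pos_or_neg assms by blast
  obtain a where "a \<in> \<Delta>" "(- \<theta>) \<bullet> coroot a > 0"
    using pos_inner_simple[OF root_span[OF pos_root[OF n]] nonzero[OF pos_root[OF n]]] pos_coef[OF n] by metis
  then show False using assms(2)[of a] by simp
qed

text \<open>If the product were not positive, \<beta> would be orthogonal to the support
  \<open>K\<close> of \<theta>. For \<open>b\<close> outside \<open>K\<close>,
  \<open>\<theta> \<bullet> b\<close> is nonnegative by dominance but a sum of nonpositive terms, so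
  \<open>b\<close> is orthogonal to \<open>K\<close> as well. Then \<Phi> splits, against
  irreducibility.\<close>

lemma dominant_inner_pos:
  assumes \<theta>: "\<theta> \<in> \<Phi>" "\<And>a. a \<in> \<Delta> \<Longrightarrow> \<theta> \<bullet> coroot a \<ge> 0"
    and \<beta>: "\<beta> \<in> \<Phi>" "\<And>a. a \<in> \<Delta> \<Longrightarrow> \<beta> \<bullet> coroot a \<ge> 0"
  shows "\<theta> \<bullet> \<beta> > 0"
proof (rule ccontr)
  assume n: "\<not> ?thesis"
  have \<theta>P: "\<theta> \<in> P" and \<beta>P: "\<beta> \<in> P" using dominant_pos assms by auto
  have dom: "\<theta> \<bullet> a \<ge> 0" "\<beta> \<bullet> a \<ge> 0" if "a \<in> \<Delta>" for a
    using assms that inner_coroot_nonneg_iff nonzero base by blast+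
  define K where "K = {a \<in> \<Delta>. coef a \<theta> > 0}"
  have e: "\<theta> = (\<Sum>a\<in>\<Delta>. coef a \<theta> *\<^sub>R a)" using coef_expansion root_span \<theta> by blast
  have inner: "v \<bullet> \<theta> = (\<Sum>a\<in>\<Delta>. coef a \<theta> * (v \<bullet> a))" for v
    by (subst e) (simp add: inner_sum_right)
  have "(\<Sum>a\<in>\<Delta>. coef a \<theta> * (\<beta> \<bullet> a)) \<le> 0" using n inner[of \<beta>] by (simp add: inner_commute)
  moreover have "coef a \<theta> * (\<beta> \<bullet> a) \<ge> 0" if "a \<in> \<Delta>" for a using that dom pos_coef[OF \<theta>P] by simp
  ultimately have z: "coef a \<theta> * (\<beta> \<bullet> a) = 0" if "a \<in> \<Delta>" for a
    using that finite_base sum_nonneg_eq_0_iff[of \<Delta> "\<lambda>a. coef a \<theta> * (\<beta> \<bullet> a)"] sum_nonneg[of \<Delta> "\<lambda>a. coef a \<theta> * (\<beta> \<bullet> a)"]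
    by (metis (no_types, lifting) order_antisym)
  then have \<beta>K: "\<beta> \<bullet> a = 0" if "a \<in> K" for a using that by (force simp: K_def)
  have orth: "a \<bullet> b = 0" if "a \<in> K" "b \<in> \<Delta> - K" for a b
  proof -
    have b: "coef b \<theta> = 0" "b \<in> \<Delta>" using that pos_coef[OF \<theta>P, of b] by (auto simp: K_def)
    have np: "coef c \<theta> * (b \<bullet> c) \<le> 0" if "c \<in> \<Delta>" for c
      using b that simple_inner_nonpos[of b c] pos_coef[OF \<theta>P, of c]
      by (cases "c = b") (auto simp: mult_nonneg_nonpos)
    have "(\<Sum>c\<in>\<Delta>. coef c \<theta> * (b \<bullet> c)) \<ge> 0" using dom(1)[OF b(2)] inner[of b] by (simp add: inner_commute)
    then have "(\<Sum>c\<in>\<Delta>. - (coef c \<theta> * (b \<bullet> c))) \<le> 0" by (simp add: sum_negf)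
    moreover have "- (coef c \<theta> * (b \<bullet> c)) \<ge> 0" if "c \<in> \<Delta>" for c using np[OF that] by simp
    ultimately have "- (coef a \<theta> * (b \<bullet> a)) = 0"
      using \<open>a \<in> K\<close> finite_base sum_nonneg_eq_0_iff[of \<Delta> "\<lambda>c. - (coef c \<theta> * (b \<bullet> c))"]
        sum_nonneg[of \<Delta> "\<lambda>c. - (coef c \<theta> * (b \<bullet> c))"]
      by (metis (no_types, lifting) K_def mem_Collect_eq order_antisym)
    then show ?thesis using \<open>a \<in> K\<close> by (auto simp: K_def inner_commute)
  qed
  have K: "K \<subseteq> \<Delta>" by (auto simp: K_def)
  have orth_span: "x \<bullet> y = 0" if "\<And>a. a \<in> S \<Longrightarrow> x \<bullet> a = 0" "y \<in> span S" for x y :: 'a and S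
    using that(2) by (induction rule: span_induct) (auto intro!: subspaceI simp: inner_add_right that(1))
  have \<theta>K: "\<theta> \<in> span K"
  proof -
    have "coef a \<theta> *\<^sub>R a \<in> span K" if "a \<in> \<Delta>" for a
      using that pos_coef[OF \<theta>P, of a] by (cases "a \<in> K") (auto simp: K_def intro: span_scale span_base span_0)
    then have "(\<Sum>a\<in>\<Delta>. coef a \<theta> *\<^sub>R a) \<in> span K" by (rule span_sum)
    then show ?thesis using e by metis
  qed
  have "\<beta> \<notin> span K"
    using orth_span[of K \<beta> \<beta>] \<beta>K nonzero[OF \<beta>(1)] by auto
  then have \<beta>': "\<beta> \<in> span (\<Delta> - K)" using simple_split[OF K orth \<beta>(1)] by blast
  have orth2: "x \<bullet> y = 0" if "x \<in> span K" "y \<in> span (\<Delta> - K)" for x y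
  proof (rule orth_span[OF _ that(2)])
    fix b assume "b \<in> \<Delta> - K"
    then show "x \<bullet> b = 0" using orth_span[of K b x] that(1) orth by (metis inner_commute)
  qed
  have "\<exists>x\<in>\<Phi> \<inter> span K. \<exists>y\<in>\<Phi> \<inter> span (\<Delta> - K). x \<bullet> y \<noteq> 0"
    by (rule irreducible) (use \<theta>K \<theta> \<beta> \<beta>' simple_split[OF K orth] in auto)
  then show False using orth2 by blast
qed

text \<open>A root \<theta> of maximal height is dominant, and among the roots above a given \<beta>
  there is also a dominant one, \<beta>'. Two dominant roots have positive inner product, so
  \<theta> - \<beta>' is zero or a root, and in the latter case positive by the choice of
  \<theta>.\<close>

lemma highest_exists: "\<exists>\<theta>\<in>\<Phi>. \<forall>\<beta>\<in>\<Phi>. \<theta> - \<beta> \<in> nat_span \<Delta>"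
proof -
  obtain \<theta> where \<theta>: "\<theta> \<in> \<Phi>" "\<And>\<gamma>. \<gamma> \<in> \<Phi> \<Longrightarrow> height \<gamma> \<le> height \<theta>"
      "\<And>a. a \<in> \<Delta> \<Longrightarrow> \<theta> \<bullet> coroot a \<ge> 0"
    using max_height_dominant[of \<Phi>] nonempty refl_closed base by (metis subset_iff subset_refl)
  have "\<theta> - \<beta> \<in> nat_span \<Delta>" if \<beta>: "\<beta> \<in> \<Phi>" for \<beta>
  proof -
    define M where "M = {\<gamma> \<in> \<Phi>. \<gamma> - \<beta> \<in> nat_span \<Delta>}"
    have closed: "refl_root a \<gamma> \<in> M" if \<gamma>: "\<gamma> \<in> M" and a: "a \<in> \<Delta>" and neg: "\<gamma> \<bullet> coroot a < 0" for \<gamma> a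
    proof -
      obtain k where k: "\<gamma> \<bullet> coroot a = real_of_int k"
        using integral[of a \<gamma>] a base \<gamma> by (auto simp: M_def elim: Ints_cases)
      have "real (nat (- k)) *\<^sub>R a = (\<Sum>b\<in>\<Delta>. real (if b = a then nat (- k) else 0) *\<^sub>R b)"
        using a finite_base by (subst sum.remove[of \<Delta> a]) (auto intro!: sum.neutral)
      then have "real (nat (- k)) *\<^sub>R a \<in> nat_span \<Delta>"
        unfolding nat_span_def by (intro CollectI exI[of _ "\<lambda>b. if b = a then nat (- k) else 0"]) simp
      moreover have "refl_root a \<gamma> - \<beta> = (\<gamma> - \<beta>) + real (nat (- k)) *\<^sub>R a"
        using k neg by (simp add: refl_root_def)
      ultimately have "refl_root a \<gamma> - \<beta> \<in> nat_span \<Delta>" using \<gamma> by (simp only: M_def mem_Collect_eq nat_span_add)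
      moreover have "refl_root a \<gamma> \<in> \<Phi>" using \<gamma> a base refl_closed by (auto simp: M_def)
      ultimately show ?thesis by (simp only: M_def mem_Collect_eq)
    qed
    have "\<beta> \<in> M" using \<beta> nat_span_0 by (simp add: M_def)
    then obtain \<beta>' where \<beta>': "\<beta>' \<in> M" "\<And>a. a \<in> \<Delta> \<Longrightarrow> \<beta>' \<bullet> coroot a \<ge> 0"
      using max_height_dominant[of M] closed by (metis (no_types, lifting) M_def empty_iff mem_Collect_eq subsetI)
    then have r: "\<beta>' \<in> \<Phi>" and d: "\<beta>' - \<beta> \<in> nat_span \<Delta>" by (auto simp: M_def)
    have ip: "\<theta> \<bullet> \<beta>' > 0" using dominant_inner_pos[OF \<theta>(1,3) r \<beta>'(2)] .
    show ?thesis
    proof (cases "\<theta> = \<beta>'")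
      case False
      then have "\<theta> - \<beta>' \<in> \<Phi>" using inner_pos_diff_root[OF \<theta>(1) r ip] by simp
      moreover have "- (\<theta> - \<beta>') \<notin> P"
      proof
        assume "- (\<theta> - \<beta>') \<in> P"
        then have "height (\<beta>' - \<theta>) > 0" using height_pos_strict[of "\<beta>' - \<theta>"] by simp
        then show False using \<theta>(2)[OF r] by (simp add: height_diff)
      qed
      ultimately have "\<theta> - \<beta>' \<in> P" using pos_or_neg by blast
      then have "\<theta> - \<beta>' \<in> nat_span \<Delta>" by (simp add: pos_roots_def)
      then have "(\<theta> - \<beta>') + (\<beta>' - \<beta>) \<in> nat_span \<Delta>" using nat_span_add d by blast
      then show ?thesis by simp
    qed (use d in simp)
  qed
  then show ?thesis using \<theta>(1) by blast
qed

abbreviation "\<theta> \<equiv> highest_root \<Phi> \<Delta>"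

lemma highest_root: "\<theta> \<in> \<Phi>" "\<beta> \<in> \<Phi> \<Longrightarrow> \<theta> - \<beta> \<in> nat_span \<Delta>"
proof -
  have "\<exists>!\<theta>. \<theta> \<in> \<Phi> \<and> (\<forall>\<beta>\<in>\<Phi>. \<theta> - \<beta> \<in> nat_span \<Delta>)"
  proof (rule ex_ex1I)
    show "\<exists>\<theta>. \<theta> \<in> \<Phi> \<and> (\<forall>\<beta>\<in>\<Phi>. \<theta> - \<beta> \<in> nat_span \<Delta>)" using highest_exists by blast
    fix \<theta> \<theta>' assume "\<theta> \<in> \<Phi> \<and> (\<forall>\<beta>\<in>\<Phi>. \<theta> - \<beta> \<in> nat_span \<Delta>)" "\<theta>' \<in> \<Phi> \<and> (\<forall>\<beta>\<in>\<Phi>. \<theta>' - \<beta> \<in> nat_span \<Delta>)"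
    then have "\<theta> - \<theta>' \<in> nat_span \<Delta>" "- (\<theta> - \<theta>') \<in> nat_span \<Delta>" by auto
    then show "\<theta> = \<theta>'" using nat_span_antisym by force
  qed
  from theI'[OF this] show "\<theta> \<in> \<Phi>" "\<beta> \<in> \<Phi> \<Longrightarrow> \<theta> - \<beta> \<in> nat_span \<Delta>"
    unfolding highest_root_def by blast+
qed

lemma highest_coef: "\<beta> \<in> \<Phi> \<Longrightarrow> coef a \<beta> \<le> coef a \<theta>"
  using nat_span_coef[OF highest_root(2), of \<beta> a] by (simp add: coef_simps)

lemma highest_pos: "\<theta> \<in> P"
proof -
  obtain a where "coef a \<theta> \<noteq> 0" using coef_nonzero[OF root_span nonzero] highest_root(1) by metis
  then show ?thesis
    using highest_coef[of "- \<theta>" a] highest_root(1) pos_if_coef[of \<theta> a] by (simp add: coef_simps)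
qed

lemma highest_dominant:
  assumes "\<alpha> \<in> P" shows "\<alpha> \<bullet> \<theta> \<ge> 0"
proof -
  have simple: "\<theta> \<bullet> a \<ge> 0" if a: "a \<in> \<Delta>" for a
  proof (rule ccontr)
    assume "\<not> ?thesis"
    then have "\<theta> \<bullet> coroot a < 0" using inner_coroot_nonneg_iff[of a \<theta>] a base nonzero by force
    moreover have "coef a (refl_root a \<theta>) \<le> coef a \<theta>"
      using highest_coef refl_closed a base highest_root(1) by blast
    ultimately show False using a by (simp add: coef_refl coef_base)
  qed
  have "\<alpha> \<in> nat_span \<Delta>" using assms by (simp add: pos_roots_def)
  then show ?thesis
    by (induction rule: nat_span_induct) (auto simp: inner_add_left simple inner_commute[of _ \<theta>] inner_add_right)
qed

text \<open>A pairing \<open>k \<ge> 2\<close> would make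
  \<open>k *\<^sub>R \<theta> - \<alpha>\<close> a root whose coefficients are at least those of
  \<theta>, which forces \<alpha> = \<theta>. The small values are what lets the affine simple
  reflection permute the other positive roots.\<close>

lemma highest_pairing:
  assumes \<alpha>: "\<alpha> \<in> P" "\<alpha> \<noteq> \<theta>" shows "\<alpha> \<bullet> coroot \<theta> = 0 \<or> \<alpha> \<bullet> coroot \<theta> = 1"
proof -
  obtain k where k: "\<alpha> \<bullet> coroot \<theta> = real_of_int k"
    using integral[OF highest_root(1) pos_root[OF \<alpha>(1)]] by (auto elim: Ints_cases)
  have "k \<ge> 0" using highest_dominant[OF \<alpha>(1)] inner_coroot_nonneg_iff[of \<theta> \<alpha>] nonzero highest_root(1) k by simp
  moreover have "\<not> k \<ge> 2"
  proof
    assume "k \<ge> 2"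
    have r: "- refl_root \<theta> \<alpha> \<in> \<Phi>" using refl_closed highest_root(1) \<alpha> pos_root by simp
    have "coef a (\<alpha> - \<theta>) = 0" for a
    proof -
      have "real_of_int k * coef a \<theta> - coef a \<alpha> \<le> coef a \<theta>"
        using highest_coef[OF r, of a] k by (simp add: coef_simps coef_refl)
      moreover have "2 * coef a \<theta> \<le> real_of_int k * coef a \<theta>"
        using \<open>k \<ge> 2\<close> pos_coef[OF highest_pos, of a] by (intro mult_right_mono) auto
      moreover have "coef a \<alpha> \<le> coef a \<theta>" using highest_coef \<alpha> pos_root by blast
      ultimately show ?thesis by (simp add: coef_simps)
    qed
    moreover have "\<alpha> - \<theta> \<in> span \<Delta>" using root_span pos_root \<alpha> highest_root(1) span_diff by blast
    ultimately show False using coef_nonzero[of "\<alpha> - \<theta>"] \<alpha>(2) by (metis right_minus_eq)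
  qed
  ultimately show ?thesis using k by force
qed

end

section \<open>Parabolic subgroups\<close>

locale parabolic_roots = based_roots +
  fixes J assumes J: "J \<subseteq> \<Delta>"
begin

abbreviation "PJ \<equiv> par_pos_roots \<Phi> \<Delta> J"
abbreviation "MJ \<equiv> min_reps \<Phi> \<Delta> J"
abbreviation "RJ \<equiv> par_roots \<Phi> J"
abbreviation "QJ \<equiv> coroot_lattice J"
abbreviation "WJ \<equiv> par_Weyl J"

lemma finite_J: "finite J"
  using J finite_base finite_subset by blast

lemma int_span_J_coef: "v \<in> int_span J \<Longrightarrow> a \<in> \<Delta> - J \<Longrightarrow> coef a v = 0"
  by (induction rule: int_span_induct) (use J in \<open>auto simp: coef_simps coef_base subset_iff\<close>)

lemma par_rootsI:
  assumes \<beta>: "\<beta> \<in> \<Phi>" and 0: "\<And>a. a \<in> \<Delta> - J \<Longrightarrow> coef a \<beta> = 0"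
  shows "\<beta> \<in> RJ"
proof -
  have "\<beta> = (\<Sum>a\<in>\<Delta>. coef a \<beta> *\<^sub>R a)" using coef_expansion root_span \<beta> by blast
  also have "\<dots> = (\<Sum>a\<in>J. coef a \<beta> *\<^sub>R a)"
    using J finite_base 0 by (intro sum.mono_neutral_right) auto
  also have "\<dots> = (\<Sum>a\<in>J. real_of_int \<lfloor>coef a \<beta>\<rfloor> *\<^sub>R a)"
    by (intro sum.cong) (use root_coef[OF \<beta>] in \<open>auto elim: Ints_cases\<close>)
  finally have "\<beta> \<in> int_span J"
    unfolding int_span_def by (intro CollectI exI[of _ "\<lambda>a. \<lfloor>coef a \<beta>\<rfloor>"]) simp
  then show ?thesis using \<beta> by (simp add: par_roots_def)
qed

lemma par_roots_iff: "\<beta> \<in> \<Phi> \<Longrightarrow> \<beta> \<in> RJ \<longleftrightarrow> (\<forall>a\<in>\<Delta> - J. coef a \<beta> = 0)"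
  using par_rootsI int_span_J_coef by (auto simp: par_roots_def)

lemma par_pos_nat_span:
  assumes \<beta>: "\<beta> \<in> PJ" shows "\<beta> \<in> nat_span J"
proof -
  have r: "\<beta> \<in> \<Phi>" "\<beta> \<in> RJ" "\<beta> \<in> P" using \<beta> by (auto simp: par_pos_roots_def par_roots_def)
  have "\<beta> = (\<Sum>a\<in>\<Delta>. coef a \<beta> *\<^sub>R a)" using coef_expansion root_span r by blast
  also have "\<dots> = (\<Sum>a\<in>J. coef a \<beta> *\<^sub>R a)"
    using J finite_base r par_roots_iff by (intro sum.mono_neutral_right) auto
  also have "\<dots> = (\<Sum>a\<in>J. real (nat \<lfloor>coef a \<beta>\<rfloor>) *\<^sub>R a)"
  proof (intro sum.cong refl)
    fix a
    show "coef a \<beta> *\<^sub>R a = real (nat \<lfloor>coef a \<beta>\<rfloor>) *\<^sub>R a"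
      using root_coef[OF r(1), of a] pos_coef[OF r(3), of a] by (auto elim: Ints_cases)
  qed
  finally show ?thesis
    unfolding nat_span_def by (intro CollectI exI[of _ "\<lambda>a. nat \<lfloor>coef a \<beta>\<rfloor>"]) simp
qed

text \<open>Makes the results on \<open>based_roots\<close> available for \<Phi>_J and W_J;
  \<open>pos_J\<close> and \<open>par_Weyl_eq\<close> match the two notations.\<close>

sublocale J: based_roots RJ J
proof
  show "finite RJ" "0 \<notin> RJ" using fin zero_notin by (auto simp: par_roots_def)
  show "\<alpha> \<in> RJ \<Longrightarrow> \<beta> \<in> RJ \<Longrightarrow> refl_root \<alpha> \<beta> \<in> RJ" for \<alpha> \<beta>
    using refl_closed integral
    by (auto simp: par_roots_def refl_root_def intro!: int_span_diff int_span_scale)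
  show "\<alpha> \<in> RJ \<Longrightarrow> \<beta> \<in> RJ \<Longrightarrow> \<beta> \<bullet> coroot \<alpha> \<in> \<int>" for \<alpha> \<beta>
    using integral by (auto simp: par_roots_def)
  show "\<alpha> \<in> RJ \<Longrightarrow> c *\<^sub>R \<alpha> \<in> RJ \<Longrightarrow> c = 1 \<or> c = - 1" for \<alpha> c
    using reduced by (auto simp: par_roots_def)
  show "J \<subseteq> RJ" using J base int_span_base[OF finite_J] by (auto simp: par_roots_def)
  show "independent J" using independent_mono[OF indep J] .
  fix \<beta> assume \<beta>: "\<beta> \<in> RJ"
  then have "- \<beta> \<in> RJ" using int_span_uminus by (auto simp: par_roots_def)
  then show "\<beta> \<in> nat_span J \<or> - \<beta> \<in> nat_span J"
    using \<beta> pos_or_neg[of \<beta>] par_pos_nat_span by (auto simp: par_pos_roots_def par_roots_def)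
qed

lemma nat_span_J_subset: "nat_span J \<subseteq> nat_span \<Delta>"
proof
  fix v assume "v \<in> nat_span J"
  then show "v \<in> nat_span \<Delta>"
    by (induction rule: nat_span_induct)
      (use J in \<open>auto intro: nat_span_0 nat_span_add nat_span_base[OF finite_base]\<close>)
qed

lemma pos_J: "pos_roots RJ J = PJ"
  using par_pos_nat_span nat_span_J_subset by (auto simp: pos_roots_def par_pos_roots_def par_roots_def)

lemma par_Weyl_eq: "WJ = Weyl RJ"
  unfolding par_Weyl_def J.Weyl_eq ..

lemma par_Weyl_subset: "WJ \<subseteq> Weyl \<Phi>"
  unfolding par_Weyl_def Weyl_def by (rule generated_subset) (use J base generated_base in blast)

lemma par_Weyl_root: "u \<in> WJ \<Longrightarrow> \<beta> \<in> RJ \<Longrightarrow> u \<beta> \<in> RJ"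
  unfolding par_Weyl_eq by (rule J.Weyl_root)

lemma outer_iff: "\<beta> \<in> P - PJ \<longleftrightarrow> \<beta> \<in> P \<and> \<beta> \<notin> RJ"
  by (auto simp: par_pos_roots_def)

text \<open>A reflection in \<open>J\<close> does not change coefficients outside \<open>J\<close>.
  A positive root outside \<Phi>_J has a positive one among them, which keeps its image positive and
  outside \<Phi>_J.\<close>

lemma par_Weyl_outer:
  assumes "u \<in> WJ" "\<beta> \<in> P - PJ" shows "u \<beta> \<in> P - PJ"
  using assms unfolding par_Weyl_def
proof (induction arbitrary: \<beta> rule: generated_induct)
  case (comp s y)
  then obtain a where a: "a \<in> J" "s = refl_root a" by blast
  have y: "y \<beta> \<in> P" "y \<beta> \<notin> RJ" using comp.IH[OF comp.prems] outer_iff by auto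
  have "a \<in> \<Delta>" "a \<in> \<Phi>" using a J base by auto
  obtain b where b: "b \<in> \<Delta> - J" "coef b (y \<beta>) \<noteq> 0" using y par_roots_iff pos_root by blast
  then have "coef b (refl_root a (y \<beta>)) = coef b (y \<beta>)"
    using a \<open>a \<in> \<Delta>\<close> by (auto simp: coef_refl coef_base)
  moreover have "refl_root a (y \<beta>) \<in> \<Phi>" using refl_closed \<open>a \<in> \<Phi>\<close> y pos_root by blast
  moreover have "coef b (y \<beta>) > 0" using pos_coef[OF y(1), of b] b by simp
  ultimately have "refl_root a (y \<beta>) \<in> P" "refl_root a (y \<beta>) \<notin> RJ"
    using pos_if_coef[of "refl_root a (y \<beta>)" b] par_roots_iff[of "refl_root a (y \<beta>)"] b by auto
  then show ?case unfolding outer_iff using a by simp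
qed simp

lemma par_Weyl_inv:
  assumes "u \<in> WJ" shows "inv u \<in> WJ"
  using J.Weyl_inv assms par_Weyl_eq by simp

lemma par_Weyl_bij_outer:
  assumes "u \<in> WJ" shows "bij_betw u (P - PJ) (P - PJ)"
proof (rule bij_betwI[of _ _ _ "inv u"])
  show "u \<in> (P - PJ) \<rightarrow> (P - PJ)" "inv u \<in> (P - PJ) \<rightarrow> (P - PJ)"
    using par_Weyl_outer assms par_Weyl_inv by blast+
  show "inv u (u x) = x" "u (inv u x) = x" for x
    using J.Weyl_inv[of u] assms par_Weyl_eq by auto
qed

lemma par_Weyl_comp: "u \<in> WJ \<Longrightarrow> v \<in> WJ \<Longrightarrow> u \<circ> v \<in> WJ"
  unfolding par_Weyl_def by (rule generated_comp)

lemma refl_par_Weyl: "\<beta> \<in> RJ \<Longrightarrow> refl_root \<beta> \<in> WJ"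
  unfolding par_Weyl_eq by (rule J.refl_Weyl)

lemma par_neg_iff: "\<beta> \<in> RJ \<Longrightarrow> \<beta> \<notin> P \<Longrightarrow> - \<beta> \<in> PJ"
  using pos_or_neg J.uminus_root by (auto simp: par_pos_roots_def par_roots_def)

lemma PJ_root: "\<beta> \<in> PJ \<Longrightarrow> \<beta> \<in> RJ \<and> \<beta> \<in> P"
  by (simp add: par_pos_roots_def)

section \<open>Lengths and minimal coset representatives\<close>

lemma len_decomp:
  assumes "w \<in> Weyl \<Phi>"
  shows "lenW w = card {\<beta> \<in> PJ. w \<beta> \<notin> P} + card {\<beta> \<in> P - PJ. w \<beta> \<notin> P}"
proof -
  have "{\<beta> \<in> P. w \<beta> \<notin> P} = {\<beta> \<in> PJ. w \<beta> \<notin> P} \<union> {\<beta> \<in> P - PJ. w \<beta> \<notin> P}"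
    by (auto simp: par_pos_roots_def)
  moreover have "finite {\<beta> \<in> PJ. w \<beta> \<notin> P}" "finite {\<beta> \<in> P - PJ. w \<beta> \<notin> P}"
    using finite_pos finite_subset[of _ P] by (auto simp: par_pos_roots_def)
  ultimately show ?thesis using Weyl_length_eq[OF assms] by (simp add: card_Un_disjoint disjoint_iff)
qed

text \<open>\<open>u\<close> permutes the positive roots outside \<Phi>_J, so multiplying by it on
  the right only relabels the inversions there.\<close>

lemma card_outer:
  assumes "u \<in> WJ"
  shows "card {\<beta> \<in> P - PJ. w (u \<beta>) \<notin> P} = card {\<beta> \<in> P - PJ. w \<beta> \<notin> P}"
proof (rule bij_betw_same_card[of u])
  have b: "bij_betw u (P - PJ) (P - PJ)" by (rule par_Weyl_bij_outer[OF assms])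
  have "u ` {\<beta> \<in> P - PJ. w (u \<beta>) \<notin> P} = {\<beta> \<in> P - PJ. w \<beta> \<notin> P}"
  proof (intro equalityI subsetI)
    fix x assume x: "x \<in> {\<beta> \<in> P - PJ. w \<beta> \<notin> P}"
    then obtain y where "y \<in> P - PJ" "x = u y" using b unfolding bij_betw_def by blast
    then show "x \<in> u ` {\<beta> \<in> P - PJ. w (u \<beta>) \<notin> P}" using x by blast
  qed (use par_Weyl_outer[OF assms] in blast)
  moreover have "inj_on u {\<beta> \<in> P - PJ. w (u \<beta>) \<notin> P}"
    using b unfolding bij_betw_def by (auto intro: inj_on_subset)
  ultimately show "bij_betw u {\<beta> \<in> P - PJ. w (u \<beta>) \<notin> P} {\<beta> \<in> P - PJ. w \<beta> \<notin> P}"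
    by (simp add: bij_betw_def)
qed

text \<open>Turns minimality of length into a sign condition. An inversion in \<Phi>_J would allow a
  shortening; without one, all inversions lie outside \<Phi>_J, and the number of those is common to
  the whole coset.\<close>

lemma min_reps_iff: "w \<in> MJ \<longleftrightarrow> w \<in> Weyl \<Phi> \<and> (\<forall>\<beta>\<in>PJ. w \<beta> \<in> P)"
proof
  assume w: "w \<in> MJ"
  then have W: "w \<in> Weyl \<Phi>" by (simp add: min_reps_def)
  moreover have "w \<beta> \<in> P" if \<beta>: "\<beta> \<in> PJ" for \<beta>
  proof (rule ccontr)
    assume "w \<beta> \<notin> P"
    then have "lenW (w \<circ> refl_root \<beta>) < lenW w"
      using Weyl_length_refl[OF W] \<beta> PJ_root by blast
    moreover have "lenW w \<le> lenW (w \<circ> refl_root \<beta>)"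
      using w \<beta> refl_par_Weyl PJ_root by (auto simp: min_reps_def)
    ultimately show False by simp
  qed
  ultimately show "w \<in> Weyl \<Phi> \<and> (\<forall>\<beta>\<in>PJ. w \<beta> \<in> P)" by blast
next
  assume w: "w \<in> Weyl \<Phi> \<and> (\<forall>\<beta>\<in>PJ. w \<beta> \<in> P)"
  have "lenW w \<le> lenW (w \<circ> u)" if u: "u \<in> WJ" for u
  proof -
    have wu: "w \<circ> u \<in> Weyl \<Phi>" using w u par_Weyl_subset Weyl_comp by blast
    have "{\<beta> \<in> PJ. w \<beta> \<notin> P} = {}" using w by blast
    then have "lenW w = card {\<beta> \<in> P - PJ. w \<beta> \<notin> P}" using len_decomp[of w] w by (simp only: card.empty add_0)
    also have "\<dots> = card {\<beta> \<in> P - PJ. (w \<circ> u) \<beta> \<notin> P}" using card_outer[OF u, of w] by simp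
    also have "\<dots> \<le> lenW (w \<circ> u)" using len_decomp[OF wu] by simp
    finally show ?thesis .
  qed
  then show "w \<in> MJ" using w by (simp add: min_reps_def)
qed

lemma min_reps_Weyl: "w \<in> MJ \<Longrightarrow> w \<in> Weyl \<Phi>"
  by (simp add: min_reps_def)

lemma min_reps_par_root_iff:
  assumes w: "w \<in> MJ" and \<beta>: "\<beta> \<in> RJ"
  shows "w \<beta> \<in> P \<longleftrightarrow> \<beta> \<in> P"
proof
  assume *: "w \<beta> \<in> P"
  show "\<beta> \<in> P"
  proof (rule ccontr)
    assume "\<beta> \<notin> P"
    then have "w (- \<beta>) \<in> P" using par_neg_iff[OF \<beta>] w min_reps_iff by blast
    then show False using * pos_not_neg linear_neg[OF Weyl_linear[OF min_reps_Weyl[OF w]]] by simp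
  qed
qed (use assms min_reps_iff in \<open>auto simp: par_pos_roots_def\<close>)

lemma min_reps_length: "w \<in> MJ \<Longrightarrow> lenW w = card {\<beta> \<in> P - PJ. w \<beta> \<notin> P}"
proof -
  assume w: "w \<in> MJ"
  then have "{\<beta> \<in> PJ. w \<beta> \<notin> P} = {}" using min_reps_iff by blast
  then show ?thesis using len_decomp[OF min_reps_Weyl[OF w]] by (simp only: card.empty add_0)
qed

lemma par_Weyl_length: "u \<in> WJ \<Longrightarrow> lenW u = card {\<beta> \<in> PJ. u \<beta> \<notin> P}"
proof -
  assume u: "u \<in> WJ"
  then have "{\<beta> \<in> P - PJ. u \<beta> \<notin> P} = {}" using par_Weyl_outer by blast
  then show ?thesis using len_decomp[OF subsetD[OF par_Weyl_subset u]] by (simp only: card.empty add_0_right)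
qed

text \<open>Outside \<Phi>_J the product has as many inversions as \<open>w\<close>; inside it has
  those of \<open>u\<close>, because \<open>w\<close> preserves signs on \<Phi>_J.\<close>

lemma length_min_comp:
  assumes w: "w \<in> MJ" and u: "u \<in> WJ"
  shows "lenW (w \<circ> u) = lenW w + lenW u"
proof -
  have "{\<beta> \<in> PJ. (w \<circ> u) \<beta> \<notin> P} = {\<beta> \<in> PJ. u \<beta> \<notin> P}"
    using min_reps_par_root_iff[OF w] par_Weyl_root[OF u] PJ_root by auto
  moreover have "w \<circ> u \<in> Weyl \<Phi>" using w u par_Weyl_subset min_reps_Weyl Weyl_comp by blast
  ultimately show ?thesis
    using len_decomp[of "w \<circ> u"] card_outer[OF u, of w] min_reps_length[OF w] par_Weyl_length[OF u] by simp
qed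

lemma min_reps_exists:
  assumes v: "v \<in> Weyl \<Phi>"
  obtains w u where "w \<in> MJ" "u \<in> WJ" "w = v \<circ> u"
proof -
  have id: "id \<in> WJ" by (simp add: par_Weyl_def)
  define f where "f u = lenW (v \<circ> u)" for u
  obtain u where u: "u \<in> WJ" "\<And>u'. u' \<in> WJ \<Longrightarrow> f u \<le> f u'"
    using ex_has_least_nat[of "\<lambda>u. u \<in> WJ" id f] id by auto
  have "v \<circ> u \<in> Weyl \<Phi>" using v u par_Weyl_subset Weyl_comp by blast
  moreover have "lenW (v \<circ> u) \<le> lenW (v \<circ> u \<circ> u')" if "u' \<in> WJ" for u'
    using u(2)[OF par_Weyl_comp[OF u(1) that]] by (simp add: f_def comp_assoc)
  ultimately have "v \<circ> u \<in> MJ" by (simp add: min_reps_def)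
  then show ?thesis using that u by blast
qed

text \<open>\<open>w\<close> preserves signs on \<Phi>_J, so \<open>u\<close> keeps the positive
  roots there positive; those outside are kept positive by every element of W_J.\<close>

lemma min_reps_unique:
  assumes w: "w \<in> MJ" "w \<circ> u \<in> MJ" and u: "u \<in> WJ"
  shows "u = id"
proof (rule Weyl_eq_id)
  show "u \<in> Weyl \<Phi>" using u par_Weyl_subset by blast
  fix \<beta> assume \<beta>: "\<beta> \<in> P"
  show "u \<beta> \<in> P"
  proof (cases "\<beta> \<in> PJ")
    case True
    then have "w (u \<beta>) \<in> P" using w(2) min_reps_iff by auto
    then show ?thesis using min_reps_par_root_iff[OF w(1)] par_Weyl_root[OF u] True PJ_root by blast
  qed (use par_Weyl_outer[OF u] \<beta> in auto)
qed

lemma min_rep_eqI: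
  assumes w: "w \<in> MJ" and u: "u \<in> WJ" "w = v \<circ> u"
  shows "min_rep \<Phi> \<Delta> J v = w"
  unfolding min_rep_def
proof (rule the_equality)
  show "w \<in> MJ \<and> (\<exists>u\<in>par_Weyl J. w = v \<circ> u)" using assms by blast
  fix w' assume "w' \<in> MJ \<and> (\<exists>u\<in>par_Weyl J. w' = v \<circ> u)"
  then obtain u' where w': "w' \<in> MJ" "u' \<in> WJ" "w' = v \<circ> u'" by blast
  let ?x = "inv u \<circ> u'"
  have x: "?x \<in> WJ" using par_Weyl_comp par_Weyl_inv u w' by blast
  have "w \<circ> ?x = v \<circ> (u \<circ> inv u) \<circ> u'" using u by (simp add: comp_assoc)
  then have "w \<circ> ?x = w'" using J.Weyl_inv(5)[of u] u par_Weyl_eq w' by simp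
  moreover from this have "?x = id" using min_reps_unique[OF w _ x] w' by simp
  ultimately show "w' = w" by simp
qed

lemma min_rep:
  assumes "v \<in> Weyl \<Phi>"
  obtains u where "u \<in> WJ" "min_rep \<Phi> \<Delta> J v \<in> MJ" "v = min_rep \<Phi> \<Delta> J v \<circ> u"
proof -
  obtain w u where w: "w \<in> MJ" "u \<in> WJ" "w = v \<circ> u" using min_reps_exists[OF assms] .
  then have e: "min_rep \<Phi> \<Delta> J v = w" using min_rep_eqI by blast
  have "w \<circ> inv u = v \<circ> (u \<circ> inv u)" using w by (simp add: comp_assoc)
  then have "v = w \<circ> inv u" using J.Weyl_inv(5)[of u] w par_Weyl_eq by simp
  then show ?thesis using that[of "inv u"] par_Weyl_inv w e by simp
qed

end


section \<open>The affine Weyl group\<close>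

text \<open>
  This form of the action depends on the transformation alone: no decomposition \<open>x = w t\<^sub>\<mu>\<close> has to be
  chosen.
\<close>

definition aff_action :: "('a::euclidean_space \<Rightarrow> 'a) \<Rightarrow> 'a \<times> real \<Rightarrow> 'a \<times> real" where
  "aff_action x \<beta> = (x (fst \<beta>) - x 0, snd \<beta> - x 0 \<bullet> (x (fst \<beta>) - x 0))"

text \<open>Here \<open>x 0\<close> is \<open>w \<mu>\<close>, and as \<open>w\<close> is an
  isometry, its pairing with \<open>w (fst \<beta>)\<close> is that of \<mu> with
  \<open>fst \<beta>\<close>.\<close>

lemma aff_action_eq:
  assumes "orthogonal_transformation w"
  shows "aff_action (w \<circ> transl \<mu>) \<beta> = aff_act w \<mu> \<beta>"
proof -
  have "linear w" "w \<mu> \<bullet> w (fst \<beta>) = \<mu> \<bullet> fst \<beta>" using assms by (auto simp: orthogonal_transformation_def)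
  then show ?thesis by (simp add: aff_action_def aff_act_def transl_def linear_add linear_0)
qed

lemma transl_0: "transl 0 = id"
  by (rule ext) (simp add: transl_def)

lemma transl_comp_linear: "linear w \<Longrightarrow> transl (w \<mu>) \<circ> w = w \<circ> transl \<mu>"
  by (rule ext) (simp add: transl_def linear_add)

lemma transl_comp: "transl \<mu> \<circ> transl \<nu> = transl (\<mu> + \<nu>)"
  by (rule ext) (simp add: transl_def add_ac)

lemma transl_cancel: "f \<circ> transl \<mu> = g \<circ> transl \<mu> \<Longrightarrow> f = g"
proof
  fix v assume "f \<circ> transl \<mu> = g \<circ> transl \<mu>"
  then have "(f \<circ> transl \<mu>) (v - \<mu>) = (g \<circ> transl \<mu>) (v - \<mu>)" by simp
  then show "f v = g v" by (simp add: transl_def)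
qed

lemma linear_transl_eq:
  assumes "linear f" "linear g" "f \<circ> transl \<mu> = g \<circ> transl \<nu>"
  shows "f = g" "f \<mu> = g \<nu>"
proof -
  have e: "f v + f \<mu> = g v + g \<nu>" for v
    using fun_cong[OF assms(3), of v] assms(1,2) by (simp add: transl_def linear_add)
  from e[of 0] show m: "f \<mu> = g \<nu>" using assms(1,2) by (simp add: linear_0)
  show "f = g" using e m by auto
qed

lemma aff_refl_0: "aff_refl (\<alpha>, 0) = refl_root \<alpha>"
  by (simp add: aff_refl_def transl_0)

lemma aff_refl_uminus: "aff_refl (- \<beta>) = aff_refl \<beta>"
  by (simp add: aff_refl_def refl_root_uminus coroot_uminus)

lemma coroot_refl_self: "refl_root \<alpha> (coroot \<alpha>) = - coroot \<alpha>"
proof (cases "\<alpha> = 0")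
  case False
  then show ?thesis using coroot_orthogonal[OF refl_root_orthogonal, of \<alpha> \<alpha>] by (simp add: refl_root_self coroot_uminus)
qed (simp add: refl_root_def coroot_def)

text \<open>The identity \<open>refl_root \<alpha> \<mu> + (\<mu> \<bullet> \<alpha>) *\<^sub>R
  coroot \<alpha> = \<mu>\<close> absorbs exactly the change of level by the pairing of \<mu> with
  \<alpha>.\<close>

lemma aff_refl_conj:
  assumes w: "orthogonal_transformation w"
  shows "(w \<circ> transl \<mu>) \<circ> aff_refl \<beta> = aff_refl (aff_act w \<mu> \<beta>) \<circ> (w \<circ> transl \<mu>)"
proof
  fix v
  obtain \<alpha> n where \<beta>: "\<beta> = (\<alpha>, n)" by fastforce
  have l: "linear w" using w orthogonal_transformation_linear by blast
  let ?r = "refl_root \<alpha>"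
  have r: "?r (coroot \<alpha>) = - coroot \<alpha>" by (rule coroot_refl_self)
  have lr: "linear ?r" by (rule linear_refl_root)
  have "refl_root (w \<alpha>) (w u) = w (?r u)" for u
    using fun_cong[OF orthogonal_comp_refl_root[OF w, of \<alpha>], of u] by simp
  then have "(aff_refl (aff_act w \<mu> \<beta>) \<circ> (w \<circ> transl \<mu>)) v = w (?r (v + \<mu> + (n - \<mu> \<bullet> \<alpha>) *\<^sub>R coroot \<alpha>))"
    using l by (simp add: aff_refl_def aff_act_def \<beta> transl_def coroot_orthogonal[OF w]
        flip: linear_scale[OF l] linear_add[OF l])
  also have "?r (v + \<mu> + (n - \<mu> \<bullet> \<alpha>) *\<^sub>R coroot \<alpha>) = ?r (v + n *\<^sub>R coroot \<alpha>) + (?r \<mu> + (\<mu> \<bullet> \<alpha>) *\<^sub>R coroot \<alpha>)"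
    using lr r by (simp add: linear_add linear_diff linear_scale algebra_simps)
  also have "?r \<mu> + (\<mu> \<bullet> \<alpha>) *\<^sub>R coroot \<alpha> = \<mu>" by (simp add: refl_root_def inner_scale_coroot)
  finally show "((w \<circ> transl \<mu>) \<circ> aff_refl \<beta>) v = (aff_refl (aff_act w \<mu> \<beta>) \<circ> (w \<circ> transl \<mu>)) v"
    by (simp add: aff_refl_def \<beta> transl_def)
qed

lemma aff_refl_invol: "aff_refl \<beta> \<circ> aff_refl \<beta> = id"
  by (rule ext) (simp add: aff_refl_def transl_def linear_add[OF linear_refl_root]
      linear_scale[OF linear_refl_root] coroot_refl_self)

context based_roots
begin

abbreviation "QL \<equiv> coroot_lattice \<Phi>"

lemma coroot_lattice_Weyl:
  assumes w: "w \<in> Weyl \<Phi>" and \<mu>: "\<mu> \<in> QL"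
  shows "w \<mu> \<in> QL"
proof -
  have "w s \<in> int_span (coroot ` \<Phi>)" if s: "s \<in> coroot ` \<Phi>" for s
  proof -
    obtain \<alpha> where "\<alpha> \<in> \<Phi>" "s = coroot \<alpha>" using s by blast
    then have "w s = coroot (w \<alpha>)" "w \<alpha> \<in> \<Phi>" using Weyl_coroot[OF w, of \<alpha>] Weyl_root[OF w] by simp_all
    then have "w s \<in> coroot ` \<Phi>" by (rule image_eqI)
    then show ?thesis by (rule int_span_base[OF finite_imageI[OF fin]])
  qed
  then show ?thesis
    using int_span_linear_image[OF Weyl_linear[OF w]] \<mu> unfolding coroot_lattice_def by blast
qed

lemma coroot_lattice_0: "0 \<in> QL"
  unfolding coroot_lattice_def by (rule int_span_0)

lemma coroot_lattice_add: "\<mu> \<in> QL \<Longrightarrow> \<nu> \<in> QL \<Longrightarrow> \<mu> + \<nu> \<in> QL"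
  unfolding coroot_lattice_def by (rule int_span_add)

lemma coroot_in_lattice: "\<alpha> \<in> \<Phi> \<Longrightarrow> coroot \<alpha> \<in> QL"
  unfolding coroot_lattice_def by (rule int_span_base) (auto intro: fin)

lemma coroot_lattice_scale: "\<mu> \<in> QL \<Longrightarrow> k \<in> \<int> \<Longrightarrow> k *\<^sub>R \<mu> \<in> QL"
  unfolding coroot_lattice_def by (rule int_span_scale)

lemma lattice_pairing:
  assumes "\<mu> \<in> QL" "\<beta> \<in> \<Phi>" shows "\<mu> \<bullet> \<beta> \<in> \<int>"
  using assms(1) unfolding coroot_lattice_def
  by (induction rule: int_span_induct) (use integral assms(2) in \<open>auto simp: inner_add_left inner_commute[of _ \<beta>] inner_add_right\<close>)

abbreviation "WA \<equiv> aff_Weyl \<Phi>"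

lemma aff_WeylI: "w \<in> Weyl \<Phi> \<Longrightarrow> \<mu> \<in> QL \<Longrightarrow> w \<circ> transl \<mu> \<in> WA"
  unfolding aff_Weyl_def by blast

lemma aff_WeylE:
  assumes "x \<in> WA"
  obtains w \<mu> where "w \<in> Weyl \<Phi>" "\<mu> \<in> QL" "x = w \<circ> transl \<mu>"
  using assms unfolding aff_Weyl_def by blast

lemma transl_comp_Weyl:
  assumes "w \<in> Weyl \<Phi>" shows "transl \<mu> \<circ> w = w \<circ> transl (inv w \<mu>)"
  using transl_comp_linear[OF Weyl_linear[OF assms], of "inv w \<mu>"] Weyl_inv(4)[OF assms] by simp

lemma aff_comp:
  assumes "w' \<in> Weyl \<Phi>"
  shows "(w \<circ> transl \<mu>) \<circ> (w' \<circ> transl \<mu>') = (w \<circ> w') \<circ> transl (inv w' \<mu> + \<mu>')"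
proof -
  have "(w \<circ> transl \<mu>) \<circ> (w' \<circ> transl \<mu>') = w \<circ> (transl \<mu> \<circ> w') \<circ> transl \<mu>'" by (simp only: comp_assoc)
  also have "\<dots> = (w \<circ> w') \<circ> (transl (inv w' \<mu>) \<circ> transl \<mu>')"
    unfolding transl_comp_Weyl[OF assms] by (simp only: comp_assoc)
  finally show ?thesis unfolding transl_comp .
qed

lemma aff_Weyl_comp: "x \<in> WA \<Longrightarrow> y \<in> WA \<Longrightarrow> x \<circ> y \<in> WA"
  by (elim aff_WeylE)
    (simp only: aff_comp aff_WeylI Weyl_comp coroot_lattice_add coroot_lattice_Weyl Weyl_inv(1))

lemma aff_Weyl_id: "id \<in> WA"
  using aff_WeylI[OF Weyl_id coroot_lattice_0] by (simp add: transl_0)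

lemma aff_refl_in: "\<beta> \<in> aff_roots \<Phi> \<Longrightarrow> aff_refl \<beta> \<in> WA"
  unfolding aff_refl_def aff_roots_def
  by (auto intro!: aff_WeylI refl_Weyl coroot_lattice_scale coroot_in_lattice)

abbreviation "PA \<equiv> aff_pos_roots \<Phi> \<Delta>"

lemma aff_pos_iff: "(\<gamma>, n) \<in> PA \<longleftrightarrow> \<gamma> \<in> \<Phi> \<and> n \<in> \<int> \<and> (n > 0 \<or> n = 0 \<and> \<gamma> \<in> P)"
  by (auto simp: aff_pos_roots_def pos_roots_def)

lemma aff_neg_iff: "(\<gamma>, n) \<in> aff_neg_roots \<Phi> \<Delta> \<longleftrightarrow> (- \<gamma>, - n) \<in> PA"
proof -
  have "(\<gamma>, n) \<in> uminus ` PA \<longleftrightarrow> - (\<gamma>, n) \<in> PA" by (metis image_iff minus_minus)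
  then show ?thesis by (simp add: aff_neg_roots_def)
qed

lemma aff_root_cases: "\<beta> \<in> aff_roots \<Phi> \<Longrightarrow> \<beta> \<in> PA \<or> - \<beta> \<in> PA"
proof -
  assume "\<beta> \<in> aff_roots \<Phi>"
  then obtain \<gamma> n where "\<beta> = (\<gamma>, n)" "\<gamma> \<in> \<Phi>" "n \<in> \<int>" by (auto simp: aff_roots_def)
  then show ?thesis using pos_or_neg[of \<gamma>] by (auto simp: aff_pos_iff)
qed

lemma aff_root_uminus_iff: "- \<beta> \<in> aff_roots \<Phi> \<longleftrightarrow> \<beta> \<in> aff_roots \<Phi>"
  using Ints_minus[of "snd \<beta>"] Ints_minus[of "- snd \<beta>"] by (cases \<beta>) (auto simp: aff_roots_def)

lemma aff_pos_root: "\<beta> \<in> PA \<Longrightarrow> \<beta> \<in> aff_roots \<Phi>"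
  by (cases \<beta>) (auto simp: aff_pos_iff aff_roots_def)

lemma aff_pos_not_neg: "\<beta> \<in> PA \<Longrightarrow> - \<beta> \<notin> PA"
  by (cases \<beta>) (use pos_not_neg in \<open>auto simp: aff_pos_iff\<close>)

lemma aff_refl_image: "aff_refl ` aff_roots \<Phi> = aff_refl ` PA"
proof
  show "aff_refl ` aff_roots \<Phi> \<subseteq> aff_refl ` PA"
  proof
    fix t assume "t \<in> aff_refl ` aff_roots \<Phi>"
    then obtain \<beta> where "\<beta> \<in> aff_roots \<Phi>" "t = aff_refl \<beta>" by blast
    then show "t \<in> aff_refl ` PA" using aff_root_cases[of \<beta>] aff_refl_uminus[of \<beta>] by (metis image_eqI)
  qed
qed (use aff_pos_root in blast)

lemma aff_action_Weyl: "w \<in> Weyl \<Phi> \<Longrightarrow> aff_action (w \<circ> transl \<mu>) \<beta> = aff_act w \<mu> \<beta>"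
  using aff_action_eq Weyl_orthogonal by blast

lemma aff_act_root: "w \<in> Weyl \<Phi> \<Longrightarrow> \<mu> \<in> QL \<Longrightarrow> \<beta> \<in> aff_roots \<Phi> \<Longrightarrow> aff_act w \<mu> \<beta> \<in> aff_roots \<Phi>"
  by (auto simp: aff_act_def aff_roots_def Weyl_root lattice_pairing)

lemma aff_action_root: "x \<in> WA \<Longrightarrow> \<beta> \<in> aff_roots \<Phi> \<Longrightarrow> aff_action x \<beta> \<in> aff_roots \<Phi>"
  by (elim aff_WeylE) (simp only: aff_action_Weyl aff_act_root)

lemma aff_action_comp:
  assumes "x \<in> WA" "y \<in> WA"
  shows "aff_action (x \<circ> y) \<beta> = aff_action x (aff_action y \<beta>)"
proof -
  obtain w \<mu> where x: "w \<in> Weyl \<Phi>" "\<mu> \<in> QL" "x = w \<circ> transl \<mu>" using aff_WeylE assms(1) .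
  obtain w' \<mu>' where y: "w' \<in> Weyl \<Phi>" "\<mu>' \<in> QL" "y = w' \<circ> transl \<mu>'" using aff_WeylE assms(2) .
  have "inv w' \<mu> \<bullet> v = \<mu> \<bullet> w' v" for v
    using Weyl_inner[OF y(1), of "inv w' \<mu>" v] Weyl_inv(4)[OF y(1)] by simp
  then have "aff_act (w \<circ> w') (inv w' \<mu> + \<mu>') \<beta> = aff_act w \<mu> (aff_act w' \<mu>' \<beta>)"
    by (simp add: aff_act_def inner_add_left)
  then show ?thesis
    unfolding x(3) y(3) aff_comp[OF y(1)]
    by (simp only: aff_action_Weyl[OF x(1)] aff_action_Weyl[OF y(1)] aff_action_Weyl[OF Weyl_comp[OF x(1) y(1)]])
qed

lemma aff_action_uminus: "x \<in> WA \<Longrightarrow> aff_action x (- \<beta>) = - aff_action x \<beta>"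
proof (elim aff_WeylE)
  fix w \<mu> assume w: "w \<in> Weyl \<Phi>" "x = w \<circ> transl \<mu>"
  show ?thesis
    unfolding w(2) aff_action_Weyl[OF w(1)] by (simp add: aff_act_def linear_neg[OF Weyl_linear[OF w(1)]] prod_eq_iff)
qed

lemma aff_action_id: "aff_action id \<beta> = \<beta>"
  by (simp add: aff_action_def)

lemma aff_conj: "x \<in> WA \<Longrightarrow> x \<circ> aff_refl \<beta> = aff_refl (aff_action x \<beta>) \<circ> x"
proof (elim aff_WeylE)
  fix w \<mu> assume w: "w \<in> Weyl \<Phi>" "x = w \<circ> transl \<mu>"
  show ?thesis
    unfolding w(2) aff_action_Weyl[OF w(1)] using aff_refl_conj Weyl_orthogonal[OF w(1)] .
qed

lemma aff_action_refl:
  "aff_action (aff_refl (\<alpha>, n)) (\<gamma>, m) = (refl_root \<alpha> \<gamma>, m - n * (\<gamma> \<bullet> coroot \<alpha>))"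
  unfolding aff_refl_def aff_action_eq[OF refl_root_orthogonal]
  by (simp add: aff_act_def inner_commute)

end

section \<open>The affine simple roots, generation of W_af and the affine length formula\<close>

context irreducible_roots
begin

definition aff_base :: "('a \<times> real) set" where
  "aff_base = insert (- \<theta>, 1) ((\<lambda>a. (a, 0)) ` \<Delta>)"

lemma aff_refl_base: "aff_refl ` aff_base = aff_simple_refls \<Phi> \<Delta>"
  by (simp add: aff_base_def aff_simple_refls_def image_image aff_refl_0)

lemma aff_base_pos: "aff_base \<subseteq> PA"
  using simple_pos base highest_root(1) by (auto simp: aff_base_def aff_pos_iff)

text \<open>For a finite simple root this is \<open>simple_perm\<close> at level 0. For \<alpha>_0 =
  -\<theta> + \<delta> the level changes by the pairing \<open>k\<close> with
  \<open>coroot \<theta>\<close>. By \<open>highest_pairing\<close>, \<open>k \<ge> -1\<close>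
  except over -\<theta>, where \<open>k\<close> is -2 and \<open>\<beta> \<noteq> s\<close> makes
  the level at least 2. Whenever level 0 is reached, the new classical part is a positive
  root.\<close>

lemma aff_simple_perm:
  assumes s: "s \<in> aff_base" and \<beta>: "\<beta> \<in> PA" "\<beta> \<noteq> s"
  shows "aff_action (aff_refl s) \<beta> \<in> PA"
proof -
  obtain \<gamma> m where b: "\<beta> = (\<gamma>, m)" by fastforce
  have \<gamma>: "\<gamma> \<in> \<Phi>" "m \<in> \<int>" "m > 0 \<or> m = 0 \<and> \<gamma> \<in> P" using \<beta> b by (auto simp: aff_pos_iff)
  from s consider a where "a \<in> \<Delta>" "s = (a, 0)" | "s = (- \<theta>, 1)" by (auto simp: aff_base_def)
  then show ?thesis
  proof cases
    case 1
    then have "refl_root a \<gamma> \<in> \<Phi>" using refl_closed base \<gamma> by blast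
    moreover have "m = 0 \<Longrightarrow> refl_root a \<gamma> \<in> P" using simple_perm[OF 1(1), of \<gamma>] \<gamma> \<beta>(2) 1 b by auto
    ultimately show ?thesis using \<gamma> unfolding b 1 aff_action_refl by (auto simp: aff_pos_iff)
  next
    case 2
    define k where "k = \<gamma> \<bullet> coroot \<theta>"
    have r: "refl_root \<theta> \<gamma> \<in> \<Phi>" using refl_closed highest_root(1) \<gamma> by blast
    have k: "k \<in> \<int>" using integral highest_root(1) \<gamma> by (simp add: k_def)
    have rk: "refl_root \<theta> \<gamma> = \<gamma> - k *\<^sub>R \<theta>" by (simp add: refl_root_def k_def)
    have act: "aff_action (aff_refl s) \<beta> = (refl_root \<theta> \<gamma>, m + k)"
      unfolding 2 b aff_action_refl by (simp add: refl_root_uminus coroot_uminus k_def)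
    have \<theta>\<theta>: "\<theta> \<bullet> coroot \<theta> = 2" using inner_coroot_self nonzero highest_root(1) by blast
    have "m + k > 0 \<or> m + k = 0 \<and> refl_root \<theta> \<gamma> \<in> P"
    proof (cases "\<gamma> \<in> P")
      case True
      then have "k = 0 \<or> k \<ge> 1" using highest_pairing[OF True] \<theta>\<theta> by (cases "\<gamma> = \<theta>") (auto simp: k_def)
      then show ?thesis using \<gamma>(3) True rk by auto
    next
      case False
      then have n: "- \<gamma> \<in> P" "m > 0" using pos_or_neg \<gamma> by auto
      have m1: "m = 1 \<or> m \<ge> 2" using n(2) \<gamma>(2) by (auto elim!: Ints_cases)
      show ?thesis
      proof (cases "- \<gamma> = \<theta>")
        case True
        then have g: "\<gamma> = - \<theta>" by (metis minus_minus)
        then have "k = - 2" using \<theta>\<theta> by (simp add: k_def)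
        moreover have "m \<noteq> 1" using g \<beta>(2) b 2 by auto
        moreover have "refl_root \<theta> \<gamma> = \<theta>"
          using refl_root_self[OF nonzero[OF highest_root(1)]] linear_neg[OF linear_refl_root, of \<theta> \<theta>]
          unfolding g by simp
        ultimately show ?thesis using m1 highest_pos by auto
      next
        case False
        then consider "k = 0" | "k = - 1" using highest_pairing[OF n(1)] by (auto simp: k_def)
        then show ?thesis
        proof cases
          case k1: 2
          then have "refl_root \<theta> \<gamma> = \<theta> - (- \<gamma>)" using rk by simp
          then have "refl_root \<theta> \<gamma> \<in> P" using highest_root(2)[of "- \<gamma>"] \<gamma> r by (simp add: pos_roots_def)
          then show ?thesis using m1 k1 by auto
        qed (use n in simp)
      qed
    qed
    then show ?thesis unfolding act using r \<gamma>(2) k by (auto simp: aff_pos_iff)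
  qed
qed

text \<open>The linear function with value 1 on every affine simple root: \<delta> = \<alpha>_0 +
  \<theta> gets the value \<open>height \<theta> + 1\<close>.\<close>

definition aff_height :: "'a \<times> real \<Rightarrow> real" where
  "aff_height \<beta> = height (fst \<beta>) + snd \<beta> * (height \<theta> + 1)"

lemma aff_height_nonneg:
  assumes "\<beta> \<in> PA" shows "aff_height \<beta> \<ge> 0"
proof -
  obtain \<gamma> n where b: "\<beta> = (\<gamma>, n)" by fastforce
  have \<gamma>: "\<gamma> \<in> \<Phi>" "n \<in> \<int>" "n > 0 \<or> n = 0 \<and> \<gamma> \<in> P" using assms b by (auto simp: aff_pos_iff)
  show ?thesis
  proof (cases "n = 0")
    case False
    then have "n \<ge> 1" using \<gamma> by (auto elim!: Ints_cases)
    have "height (\<theta> - (- \<gamma>)) \<ge> 0" by (intro height_nat_span highest_root(2)) (simp add: \<gamma>)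
    then have hh: "height \<theta> + height \<gamma> \<ge> 0" unfolding height_diff height_neg by simp
    have "height \<theta> \<ge> 0" using height_pos highest_pos by blast
    then have "1 * (height \<theta> + 1) \<le> n * (height \<theta> + 1)"
      using \<open>n \<ge> 1\<close> by (intro mult_right_mono) auto
    then have "height \<gamma> + 1 * (height \<theta> + 1) \<le> height \<gamma> + n * (height \<theta> + 1)" by (rule add_left_mono)
    then have "height \<gamma> + n * (height \<theta> + 1) \<ge> 0" using hh unfolding mult_1 by linarith
    then show ?thesis by (simp add: aff_height_def b)
  qed (use \<gamma> height_pos in \<open>simp add: aff_height_def b\<close>)
qed

text \<open>Induction on the affine height: some affine simple reflection lowers it by at least one,
  and conjugation by that reflection leads back from the lower root.\<close>

lemma aff_refl_generated:
  "\<beta> \<in> PA \<Longrightarrow> aff_refl \<beta> \<in> generated (aff_refl ` aff_base)"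
proof (induction "nat \<lfloor>aff_height \<beta>\<rfloor>" arbitrary: \<beta> rule: less_induct)
  case less
  show ?case
  proof (cases "\<beta> \<in> aff_base")
    case False
    obtain \<gamma> n where b: "\<beta> = (\<gamma>, n)" by fastforce
    have \<gamma>: "\<gamma> \<in> \<Phi>" "n \<in> \<int>" "n > 0 \<or> n = 0 \<and> \<gamma> \<in> P" using less.prems b by (auto simp: aff_pos_iff)
    \<comment> \<open>Since \<delta> = \<alpha>_0 + \<theta>, the root \<gamma> + n\<delta> is the
      sum of n\<alpha>_0 and \<gamma> + n\<theta>; these are its coefficients at the finite simple
      roots.\<close>
    have c: "coef a \<gamma> + n * coef a \<theta> \<ge> 0" for a
    proof (cases "n = 0")
      case False
      then have "n \<ge> 1" using \<gamma> by (auto elim!: Ints_cases)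
      then have "n * coef a \<theta> \<ge> 1 * coef a \<theta>" using pos_coef[OF highest_pos] by (intro mult_right_mono) auto
      then show ?thesis using highest_coef[of "- \<gamma>" a] \<gamma> by (simp add: coef_simps)
    qed (use \<gamma> pos_coef in auto)
    have "\<exists>s\<in>aff_base. aff_height (aff_action (aff_refl s) \<beta>) \<le> aff_height \<beta> - 1"
    proof (cases "\<gamma> \<bullet> \<theta> < 0")
      case True
      then have "\<gamma> \<bullet> coroot \<theta> < 0"
        using inner_coroot_nonneg_iff[of \<theta> \<gamma>] nonzero highest_root(1) by force
      then have "\<gamma> \<bullet> coroot \<theta> \<le> - 1"
        using integral[OF highest_root(1) \<gamma>(1)] by (auto elim!: Ints_cases)
      moreover have "aff_height (aff_action (aff_refl (- \<theta>, 1)) \<beta>) = aff_height \<beta> + \<gamma> \<bullet> coroot \<theta>"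
      proof -
        have "height (refl_root \<theta> \<gamma>) = height \<gamma> - (\<gamma> \<bullet> coroot \<theta>) * height \<theta>"
          by (simp add: height_def coef_refl sum_subtractf sum_distrib_left)
        then show ?thesis
          unfolding b aff_action_refl
          by (simp add: aff_height_def refl_root_uminus coroot_uminus algebra_simps)
      qed
      ultimately show ?thesis by (intro bexI[of _ "(- \<theta>, 1)"]) (auto simp: aff_base_def)
    next
      case False
      have "n \<ge> 0" using \<gamma>(3) by auto
      \<comment> \<open>As \<open>\<gamma> \<bullet> \<theta>\<close> is nonnegative, \<gamma> has
        positive inner product with \<gamma> + n\<theta>, which is a nonnegative combination of
        simple roots.\<close>
      have "\<exists>a\<in>\<Delta>. \<gamma> \<bullet> a > 0"
      proof (rule ccontr)
        assume *: "\<not> ?thesis"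
        have "\<gamma> + n *\<^sub>R \<theta> = (\<Sum>a\<in>\<Delta>. coef a (\<gamma> + n *\<^sub>R \<theta>) *\<^sub>R a)"
          by (intro coef_expansion span_add span_scale root_span \<gamma> highest_root(1))
        then have "\<gamma> \<bullet> (\<gamma> + n *\<^sub>R \<theta>) = \<gamma> \<bullet> (\<Sum>a\<in>\<Delta>. coef a (\<gamma> + n *\<^sub>R \<theta>) *\<^sub>R a)" by (rule arg_cong)
        also have "\<dots> = (\<Sum>a\<in>\<Delta>. (coef a \<gamma> + n * coef a \<theta>) * (\<gamma> \<bullet> a))"
          by (simp add: inner_sum_right coef_simps)
        also have "\<dots> \<le> 0" using * c by (intro sum_nonpos mult_nonneg_nonpos) (auto simp: not_less)
        finally have "\<gamma> \<bullet> \<gamma> + n * (\<gamma> \<bullet> \<theta>) \<le> 0" by (simp add: inner_add_right)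
        moreover have "n * (\<gamma> \<bullet> \<theta>) \<ge> 0" using False \<open>n \<ge> 0\<close> by simp
        ultimately have "\<gamma> \<bullet> \<gamma> \<le> 0" by linarith
        then show False using nonzero[OF \<gamma>(1)] by (metis inner_gt_zero_iff not_le)
      qed
      then obtain a where a: "a \<in> \<Delta>" "\<gamma> \<bullet> a > 0" by blast
      then have "\<gamma> \<bullet> coroot a > 0" using inner_coroot_pos_iff nonzero base by blast
      then have "\<gamma> \<bullet> coroot a \<ge> 1"
        using integral[OF subsetD[OF base a(1)] \<gamma>(1)] by (auto elim!: Ints_cases)
      moreover have "aff_height (aff_action (aff_refl (a, 0)) \<beta>) = aff_height \<beta> - \<gamma> \<bullet> coroot a"
        unfolding b aff_action_refl by (simp add: aff_height_def height_refl[OF a(1)])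
      ultimately show ?thesis using a by (intro bexI[of _ "(a, 0)"]) (auto simp: aff_base_def)
    qed
    then obtain s where s: "s \<in> aff_base" "aff_height (aff_action (aff_refl s) \<beta>) \<le> aff_height \<beta> - 1" by blast
    let ?\<beta> = "aff_action (aff_refl s) \<beta>"
    have p: "?\<beta> \<in> PA" using aff_simple_perm[OF s(1) less.prems] False s(1) by blast
    have "nat \<lfloor>aff_height ?\<beta>\<rfloor> < nat \<lfloor>aff_height \<beta>\<rfloor>" using aff_height_nonneg[OF p] s(2) by linarith
    then have g: "aff_refl ?\<beta> \<in> generated (aff_refl ` aff_base)" using less.hyps p by blast
    have sW: "aff_refl s \<in> WA" using aff_refl_in aff_pos_root aff_base_pos s(1) by blast
    have sg: "aff_refl s \<in> generated (aff_refl ` aff_base)" using s(1) by (intro generated_base) simp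
    have "aff_refl s \<circ> aff_refl ?\<beta> \<circ> aff_refl s = aff_refl s \<circ> (aff_refl s \<circ> aff_refl \<beta>)"
      unfolding aff_conj[OF sW, of \<beta>] by (simp only: comp_assoc)
    also have "\<dots> = aff_refl \<beta>" by (simp only: comp_assoc[symmetric] aff_refl_invol id_comp)
    finally show ?thesis using generated_comp[OF generated_comp[OF sg g] sg] by metis
  qed (auto intro: generated_base)
qed

text \<open>Identifies the semidirect product with the group generated by the affine simple
  reflections, to which word length and Bruhat order refer. Translations arise as products of
  \<open>refl_root \<alpha>\<close> with \<open>aff_refl (\<alpha>, n)\<close>.\<close>

lemma aff_Weyl_eq: "WA = generated (aff_refl ` aff_base)"
proof
  let ?G = "generated (aff_refl ` aff_base)"
  have refl: "aff_refl \<beta> \<in> ?G" if "\<beta> \<in> aff_roots \<Phi>" for \<beta>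
    using aff_root_cases[OF that] aff_refl_generated aff_refl_uminus by metis
  have W: "Weyl \<Phi> \<subseteq> ?G"
    unfolding Weyl_def
  proof (rule generated_subset, clarify)
    fix \<alpha> assume "\<alpha> \<in> \<Phi>"
    then show "refl_root \<alpha> \<in> ?G" using refl[of "(\<alpha>, 0)"] by (simp add: aff_refl_0 aff_roots_def)
  qed
  have T: "transl \<mu> \<in> ?G" if "\<mu> \<in> QL" for \<mu>
  proof -
    \<comment> \<open>Both signs are carried along for the negation case of
      \<open>int_span_induct\<close>.\<close>
    have "transl \<mu> \<in> ?G \<and> transl (- \<mu>) \<in> ?G"
      using that unfolding coroot_lattice_def
    proof (induction rule: int_span_induct)
      case zero
      show ?case unfolding minus_zero transl_0 by (intro conjI generated_id)
    next
      case (base s)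
      then obtain \<alpha> where \<alpha>: "\<alpha> \<in> \<Phi>" "s = coroot \<alpha>" by blast
      have c: "refl_root \<alpha> \<circ> aff_refl (\<alpha>, n) = transl (n *\<^sub>R s)" for n
      proof -
        have "refl_root \<alpha> \<circ> aff_refl (\<alpha>, n) = (refl_root \<alpha> \<circ> refl_root \<alpha>) \<circ> transl (n *\<^sub>R s)"
          unfolding aff_refl_def \<alpha>(2) by (simp only: comp_assoc fst_conv snd_conv)
        then show ?thesis by (simp only: refl_root_invol id_comp)
      qed
      have "refl_root \<alpha> \<in> ?G" using W refl_Weyl \<alpha>(1) by blast
      moreover have "aff_refl (\<alpha>, 1) \<in> ?G" "aff_refl (\<alpha>, - 1) \<in> ?G"
        using refl \<alpha>(1) by (auto simp: aff_roots_def)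
      ultimately have "transl (1 *\<^sub>R s) \<in> ?G" "transl ((- 1) *\<^sub>R s) \<in> ?G"
        unfolding c[symmetric] using generated_comp by blast+
      then show ?case by simp
    next
      case (add x y)
      then show ?case using generated_comp[of "transl x" _ "transl y"] generated_comp[of "transl (- x)" _ "transl (- y)"]
        by (simp add: transl_comp)
    qed auto
    then show ?thesis ..
  qed
  show "WA \<subseteq> ?G"
  proof
    fix x assume "x \<in> WA"
    then show "x \<in> ?G" using T W by (elim aff_WeylE) (metis generated_comp subsetD)
  qed
  show "?G \<subseteq> WA"
  proof
    fix x assume "x \<in> ?G"
    then show "x \<in> WA"
    proof (induction rule: generated_induct)
      case (comp s y)
      then have "s \<in> WA" using aff_refl_in aff_pos_root aff_base_pos by blast
      then show ?case using comp aff_Weyl_comp by blast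
    qed (rule aff_Weyl_id)
  qed
qed

sublocale aff: reflection_action aff_action aff_refl "aff_pos_roots \<Phi> \<Delta>" aff_base
proof (unfold_locales, fold aff_Weyl_eq)
  fix \<beta> assume \<beta>: "\<beta> \<in> PA"
  obtain \<gamma> n where b: "\<beta> = (\<gamma>, n)" by fastforce
  have "\<gamma> \<in> \<Phi>" using \<beta> b by (simp add: aff_pos_iff)
  then show "aff_action (aff_refl \<beta>) \<beta> = - \<beta>"
    unfolding b aff_action_refl by (simp add: refl_root_self inner_coroot_self nonzero)
  show "aff_refl \<beta> \<in> WA" using aff_refl_in aff_pos_root \<beta> by blast
  fix x assume "x \<in> WA"
  then show "aff_action x \<beta> \<in> PA \<or> - aff_action x \<beta> \<in> PA"
    using aff_root_cases aff_action_root aff_pos_root[OF \<beta>] by blast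
qed (use aff_pos_not_neg aff_base_pos aff_refl_invol aff_simple_perm aff_action_id
      aff_action_comp aff_action_uminus aff_conj in blast)+

abbreviation "aff_len \<equiv> word_length (aff_refl ` aff_base)"

lemma aff_cover_iff:
  "aff_cover \<Phi> \<Delta> u v \<longleftrightarrow>
    u \<in> WA \<and> (\<exists>\<beta>\<in>PA. v = u \<circ> aff_refl \<beta>) \<and> aff_len v = Suc (aff_len u)"
  unfolding aff_cover_def aff_refl_base[symmetric] aff_refl_image aff_Weyl_eq by (rule aff.cover_iff)

lemma aff_len_refl:
  assumes "x \<in> WA" "\<beta> \<in> PA"
  shows "aff_len (x \<circ> aff_refl \<beta>) < aff_len x \<longleftrightarrow> aff_action x \<beta> \<notin> PA"
    and "aff_len x < aff_len (x \<circ> aff_refl \<beta>) \<longleftrightarrow> aff_action x \<beta> \<in> PA"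
  using aff.len_refl_less_iff aff.len_less_refl_iff assms aff_Weyl_eq by auto

abbreviation neg_ind :: "('a \<Rightarrow> 'a) \<Rightarrow> 'a \<Rightarrow> real" where
  "neg_ind w \<alpha> \<equiv> (if w \<alpha> \<in> P then 0 else 1)"

text \<open>Over \<alpha> the inverted levels are \<open>0 \<le> i < m + e\<close>, over -\<alpha>
  they are \<open>1 \<le> i < 1 - e - m\<close>; at most one range is nonempty, and together they
  have |m + e| elements. The shift \<open>e\<close> settles the level that is sent to level 0, where
  the sign of \<open>w \<alpha>\<close> decides.\<close>

lemma aff_len_formula:
  assumes w: "w \<in> Weyl \<Phi>" and \<mu>: "\<mu> \<in> QL"
  shows "real (aff_len (w \<circ> transl \<mu>)) = (\<Sum>\<alpha>\<in>P. \<bar>\<mu> \<bullet> \<alpha> + neg_ind w \<alpha>\<bar>)"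
proof -
  define I where "I \<alpha> = {\<beta> \<in> PA. aff_act w \<mu> \<beta> \<notin> PA \<and> (fst \<beta> = \<alpha> \<or> fst \<beta> = - \<alpha>)}" for \<alpha>
  have x: "w \<circ> transl \<mu> \<in> generated (aff_refl ` aff_base)" using aff_WeylI[OF w \<mu>] aff_Weyl_eq by simp
  have len: "aff_len (w \<circ> transl \<mu>) = card {\<beta> \<in> PA. aff_act w \<mu> \<beta> \<notin> PA}"
    using aff.len_eq_card[OF x] by (simp only: aff_action_Weyl[OF w])
  have I: "finite (I \<alpha>) \<and> real (card (I \<alpha>)) = \<bar>\<mu> \<bullet> \<alpha> + neg_ind w \<alpha>\<bar>" if \<alpha>: "\<alpha> \<in> P" for \<alpha>
  proof -
    obtain m where m: "\<mu> \<bullet> \<alpha> = real_of_int m" using lattice_pairing[OF \<mu> pos_root[OF \<alpha>]] by (auto elim: Ints_cases)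
    define e :: int where "e = (if w \<alpha> \<in> P then 0 else 1)"
    have n\<alpha>: "- \<alpha> \<notin> P" "- \<alpha> \<in> \<Phi>" "\<alpha> \<in> \<Phi>" using pos_not_neg[OF \<alpha>] pos_root[OF \<alpha>] by auto
    then have w\<alpha>: "w \<alpha> \<in> \<Phi>" "- w \<alpha> \<in> \<Phi>" "- w \<alpha> \<in> P \<longleftrightarrow> w \<alpha> \<notin> P" "w (- \<alpha>) = - w \<alpha>"
      using Weyl_root[OF w] neg_iff linear_neg[OF Weyl_linear[OF w]] by auto
    have ne: "\<alpha> \<noteq> - \<alpha>" using n\<alpha>(1) \<alpha> by metis
    let ?A = "(\<lambda>i. (\<alpha>, real_of_int i)) ` {0..<m + e}"
    let ?B = "(\<lambda>i. (- \<alpha>, real_of_int i)) ` {1..<1 - e - m}"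
    have a: "(\<alpha>, real_of_int i) \<in> I \<alpha> \<longleftrightarrow> i \<in> {0..<m + e}" for i
      using \<alpha> n\<alpha> w\<alpha> by (auto simp: I_def aff_pos_iff aff_act_def m e_def simp flip: of_int_diff)
    have b: "(- \<alpha>, real_of_int i) \<in> I \<alpha> \<longleftrightarrow> i \<in> {1..<1 - e - m}" for i
      using \<alpha> n\<alpha> w\<alpha> by (auto simp: I_def aff_pos_iff aff_act_def m e_def simp flip: of_int_add)
    have "I \<alpha> = ?A \<union> ?B"
    proof (intro equalityI subsetI)
      fix \<beta> assume \<beta>: "\<beta> \<in> I \<alpha>"
      then obtain i where "\<beta> = (\<alpha>, real_of_int i) \<or> \<beta> = (- \<alpha>, real_of_int i)"
        by (cases \<beta>) (auto simp: I_def aff_pos_iff elim!: Ints_cases)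
      then show "\<beta> \<in> ?A \<union> ?B" using \<beta> a b by blast
    qed (use a b in blast)
    moreover have "card ?A = nat (m + e)" "card ?B = nat (- e - m)"
      by (simp_all add: card_image inj_on_def)
    moreover have "?A \<inter> ?B = {}" using ne by auto
    ultimately have "card (I \<alpha>) = nat (m + e) + nat (- e - m)" "finite (I \<alpha>)" by (auto simp: card_Un_disjoint)
    moreover have "real (nat (m + e) + nat (- e - m)) = \<bar>real_of_int m + real_of_int e\<bar>" by linarith
    ultimately show ?thesis by (simp add: m e_def split: if_splits)
  qed
  have "{\<beta> \<in> PA. aff_act w \<mu> \<beta> \<notin> PA} = (\<Union>\<alpha>\<in>P. I \<alpha>)"
  proof (intro equalityI subsetI)
    fix \<beta> assume \<beta>: "\<beta> \<in> {\<beta> \<in> PA. aff_act w \<mu> \<beta> \<notin> PA}"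
    then have "fst \<beta> \<in> \<Phi>" by (cases \<beta>) (simp add: aff_pos_iff)
    then show "\<beta> \<in> (\<Union>\<alpha>\<in>P. I \<alpha>)" using \<beta> pos_or_neg[of "fst \<beta>"] by (fastforce simp: I_def)
  qed (auto simp: I_def)
  moreover have "I \<alpha> \<inter> I \<alpha>' = {}" if "\<alpha> \<in> P" "\<alpha>' \<in> P" "\<alpha> \<noteq> \<alpha>'" for \<alpha> \<alpha>'
    using that pos_not_neg by (fastforce simp: I_def)
  ultimately have "card {\<beta> \<in> PA. aff_act w \<mu> \<beta> \<notin> PA} = (\<Sum>\<alpha>\<in>P. card (I \<alpha>))"
    using I finite_pos by (simp add: card_UN_disjoint)
  then show ?thesis using len I by simp
qed

end


section \<open>Parabolic factorization in the affine Weyl group\<close>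

lemma sum_neg_indicator: "finite A \<Longrightarrow> (\<Sum>\<alpha>\<in>A. if Q \<alpha> then 0 else 1 :: real) = real (card {\<alpha> \<in> A. \<not> Q \<alpha>})"
proof -
  assume "finite A"
  then have "(\<Sum>\<alpha>\<in>A. if Q \<alpha> then 0 else 1 :: real) = (\<Sum>\<alpha>\<in>{\<alpha> \<in> A. \<not> Q \<alpha>}. 1)"
    by (intro sum.mono_neutral_cong_right) auto
  then show ?thesis by simp
qed

locale irreducible_parabolic_roots = irreducible_roots + parabolic_roots
begin

abbreviation "PAJ \<equiv> par_aff_pos_roots \<Phi> \<Delta> J"

text \<open>This is 2\<rho> - 2\<rho>_J. Written as a sum over a set that W_J permutes, it is
  visibly invariant under W_J.\<close>

definition outer_sum :: 'a where "outer_sum = (\<Sum>\<beta>\<in>P - PJ. \<beta>)"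

definition inner_sum :: 'a where "inner_sum = (\<Sum>\<beta>\<in>PJ. \<beta>)"

lemma PJ_subset: "PJ \<subseteq> P"
  by (auto simp: par_pos_roots_def)

lemma finite_PJ: "finite PJ"
  using PJ_subset finite_pos finite_subset by blast

lemma sum_P_split: "sum f P = sum f PJ + sum f (P - PJ)"
  using sum.subset_diff[OF PJ_subset finite_pos, of f] by (simp add: add.commute)

lemma two_rho: "2 *\<^sub>R rho \<Phi> \<Delta> = inner_sum + outer_sum"
  using sum_P_split[of "\<lambda>x. x"] by (simp add: rho_def inner_sum_def outer_sum_def)

lemma two_rho_diff: "2 *\<^sub>R rho \<Phi> \<Delta> - 2 *\<^sub>R par_rho \<Phi> \<Delta> J = outer_sum"
  using two_rho by (simp add: par_rho_def inner_sum_def)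

lemma outer_sum_invariant:
  assumes "u \<in> WJ" shows "u outer_sum = outer_sum"
proof -
  have "linear u" using assms par_Weyl_subset Weyl_linear by blast
  then have "u outer_sum = (\<Sum>\<beta>\<in>P - PJ. u \<beta>)" by (simp add: outer_sum_def linear_sum)
  also have "\<dots> = outer_sum"
    unfolding outer_sum_def using sum.reindex_bij_betw[OF par_Weyl_bij_outer[OF assms], of "\<lambda>x. x"] .
  finally show ?thesis .
qed

lemma inner_outer_sum: "u \<in> WJ \<Longrightarrow> u v \<bullet> outer_sum = v \<bullet> outer_sum"
  using outer_sum_invariant Weyl_inner par_Weyl_subset by (metis subsetD)

text \<open>\<open>refl_root a\<close> permutes the other positive roots, so their sum is orthogonal
  to \<open>a\<close> and only \<open>a\<close> itself contributes.\<close>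

lemma simple_rho:
  assumes a: "a \<in> \<Delta>" shows "(\<Sum>\<beta>\<in>P. \<beta>) \<bullet> coroot a = 2"
proof -
  have aP: "a \<in> P" and a0: "a \<noteq> 0" using a simple_pos base nonzero by blast+
  let ?S = "\<Sum>\<beta>\<in>P - {a}. \<beta>"
  have "refl_root a \<beta> \<in> P - {a}" if "\<beta> \<in> P - {a}" for \<beta>
  proof -
    have "refl_root a \<beta> \<noteq> a"
    proof
      assume "refl_root a \<beta> = a"
      then have "\<beta> = - a" using refl_root_invol_apply[of a \<beta>] refl_root_self[OF a0] by simp
      then show False using that aP pos_not_neg by blast
    qed
    then show ?thesis using simple_perm[OF a] that by blast
  qed
  then have "bij_betw (refl_root a) (P - {a}) (P - {a})"
    by (intro bij_betwI[of _ _ _ "refl_root a"]) auto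
  then have "(\<Sum>\<beta>\<in>P - {a}. refl_root a \<beta>) = ?S"
    using sum.reindex_bij_betw[of "refl_root a" _ _ "\<lambda>x. x"] by blast
  then have "refl_root a ?S = ?S" by (simp add: linear_sum[OF linear_refl_root])
  then have "(?S \<bullet> coroot a) *\<^sub>R a = 0" by (simp add: refl_root_def)
  then have "?S \<bullet> coroot a = 0" using a0 by simp
  moreover have "(\<Sum>\<beta>\<in>P. \<beta>) = a + ?S" using sum.remove[OF finite_pos aP] .
  ultimately show ?thesis using inner_coroot_self[OF a0] by (simp add: inner_add_left)
qed

text \<open>Invariance under W_J makes \<open>outer_sum\<close> orthogonal to \<open>J\<close>. At
  the other simple coroots 2\<rho> pairs to 2 and 2\<rho>_J to at most 0, and a positive root
  outside \<Phi>_J has a positive coefficient at one of those simple roots. The strict sign later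
  bounds \<chi> by 1.\<close>

lemma outer_sum_pos:
  assumes \<alpha>: "\<alpha> \<in> P - PJ" shows "coroot \<alpha> \<bullet> outer_sum > 0"
proof -
  have inJ: "a \<bullet> outer_sum = 0" if "a \<in> J" for a
  proof -
    have "refl_root a \<in> WJ" using that unfolding par_Weyl_def by (intro generated_base) simp
    then have "refl_root a outer_sum = outer_sum" by (rule outer_sum_invariant)
    then have "(outer_sum \<bullet> a) *\<^sub>R coroot a = 0" by (simp add: refl_root_def inner_scale_coroot)
    moreover have "a \<noteq> 0" using that J base nonzero by blast
    ultimately show ?thesis by (simp add: coroot_def inner_commute)
  qed
  have outJ: "a \<bullet> outer_sum > 0" if a: "a \<in> \<Delta> - J" for a
  proof -
    have "\<beta> \<bullet> a \<le> 0" if "\<beta> \<in> PJ" for \<beta>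
    proof -
      have "\<beta> \<in> nat_span J" using par_pos_nat_span that .
      then show ?thesis
        by (induction rule: nat_span_induct)
          (use a J simple_inner_nonpos[of _ a] in \<open>auto simp: inner_add_left subset_iff\<close>)
    qed
    then have "inner_sum \<bullet> a \<le> 0" by (simp add: inner_sum_def inner_sum_left sum_nonpos)
    then have "\<not> inner_sum \<bullet> coroot a > 0" using inner_coroot_pos_iff[of a] a base nonzero by (metis DiffD1 not_less subsetD)
    moreover have "(inner_sum + outer_sum) \<bullet> coroot a = 2"
      using simple_rho[of a] a sum_P_split[of "\<lambda>x. x"] by (simp add: inner_sum_def outer_sum_def)
    ultimately have "outer_sum \<bullet> coroot a > 0" by (simp add: inner_add_left)
    then show ?thesis using inner_coroot_pos_iff[of a] a base nonzero by (metis DiffD1 inner_commute subsetD)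
  qed
  have r: "\<alpha> \<in> P" "\<alpha> \<notin> RJ" "\<alpha> \<in> \<Phi>" using \<alpha> outer_iff pos_root by blast+
  then obtain b where b: "b \<in> \<Delta> - J" "coef b \<alpha> \<noteq> 0" using par_roots_iff by blast
  have "\<alpha> \<bullet> outer_sum = (\<Sum>a\<in>\<Delta>. coef a \<alpha> *\<^sub>R a) \<bullet> outer_sum"
    using coef_expansion[OF root_span[OF r(3)]] by (rule arg_cong)
  also have "\<dots> = (\<Sum>a\<in>\<Delta>. coef a \<alpha> * (a \<bullet> outer_sum))" by (simp add: inner_sum_left)
  also have "\<dots> > 0"
  proof (rule sum_pos2[OF finite_base])
    show "b \<in> \<Delta>" using b by blast
    show "coef b \<alpha> * (b \<bullet> outer_sum) > 0" using b outJ pos_coef[OF r(1), of b] by (simp add: less_le)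
    show "coef a \<alpha> * (a \<bullet> outer_sum) \<ge> 0" if "a \<in> \<Delta>" for a
      using that inJ[of a] outJ[of a] pos_coef[OF r(1), of a] by (cases "a \<in> J") auto
  qed
  finally show ?thesis using nonzero[OF r(3)] by (simp add: coroot_def)
qed

section \<open>The coroot lattice of J under W_J\<close>

lemma lattice_J_subset: "QJ \<subseteq> QL"
proof
  fix \<mu> assume "\<mu> \<in> QJ"
  then show "\<mu> \<in> QL"
    unfolding coroot_lattice_def
  proof (induction rule: int_span_induct)
    case (base s)
    then show ?case using J based_roots.base[OF based_roots_axioms] by (intro int_span_base finite_imageI fin) auto
  qed (auto intro: int_span_0 int_span_add int_span_uminus)
qed

lemma lattice_J_Weyl:
  assumes u: "u \<in> WJ" and \<nu>: "\<nu> \<in> QJ" shows "u \<nu> \<in> QJ"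
proof -
  have W: "u \<in> Weyl RJ" using u par_Weyl_eq by simp
  have "u s \<in> int_span (coroot ` J)" if s: "s \<in> coroot ` J" for s
  proof -
    obtain \<alpha> where \<alpha>: "\<alpha> \<in> J" "s = coroot \<alpha>" using s by blast
    have "u s = coroot (u \<alpha>)" unfolding \<alpha>(2) J.Weyl_coroot[OF W] ..
    moreover have "u \<alpha> \<in> RJ" using J.Weyl_root[OF W] J.base \<alpha>(1) by blast
    ultimately show ?thesis using J.coroot_base_int_span by metis
  qed
  then show ?thesis
    using int_span_linear_image[OF J.Weyl_linear[OF W]] \<nu> unfolding coroot_lattice_def by blast
qed

text \<open>Each simple reflection in \<open>J\<close> subtracts an integral multiple of a coroot
  from \<open>J\<close>. This places the second factor of \<open>transl \<mu>\<close> in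
  (W_J)_af.\<close>

lemma lattice_diff_J:
  assumes "u \<in> WJ" "\<mu> \<in> QL" shows "\<mu> - u \<mu> \<in> QJ"
  using assms(1) unfolding par_Weyl_def
proof (induction rule: generated_induct)
  case id
  show ?case by (simp add: coroot_lattice_def int_span_0)
next
  case (comp s y)
  then obtain a where a: "a \<in> J" "s = refl_root a" by blast
  have "y \<in> Weyl \<Phi>" using comp(2) par_Weyl_subset by (auto simp: par_Weyl_def)
  then have "y \<mu> \<bullet> a \<in> \<int>"
    using lattice_pairing coroot_lattice_Weyl assms(2) a J base by blast
  then have "(y \<mu> \<bullet> a) *\<^sub>R coroot a \<in> QJ"
    unfolding coroot_lattice_def using a finite_J by (intro int_span_scale int_span_base) auto
  then have "(\<mu> - y \<mu>) + (y \<mu> \<bullet> a) *\<^sub>R coroot a \<in> QJ"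
    using comp(3) unfolding coroot_lattice_def by (intro int_span_add)
  moreover have "\<mu> - (s \<circ> y) \<mu> = (\<mu> - y \<mu>) + (y \<mu> \<bullet> a) *\<^sub>R coroot a"
    by (simp add: a(2) refl_root_def inner_scale_coroot)
  ultimately show ?case by (simp only:)
qed

text \<open>
  A simple reflection \<open>r\<^sub>a\<close> whose coordinate in \<open>\<eta>\<close> has the same sign as \<open>\<langle>\<eta>, a\<rangle> = \<plusminus>1\<close> brings
  that coordinate one step closer to zero and changes no other coordinate.
\<close>

lemma minuscule_lattice_zero:
  assumes "\<eta> \<in> QJ" and "\<And>\<alpha>. \<alpha> \<in> RJ \<Longrightarrow> \<bar>\<eta> \<bullet> \<alpha>\<bar> \<le> 1"
  shows "\<eta> = 0"
proof -
  \<comment> \<open>The coordinate at \<open>coroot a\<close> in the basis of simple coroots,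
    because \<open>a\<close> is \<open>(a \<bullet> a) / 2\<close> times its coroot; it is integral
    on the lattice.\<close>
  define d where "d a v = coef a v * (a \<bullet> a) / 2" for a v
  have d_lin: "d a (v - w) = d a v - d a w" "d a (c *\<^sub>R v) = c * d a v" for a v w c
    by (simp_all add: d_def coef_simps algebra_simps diff_divide_distrib)
  have d_coroot: "d a (coroot b) = (if a = b then 1 else 0)" if "a \<in> J" "b \<in> J" for a b
    using that J base nonzero by (auto simp: d_def coroot_def coef_simps coef_base subset_iff)
  have d_int: "d a v \<in> \<int>" if "v \<in> QJ" "a \<in> J" for a v
    using that(1) unfolding coroot_lattice_def
  proof (induction rule: int_span_induct)
    case (base s)
    then show ?case using d_coroot that(2) by auto
  next
    case (add x y)
    then show ?case by (simp add: d_def coef_simps algebra_simps add_divide_distrib)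
  qed (simp_all add: d_def coef_simps)
  show ?thesis
    using assms
  proof (induction "\<Sum>a\<in>J. nat \<lfloor>\<bar>d a \<eta>\<bar>\<rfloor>" arbitrary: \<eta> rule: less_induct)
    case less
    note lat = less.prems(1)
    show ?case
    proof (rule ccontr)
      assume "\<eta> \<noteq> 0"
      have "\<eta> \<in> span J"
        using lat unfolding coroot_lattice_def
        by (induction rule: int_span_induct)
          (auto simp: coroot_def intro: span_0 span_scale span_base span_add span_neg)
      then have "\<eta> = (\<Sum>a\<in>J. J.coef a \<eta> *\<^sub>R a)" by (rule J.coef_expansion)
      \<comment> \<open>The two coordinate functions come from independent choices, but both are
        determined by the values on \<open>J\<close> within \<open>span J\<close>.\<close>
      moreover have "J.coef a \<eta> = coef a \<eta>" if "a \<in> J" for a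
        using \<open>\<eta> \<in> span J\<close>
      proof (induction rule: span_induct)
        case base
        show ?case by (auto intro!: subspaceI simp: coef_simps J.coef_simps)
      next
        case (step b)
        then show ?case using J that by (auto simp: coef_base J.coef_base)
      qed
      ultimately have e: "\<eta> = (\<Sum>a\<in>J. coef a \<eta> *\<^sub>R a)" by simp
      have "\<exists>a\<in>J. coef a \<eta> * (\<eta> \<bullet> a) > 0"
      proof (rule ccontr)
        assume "\<not> ?thesis"
        then have "(\<Sum>a\<in>J. coef a \<eta> * (\<eta> \<bullet> a)) \<le> 0" by (intro sum_nonpos) force
        moreover have "\<eta> \<bullet> \<eta> = \<eta> \<bullet> (\<Sum>a\<in>J. coef a \<eta> *\<^sub>R a)" using e by (rule arg_cong)
        ultimately have "\<eta> \<bullet> \<eta> \<le> 0" by (simp add: inner_sum_right)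
        then show False using \<open>\<eta> \<noteq> 0\<close> by (metis inner_gt_zero_iff not_le)
      qed
      then obtain a where a: "a \<in> J" "coef a \<eta> * (\<eta> \<bullet> a) > 0" by blast
      have ar: "a \<in> RJ" "a \<in> \<Phi>" "a \<noteq> 0" using a J base nonzero J.base by blast+
      obtain k where k: "\<eta> \<bullet> a = real_of_int k"
        using lattice_pairing[OF subsetD[OF lattice_J_subset lat] ar(2)] by (auto elim: Ints_cases)
      obtain m where m: "d a \<eta> = real_of_int m" using d_int[OF lat a(1)] by (auto elim: Ints_cases)
      have "d a \<eta> * (\<eta> \<bullet> a) > 0"
      proof -
        have "coef a \<eta> * (\<eta> \<bullet> a) * ((a \<bullet> a) / 2) > 0"
          by (rule mult_pos_pos[OF a(2)]) (simp add: ar(3))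
        then show ?thesis by (simp add: d_def mult_ac)
      qed
      then have mk: "m * k > 0" using k m by (simp flip: of_int_mult)
      have "\<bar>\<eta> \<bullet> a\<bar> \<le> 1" using less.prems(2) ar(1) by blast
      then have "\<bar>k\<bar> \<le> 1" using k by simp
      then have "k = 1 \<or> k = - 1" using mk by (cases "k = 0") auto
      then have dec: "nat \<bar>m - k\<bar> < nat \<bar>m\<bar>" using mk by (auto simp: zero_less_mult_iff)
      let ?\<eta> = "refl_root a \<eta>"
      have r: "?\<eta> = \<eta> - (\<eta> \<bullet> a) *\<^sub>R coroot a" by (simp add: refl_root_def inner_scale_coroot)
      have dr: "d b ?\<eta> = d b \<eta> - (if b = a then real_of_int k else 0)" if "b \<in> J" for b
        unfolding r using that a(1) by (simp add: d_lin d_coroot k)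
      have "(\<Sum>b\<in>J. nat \<lfloor>\<bar>d b ?\<eta>\<bar>\<rfloor>) < (\<Sum>b\<in>J. nat \<lfloor>\<bar>d b \<eta>\<bar>\<rfloor>)"
      proof (rule sum_strict_mono_ex1[OF finite_J])
        have da: "nat \<lfloor>\<bar>d a ?\<eta>\<bar>\<rfloor> = nat \<bar>m - k\<bar>" "nat \<lfloor>\<bar>d a \<eta>\<bar>\<rfloor> = nat \<bar>m\<bar>"
          using dr[OF a(1)] m by (simp_all flip: of_int_diff of_int_abs)
        show "\<exists>b\<in>J. nat \<lfloor>\<bar>d b ?\<eta>\<bar>\<rfloor> < nat \<lfloor>\<bar>d b \<eta>\<bar>\<rfloor>" using da dec a(1) by (intro bexI[of _ a]) simp_all
        show "\<forall>b\<in>J. nat \<lfloor>\<bar>d b ?\<eta>\<bar>\<rfloor> \<le> nat \<lfloor>\<bar>d b \<eta>\<bar>\<rfloor>"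
        proof
          fix b assume "b \<in> J"
          then show "nat \<lfloor>\<bar>d b ?\<eta>\<bar>\<rfloor> \<le> nat \<lfloor>\<bar>d b \<eta>\<bar>\<rfloor>" using da dec dr[of b] by (cases "b = a") (metis less_imp_le, simp)
        qed
      qed
      moreover have rW: "refl_root a \<in> WJ" using refl_par_Weyl ar(1) by blast
      then have "?\<eta> \<in> QJ" using lattice_J_Weyl lat by blast
      moreover have "\<bar>?\<eta> \<bullet> \<alpha>\<bar> \<le> 1" if "\<alpha> \<in> RJ" for \<alpha>
      proof -
        have "?\<eta> \<bullet> \<alpha> = \<eta> \<bullet> refl_root a \<alpha>"
          using refl_root_inner[of a \<eta> "refl_root a \<alpha>"] by simp
        then show ?thesis using less.prems(2) J.refl_closed[OF ar(1) that] by simp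
      qed
      ultimately have "?\<eta> = 0" using less.hyps by blast
      then have "refl_root a ?\<eta> = 0" by (simp add: refl_root_def)
      then show False using \<open>\<eta> \<noteq> 0\<close> by simp
    qed
  qed
qed

section \<open>Existence and uniqueness of the factorization with respect to (W_J)_af\<close>

lemma par_aff_subset: "par_aff_Weyl J \<subseteq> WA"
  unfolding par_aff_Weyl_def aff_Weyl_def using par_Weyl_subset lattice_J_subset by blast

lemma par_aff_WeylI: "w \<in> WJ \<Longrightarrow> \<nu> \<in> QJ \<Longrightarrow> w \<circ> transl \<nu> \<in> par_aff_Weyl J"
  unfolding par_aff_Weyl_def by blast

lemma par_aff_WeylE:
  assumes "u \<in> par_aff_Weyl J"
  obtains w \<nu> where "w \<in> WJ" "\<nu> \<in> QJ" "u = w \<circ> transl \<nu>"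
  using assms unfolding par_aff_Weyl_def by blast

lemma par_aff_comp:
  assumes "u \<in> par_aff_Weyl J" "v \<in> par_aff_Weyl J" shows "u \<circ> v \<in> par_aff_Weyl J"
proof -
  obtain w \<nu> where u: "w \<in> WJ" "\<nu> \<in> QJ" "u = w \<circ> transl \<nu>" using par_aff_WeylE assms(1) .
  obtain w' \<nu>' where v: "w' \<in> WJ" "\<nu>' \<in> QJ" "v = w' \<circ> transl \<nu>'" using par_aff_WeylE assms(2) .
  have "inv w' \<nu> + \<nu>' \<in> QJ"
    using lattice_J_Weyl[OF par_Weyl_inv[OF v(1)] u(2)] v(2) unfolding coroot_lattice_def by (rule int_span_add)
  moreover have "w' \<in> Weyl \<Phi>" using v(1) par_Weyl_subset by blast
  ultimately show ?thesis
    unfolding u(3) v(3) using aff_comp[of w' w \<nu> \<nu>'] par_aff_WeylI[OF par_Weyl_comp[OF u(1) v(1)]] by metis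
qed

lemma par_aff_inverse:
  assumes "u \<in> par_aff_Weyl J" obtains u' where "u' \<in> par_aff_Weyl J" "u \<circ> u' = id" "u' \<circ> u = id"
proof -
  obtain w \<nu> where u: "w \<in> WJ" "\<nu> \<in> QJ" "u = w \<circ> transl \<nu>" using par_aff_WeylE assms .
  have W: "w \<in> Weyl \<Phi>" using u(1) par_Weyl_subset by blast
  have n: "- w \<nu> \<in> QJ"
    using lattice_J_Weyl[OF u(1,2)] unfolding coroot_lattice_def by (rule int_span_uminus)
  let ?u = "inv w \<circ> transl (- w \<nu>)"
  have "?u \<in> par_aff_Weyl J" using par_aff_WeylI[OF par_Weyl_inv[OF u(1)] n] .
  moreover have "u \<circ> ?u = id" "?u \<circ> u = id"
    using Weyl_inv(3,4)[OF W] linear_add[OF Weyl_linear[OF W]]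
      linear_diff[OF Weyl_linear[OF Weyl_inv(1)[OF W]]]
    unfolding u(3) by (auto simp: fun_eq_iff transl_def)
  ultimately show ?thesis using that by blast
qed

lemma par_aff_refl:
  assumes "\<beta> \<in> PAJ" shows "aff_refl \<beta> \<in> par_aff_Weyl J"
proof -
  have r: "fst \<beta> \<in> RJ" "snd \<beta> \<in> \<int>"
    using assms by (auto simp: par_aff_pos_roots_def aff_pos_roots_def)
  then have "snd \<beta> *\<^sub>R coroot (fst \<beta>) \<in> QJ"
    unfolding coroot_lattice_def using J.coroot_base_int_span by (intro int_span_scale)
  then show ?thesis unfolding aff_refl_def using par_aff_WeylI refl_par_Weyl r by blast
qed

lemma aff_min_reps_iff:
  "x \<in> aff_min_reps \<Phi> \<Delta> J \<longleftrightarrow> x \<in> WA \<and> (\<forall>\<beta>\<in>PAJ. aff_action x \<beta> \<in> PA)"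
proof
  assume "x \<in> aff_min_reps \<Phi> \<Delta> J"
  then obtain w \<mu> where w: "w \<in> Weyl \<Phi>" "\<mu> \<in> QL" "x = w \<circ> transl \<mu>"
    "\<forall>\<beta>\<in>PAJ. aff_act w \<mu> \<beta> \<in> PA" unfolding aff_min_reps_def by blast
  then show "x \<in> WA \<and> (\<forall>\<beta>\<in>PAJ. aff_action x \<beta> \<in> PA)"
    unfolding w(3) aff_action_Weyl[OF w(1)] using aff_WeylI by blast
next
  assume x: "x \<in> WA \<and> (\<forall>\<beta>\<in>PAJ. aff_action x \<beta> \<in> PA)"
  then obtain w \<mu> where w: "w \<in> Weyl \<Phi>" "\<mu> \<in> QL" "x = w \<circ> transl \<mu>" using aff_WeylE by blast
  have "\<forall>\<beta>\<in>PAJ. aff_act w \<mu> \<beta> \<in> PA" using x unfolding w(3) aff_action_Weyl[OF w(1)] by blast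
  then show "x \<in> aff_min_reps \<Phi> \<Delta> J" unfolding aff_min_reps_def using w by blast
qed

lemma par_aff_action_root:
  assumes "u \<in> par_aff_Weyl J" "\<beta> \<in> PAJ"
  shows "fst (aff_action u \<beta>) \<in> RJ"
proof -
  obtain w \<nu> where u: "w \<in> WJ" "\<nu> \<in> QJ" "u = w \<circ> transl \<nu>" using par_aff_WeylE assms(1) .
  have W: "w \<in> Weyl \<Phi>" using u(1) par_Weyl_subset by blast
  have "fst \<beta> \<in> RJ" using assms(2) by (simp add: par_aff_pos_roots_def)
  then show ?thesis unfolding u(3) aff_action_Weyl[OF W] using par_Weyl_root[OF u(1)] by (simp add: aff_act_def)
qed

text \<open>Two test roots over a positive \<gamma>: if an element w t_\<mu> sends both to positive
  roots, the integral pairing of \<mu> with \<gamma> can only be 0 or -1.\<close>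

lemma PAJ_I: "\<gamma> \<in> PJ \<Longrightarrow> (\<gamma>, 0) \<in> PAJ \<and> (- \<gamma>, 1) \<in> PAJ"
  using PJ_root[of \<gamma>] pos_root J.uminus_root[of \<gamma>] by (auto simp: par_aff_pos_roots_def aff_pos_iff)

text \<open>The test roots bound all pairings of \<nu> with \<Phi>_J by 1, so \<nu> vanishes by
  \<open>minuscule_lattice_zero\<close>, and what remains is an element of W_J without inversions. A
  descent argument as in \<open>aff.eq_id_if_pos\<close> is not at hand here, since \<Phi>_J may be
  reducible.\<close>

lemma par_aff_eq_id:
  assumes u: "u \<in> par_aff_Weyl J" and pos: "\<And>\<beta>. \<beta> \<in> PAJ \<Longrightarrow> aff_action u \<beta> \<in> PA"
  shows "u = id"
proof -
  obtain w \<nu> where u': "w \<in> WJ" "\<nu> \<in> QJ" "u = w \<circ> transl \<nu>" using par_aff_WeylE u .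
  have W: "w \<in> Weyl \<Phi>" using u'(1) par_Weyl_subset by blast
  have g: "(w \<gamma>, - (\<nu> \<bullet> \<gamma>)) \<in> PA" "(w (- \<gamma>), 1 + \<nu> \<bullet> \<gamma>) \<in> PA" if "\<gamma> \<in> PJ" for \<gamma>
    using pos[of "(\<gamma>, 0)"] pos[of "(- \<gamma>, 1)"] PAJ_I[OF that]
    unfolding u'(3) aff_action_Weyl[OF W] by (simp_all add: aff_act_def)
  have b: "\<bar>\<nu> \<bullet> \<gamma>\<bar> \<le> 1" if "\<gamma> \<in> PJ" for \<gamma>
    using g[OF that] by (auto simp: aff_pos_iff)
  have "\<bar>\<nu> \<bullet> \<alpha>\<bar> \<le> 1" if "\<alpha> \<in> RJ" for \<alpha>
    using b[of \<alpha>] b[of "- \<alpha>"] par_neg_iff[OF that] that by (cases "\<alpha> \<in> P") (auto simp: par_pos_roots_def)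
  then have \<nu>: "\<nu> = 0" using minuscule_lattice_zero u'(2) by blast
  have "w = id"
  proof (rule J.Weyl_eq_id)
    show "w \<in> Weyl RJ" using u'(1) par_Weyl_eq by simp
    fix \<beta> assume "\<beta> \<in> J.P"
    then have \<beta>: "\<beta> \<in> PJ" using pos_J by simp
    then have "w \<beta> \<in> P" using g(1)[OF \<beta>] \<nu> by (simp add: aff_pos_iff)
    moreover have "w \<beta> \<in> RJ" using par_Weyl_root u'(1) \<beta> PJ_root by blast
    ultimately show "w \<beta> \<in> J.P" unfolding pos_J by (simp add: par_pos_roots_def)
  qed
  then show ?thesis unfolding u'(3) \<nu> transl_0 by simp
qed

text \<open>If \<open>u\<close> sent \<beta> to a negative root, the opposite root would be positive
  over \<Phi>_J and kept positive by \<open>x\<close>, so \<open>x \<circ> u\<close> would send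
  \<beta> to a negative root. Hence \<open>par_aff_eq_id\<close> applies.\<close>

lemma aff_min_reps_unique:
  assumes x: "x \<in> aff_min_reps \<Phi> \<Delta> J" "x \<circ> u \<in> aff_min_reps \<Phi> \<Delta> J" and u: "u \<in> par_aff_Weyl J"
  shows "u = id"
proof (rule par_aff_eq_id[OF u])
  fix \<beta> assume \<beta>: "\<beta> \<in> PAJ"
  have xW: "x \<in> WA" and uW: "u \<in> WA" using x(1) aff_min_reps_iff u par_aff_subset by blast+
  let ?\<gamma> = "aff_action u \<beta>"
  have r: "?\<gamma> \<in> aff_roots \<Phi>" using \<beta> aff_action_root[OF uW] aff_pos_root by (simp add: par_aff_pos_roots_def)
  have p: "aff_action x ?\<gamma> \<in> PA" using x(2) \<beta> aff_action_comp[OF xW uW] aff_min_reps_iff by metis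
  show "?\<gamma> \<in> PA"
  proof (rule ccontr)
    assume "?\<gamma> \<notin> PA"
    then have "- ?\<gamma> \<in> PA" using aff_root_cases[OF r] by blast
    moreover have "fst (- ?\<gamma>) \<in> RJ" using par_aff_action_root[OF u \<beta>] J.uminus_root by simp
    ultimately have "- ?\<gamma> \<in> PAJ" by (simp add: par_aff_pos_roots_def)
    then have "- aff_action x ?\<gamma> \<in> PA" using x(1) aff_min_reps_iff aff_action_uminus[OF xW] by metis
    then show False using p aff_pos_not_neg by blast
  qed
qed

text \<open>An element of minimal length in the coset has no inversion over \<Phi>_J: the reflection
  in one would shorten it without leaving the coset.\<close>

lemma aff_min_reps_exists:
  assumes x: "x \<in> WA"
  obtains x1 u where "x1 \<in> aff_min_reps \<Phi> \<Delta> J" "u \<in> par_aff_Weyl J" "x = x1 \<circ> u"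
proof -
  have id: "id \<in> par_aff_Weyl J"
    using par_aff_WeylI[of id 0] by (simp add: transl_0 par_Weyl_def coroot_lattice_def int_span_0)
  obtain u where u: "u \<in> par_aff_Weyl J" "\<And>u'. u' \<in> par_aff_Weyl J \<Longrightarrow> aff_len (x \<circ> u) \<le> aff_len (x \<circ> u')"
    using ex_has_least_nat[of "\<lambda>u. u \<in> par_aff_Weyl J" id "\<lambda>u. aff_len (x \<circ> u)"] id by auto
  have xu: "x \<circ> u \<in> WA" using x u(1) par_aff_subset aff_Weyl_comp by blast
  have "aff_action (x \<circ> u) \<beta> \<in> PA" if \<beta>: "\<beta> \<in> PAJ" for \<beta>
  proof (rule ccontr)
    assume "aff_action (x \<circ> u) \<beta> \<notin> PA"
    moreover have "\<beta> \<in> PA" using \<beta> by (simp add: par_aff_pos_roots_def)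
    ultimately have "aff_len (x \<circ> u \<circ> aff_refl \<beta>) < aff_len (x \<circ> u)" using aff_len_refl(1)[OF xu] by blast
    moreover have "aff_len (x \<circ> u) \<le> aff_len (x \<circ> (u \<circ> aff_refl \<beta>))"
      using u par_aff_comp[OF u(1) par_aff_refl[OF \<beta>]] by blast
    ultimately show False by (simp add: comp_assoc)
  qed
  then have m: "x \<circ> u \<in> aff_min_reps \<Phi> \<Delta> J" using aff_min_reps_iff xu by blast
  obtain u' where u': "u' \<in> par_aff_Weyl J" "u \<circ> u' = id" using par_aff_inverse u(1) by metis
  have "x = (x \<circ> u) \<circ> u'" unfolding comp_assoc u'(2) by simp
  then show ?thesis using that m u'(1) by blast
qed

lemma aff_proj_eqI:
  assumes x1: "x1 \<in> aff_min_reps \<Phi> \<Delta> J" and u: "u \<in> par_aff_Weyl J" "x = x1 \<circ> u"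
  shows "aff_proj \<Phi> \<Delta> J x = x1"
  unfolding aff_proj_def
proof (rule the_equality)
  show "x1 \<in> aff_min_reps \<Phi> \<Delta> J \<and> (\<exists>x2\<in>par_aff_Weyl J. x = x1 \<circ> x2)" using assms by blast
  fix y assume "y \<in> aff_min_reps \<Phi> \<Delta> J \<and> (\<exists>x2\<in>par_aff_Weyl J. x = y \<circ> x2)"
  then obtain v where y: "y \<in> aff_min_reps \<Phi> \<Delta> J" "v \<in> par_aff_Weyl J" "x = y \<circ> v" by blast
  obtain v' where v': "v' \<in> par_aff_Weyl J" "v \<circ> v' = id" using par_aff_inverse y(2) by metis
  have "x1 \<circ> (u \<circ> v') = (y \<circ> v) \<circ> v'" using u y by (simp only: comp_assoc)
  then have e: "x1 \<circ> (u \<circ> v') = y" unfolding comp_assoc v'(2) by simp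
  then have "u \<circ> v' = id" using aff_min_reps_unique[OF x1 _ par_aff_comp[OF u(1) v'(1)]] y(1) by simp
  then show "y = x1" using e by simp
qed

text \<open>Makes \<open>z\<close> explicit and replaces the projection by conditions on pairings;
  \<open>adjustedD\<close> and \<open>adjustedI\<close> give the equivalence.\<close>

definition adjusted :: "('a \<Rightarrow> 'a) \<Rightarrow> 'a \<Rightarrow> bool" where
  "adjusted z \<mu> \<longleftrightarrow> z \<in> WJ \<and> \<mu> \<in> QL \<and> (\<forall>\<gamma>\<in>PJ. \<mu> \<bullet> \<gamma> = - neg_ind z \<gamma>)"

text \<open>Comparing linear parts in the factorization of \<open>transl \<mu>\<close> puts
  \<open>z\<close> into W_J. The test roots over \<gamma> are sent to the levels
  \<open>- (\<mu> \<bullet> \<gamma>)\<close> and \<open>1 + \<mu> \<bullet> \<gamma>\<close>, which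
  leaves the pairings 0 and -1; the image at level 0 then fixes the sign of
  \<open>z \<gamma>\<close>.\<close>

lemma adjustedD:
  assumes adj: "J_adjusted \<Phi> \<Delta> J \<mu>" and z: "aff_proj \<Phi> \<Delta> J (transl \<mu>) = z \<circ> transl \<mu>"
  shows "adjusted z \<mu>"
proof -
  from adj obtain z0 where z0: "\<mu> \<in> QL" "z0 \<in> Weyl \<Phi>" "aff_proj \<Phi> \<Delta> J (transl \<mu>) = z0 \<circ> transl \<mu>"
    unfolding J_adjusted_def by blast
  then have "z = z0" using z transl_cancel by metis
  then have zW: "z \<in> Weyl \<Phi>" using z0 by simp
  have "transl \<mu> \<in> WA" using aff_WeylI[OF Weyl_id z0(1)] by simp
  then obtain x1 u where x1: "x1 \<in> aff_min_reps \<Phi> \<Delta> J" "u \<in> par_aff_Weyl J" "transl \<mu> = x1 \<circ> u"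
    using aff_min_reps_exists by metis
  then have x1z: "x1 = z \<circ> transl \<mu>" using aff_proj_eqI z by metis
  obtain w \<nu> where w: "w \<in> WJ" "\<nu> \<in> QJ" "u = w \<circ> transl \<nu>" using par_aff_WeylE x1(2) .
  have wW: "w \<in> Weyl \<Phi>" using w(1) par_Weyl_subset by blast
  have "(z \<circ> w) \<circ> transl (inv w \<mu> + \<nu>) = id \<circ> transl \<mu>"
    using x1(3) aff_comp[OF wW, of z \<mu> \<nu>] unfolding x1z w(3) by simp
  then have zw: "z \<circ> w = id" using linear_transl_eq(1) Weyl_linear Weyl_comp[OF zW wW] linear_id by blast
  have "z = (z \<circ> w) \<circ> inv w" using Weyl_inv(5)[OF wW] by (simp add: comp_assoc)
  then have "z = inv w" by (simp add: zw)
  then have zJ: "z \<in> WJ" using par_Weyl_inv w(1) by simp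
  have "\<mu> \<bullet> \<gamma> = - neg_ind z \<gamma>" if \<gamma>: "\<gamma> \<in> PJ" for \<gamma>
  proof -
    have "aff_action x1 (\<gamma>, 0) \<in> PA" "aff_action x1 (- \<gamma>, 1) \<in> PA"
      using x1(1) PAJ_I[OF \<gamma>] aff_min_reps_iff by blast+
    then have g: "(z \<gamma>, - (\<mu> \<bullet> \<gamma>)) \<in> PA" "(- z \<gamma>, 1 + \<mu> \<bullet> \<gamma>) \<in> PA"
      unfolding x1z aff_action_Weyl[OF zW] by (simp_all add: aff_act_def linear_neg[OF Weyl_linear[OF zW]])
    obtain i where i: "\<mu> \<bullet> \<gamma> = real_of_int i"
      using lattice_pairing[OF z0(1)] \<gamma> PJ_root pos_root by (metis Ints_cases)
    have "i = 0 \<or> i = - 1" using g i by (auto simp: aff_pos_iff)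
    then show ?thesis using g i pos_not_neg by (auto simp: aff_pos_iff)
  qed
  then show ?thesis unfolding adjusted_def using zJ z0(1) by blast
qed

lemma adjustedI:
  assumes "adjusted z \<mu>"
  shows "J_adjusted \<Phi> \<Delta> J \<mu>" "aff_proj \<Phi> \<Delta> J (transl \<mu>) = z \<circ> transl \<mu>"
proof -
  have z: "z \<in> WJ" and \<mu>: "\<mu> \<in> QL" and g: "\<And>\<gamma>. \<gamma> \<in> PJ \<Longrightarrow> \<mu> \<bullet> \<gamma> = - neg_ind z \<gamma>"
    using assms by (auto simp: adjusted_def)
  have zW: "z \<in> Weyl \<Phi>" using z par_Weyl_subset by blast
  have "aff_action (z \<circ> transl \<mu>) \<beta> \<in> PA" if \<beta>: "\<beta> \<in> PAJ" for \<beta>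
  proof -
    obtain \<gamma> n where b: "\<beta> = (\<gamma>, n)" by fastforce
    have \<gamma>: "\<gamma> \<in> RJ" "n \<in> \<int>" "n > 0 \<or> n = 0 \<and> \<gamma> \<in> P" "\<gamma> \<in> \<Phi>"
      using \<beta> b by (auto simp: par_aff_pos_roots_def aff_pos_iff)
    have zg: "z \<gamma> \<in> \<Phi>" "z (- \<gamma>) = - z \<gamma>" using Weyl_root[OF zW \<gamma>(4)] linear_neg[OF Weyl_linear[OF zW]] by auto
    have i: "\<mu> \<bullet> \<gamma> \<in> \<int>" using lattice_pairing[OF \<mu> \<gamma>(4)] .
    have n1: "n > 0 \<Longrightarrow> n \<ge> 1" using \<gamma>(2) by (auto elim!: Ints_cases)
    have "n - \<mu> \<bullet> \<gamma> > 0 \<or> n - \<mu> \<bullet> \<gamma> = 0 \<and> z \<gamma> \<in> P"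
    proof (cases "\<gamma> \<in> P")
      case True
      then have "\<mu> \<bullet> \<gamma> = - neg_ind z \<gamma>" using g \<gamma>(1) by (simp add: par_pos_roots_def)
      then show ?thesis using \<gamma>(3) by auto
    next
      case False
      then have "\<mu> \<bullet> (- \<gamma>) = - neg_ind z (- \<gamma>)" using g par_neg_iff \<gamma>(1) by blast
      then have "\<mu> \<bullet> \<gamma> = neg_ind z (- \<gamma>)" by simp
      then show ?thesis using \<gamma>(3) False n1 zg neg_iff[of "z \<gamma>"] by (auto split: if_splits)
    qed
    then show ?thesis
      unfolding aff_action_Weyl[OF zW] b using zg(1) i \<gamma>(2) by (auto simp: aff_act_def aff_pos_iff)
  qed
  then have m: "z \<circ> transl \<mu> \<in> aff_min_reps \<Phi> \<Delta> J" using aff_min_reps_iff aff_WeylI[OF zW \<mu>] by blast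
  \<comment> \<open>The complementary factor: \<open>z \<circ> transl \<mu> \<circ> inv z\<close> is
    the translation by \<open>z \<mu>\<close>, and the rest makes up the difference to
    \<mu>.\<close>
  let ?u = "inv z \<circ> transl (\<mu> - z \<mu>)"
  have u: "?u \<in> par_aff_Weyl J" using par_aff_WeylI[OF par_Weyl_inv[OF z] lattice_diff_J[OF z \<mu>]] .
  have "transl \<mu> = (z \<circ> transl \<mu>) \<circ> ?u"
  proof
    fix v
    have "((z \<circ> transl \<mu>) \<circ> ?u) v = z (inv z (v + (\<mu> - z \<mu>)) + \<mu>)" by (simp add: transl_def)
    also have "\<dots> = v + \<mu>"
      unfolding linear_add[OF Weyl_linear[OF zW]] Weyl_inv(4)[OF zW] by simp
    finally show "transl \<mu> v = ((z \<circ> transl \<mu>) \<circ> ?u) v" by (simp add: transl_def)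
  qed
  then show p: "aff_proj \<Phi> \<Delta> J (transl \<mu>) = z \<circ> transl \<mu>" using aff_proj_eqI[OF m u] by blast
  then show "J_adjusted \<Phi> \<Delta> J \<mu>" unfolding J_adjusted_def using \<mu> zW by blast
qed

lemma Omega_iff:
  "x \<in> Omega \<Phi> \<Delta> J N \<longleftrightarrow>
    (\<exists>w z \<mu>. w \<in> MJ \<and> adjusted z \<mu> \<and> J_superantidominant \<Phi> \<Delta> J N \<mu> \<and> x = w \<circ> z \<circ> transl \<mu>)"
proof
  assume "x \<in> Omega \<Phi> \<Delta> J N"
  then obtain w \<mu> where w: "w \<in> MJ" "J_superantidominant \<Phi> \<Delta> J N \<mu>" "J_adjusted \<Phi> \<Delta> J \<mu>"
    "x = w \<circ> aff_proj \<Phi> \<Delta> J (transl \<mu>)" unfolding Omega_def by blast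
  then obtain z where z: "aff_proj \<Phi> \<Delta> J (transl \<mu>) = z \<circ> transl \<mu>" unfolding J_adjusted_def by blast
  then have "x = w \<circ> z \<circ> transl \<mu>" unfolding w(4) by (simp only: comp_assoc)
  then show "\<exists>w z \<mu>. w \<in> MJ \<and> adjusted z \<mu> \<and> J_superantidominant \<Phi> \<Delta> J N \<mu> \<and> x = w \<circ> z \<circ> transl \<mu>"
    using w adjustedD[OF w(3) z] by blast
next
  assume "\<exists>w z \<mu>. w \<in> MJ \<and> adjusted z \<mu> \<and> J_superantidominant \<Phi> \<Delta> J N \<mu> \<and> x = w \<circ> z \<circ> transl \<mu>"
  then obtain w z \<mu> where w: "w \<in> MJ" "adjusted z \<mu>" "J_superantidominant \<Phi> \<Delta> J N \<mu>"
    "x = w \<circ> z \<circ> transl \<mu>" by blast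
  have "x = w \<circ> aff_proj \<Phi> \<Delta> J (transl \<mu>)" unfolding adjustedI(2)[OF w(2)] w(4) by (simp only: comp_assoc)
  then show "x \<in> Omega \<Phi> \<Delta> J N" unfolding Omega_def using w adjustedI(1)[OF w(2)] by blast
qed

section \<open>Lengths of elements of the form v z t_\<mu>\<close>

lemma par_Weyl_length_sum: "z \<in> WJ \<Longrightarrow> real (lenW z) = (\<Sum>\<gamma>\<in>PJ. neg_ind z \<gamma>)"
  using par_Weyl_length sum_neg_indicator[OF finite_PJ] by simp

text \<open>Summing the defining pairings over the positive roots of \<Phi>_J counts the inversions
  of \<open>z\<close>. Needed to pass from lengths in W^J to lengths in W.\<close>

lemma adjusted_length: "adjusted z \<mu> \<Longrightarrow> real (lenW z) = - (\<mu> \<bullet> inner_sum)"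
proof -
  assume a: "adjusted z \<mu>"
  have "\<mu> \<bullet> inner_sum = (\<Sum>\<gamma>\<in>PJ. \<mu> \<bullet> \<gamma>)" by (simp add: inner_sum_def inner_sum_right)
  also have "\<dots> = (\<Sum>\<gamma>\<in>PJ. - neg_ind z \<gamma>)" using a by (intro sum.cong) (auto simp: adjusted_def)
  finally show ?thesis using par_Weyl_length_sum a by (simp add: adjusted_def sum_negf)
qed

text \<open>On \<Phi>_J the signs under \<open>v \<circ> z\<close> are those under \<open>z\<close>.
  Outside it \<open>card_outer\<close> removes \<open>z\<close> from the count, so the sum without
  absolute values sees only \<open>v\<close> and \<mu>.\<close>

lemma aff_len_split:
  assumes v: "v \<in> MJ" and z: "z \<in> WJ" and \<mu>: "\<mu> \<in> QL"
  shows "real (aff_len (v \<circ> z \<circ> transl \<mu>)) =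
    (\<Sum>\<gamma>\<in>PJ. \<bar>\<mu> \<bullet> \<gamma> + neg_ind z \<gamma>\<bar>) + (\<Sum>\<alpha>\<in>P - PJ. \<bar>\<mu> \<bullet> \<alpha> + neg_ind (v \<circ> z) \<alpha>\<bar>)"
    and "(\<Sum>\<alpha>\<in>P - PJ. - (\<mu> \<bullet> \<alpha> + neg_ind (v \<circ> z) \<alpha>)) = - (\<mu> \<bullet> outer_sum) - real (lenW v)"
proof -
  have vz: "v \<circ> z \<in> Weyl \<Phi>" using v z min_reps_Weyl par_Weyl_subset Weyl_comp by blast
  have "neg_ind (v \<circ> z) \<gamma> = neg_ind z \<gamma>" if "\<gamma> \<in> PJ" for \<gamma>
    using min_reps_par_root_iff[OF v par_Weyl_root[OF z]] that PJ_root by simp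
  then show "real (aff_len (v \<circ> z \<circ> transl \<mu>)) =
    (\<Sum>\<gamma>\<in>PJ. \<bar>\<mu> \<bullet> \<gamma> + neg_ind z \<gamma>\<bar>) + (\<Sum>\<alpha>\<in>P - PJ. \<bar>\<mu> \<bullet> \<alpha> + neg_ind (v \<circ> z) \<alpha>\<bar>)"
    unfolding aff_len_formula[OF vz \<mu>] sum_P_split by simp
  have "(\<Sum>\<alpha>\<in>P - PJ. neg_ind (v \<circ> z) \<alpha>) = real (lenW v)"
    using sum_neg_indicator[of "P - PJ" "\<lambda>\<alpha>. (v \<circ> z) \<alpha> \<in> P"] finite_pos card_outer[OF z, of v]
      min_reps_length[OF v] by simp
  moreover have "\<mu> \<bullet> outer_sum = (\<Sum>\<alpha>\<in>P - PJ. \<mu> \<bullet> \<alpha>)" by (simp add: outer_sum_def inner_sum_right)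
  ultimately show "(\<Sum>\<alpha>\<in>P - PJ. - (\<mu> \<bullet> \<alpha> + neg_ind (v \<circ> z) \<alpha>)) = - (\<mu> \<bullet> outer_sum) - real (lenW v)"
    unfolding sum_negf sum.distrib by simp
qed

text \<open>Meant for elements not yet known to lie in \<open>Omega\<close>: each absolute value
  outside \<Phi>_J is bounded below by the negated term, and the terms of \<Phi>_J are kept as an
  explicit excess.\<close>

lemma aff_len_lower:
  assumes "v \<in> MJ" "z \<in> WJ" "\<mu> \<in> QL"
  shows "real (aff_len (v \<circ> z \<circ> transl \<mu>)) \<ge>
    - (\<mu> \<bullet> outer_sum) - real (lenW v) + (\<Sum>\<gamma>\<in>PJ. \<bar>\<mu> \<bullet> \<gamma> + neg_ind z \<gamma>\<bar>)"
proof -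
  have "(\<Sum>\<alpha>\<in>P - PJ. - (\<mu> \<bullet> \<alpha> + neg_ind (v \<circ> z) \<alpha>)) \<le> (\<Sum>\<alpha>\<in>P - PJ. \<bar>\<mu> \<bullet> \<alpha> + neg_ind (v \<circ> z) \<alpha>\<bar>)"
    by (rule sum_mono) (rule abs_ge_minus_self)
  then show ?thesis unfolding aff_len_split(1)[OF assms] aff_len_split(2)[OF assms] by linarith
qed

text \<open>Pairings of at most -1 absorb the indicators, so every absolute value outside \<Phi>_J
  opens with a minus sign and the lower bound is attained.\<close>

lemma aff_len_adjusted:
  assumes v: "v \<in> MJ" and adj: "adjusted z \<mu>" and neg: "\<And>\<alpha>. \<alpha> \<in> P - PJ \<Longrightarrow> \<mu> \<bullet> \<alpha> \<le> - 1"
  shows "real (aff_len (v \<circ> z \<circ> transl \<mu>)) = - (\<mu> \<bullet> outer_sum) - real (lenW v)"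
proof -
  have z: "z \<in> WJ" "\<mu> \<in> QL" "\<And>\<gamma>. \<gamma> \<in> PJ \<Longrightarrow> \<mu> \<bullet> \<gamma> + neg_ind z \<gamma> = 0"
    using adj by (auto simp: adjusted_def)
  have "(\<Sum>\<gamma>\<in>PJ. \<bar>\<mu> \<bullet> \<gamma> + neg_ind z \<gamma>\<bar>) = 0" using z(3) by (intro sum.neutral) simp
  moreover have "(\<Sum>\<alpha>\<in>P - PJ. \<bar>\<mu> \<bullet> \<alpha> + neg_ind (v \<circ> z) \<alpha>\<bar>) = (\<Sum>\<alpha>\<in>P - PJ. - (\<mu> \<bullet> \<alpha> + neg_ind (v \<circ> z) \<alpha>))"
  proof (rule sum.cong[OF refl])
    fix \<alpha> assume "\<alpha> \<in> P - PJ"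
    then have "\<mu> \<bullet> \<alpha> \<le> - 1" by (rule neg)
    moreover have "neg_ind (v \<circ> z) \<alpha> \<le> 1" by simp
    ultimately show "\<bar>\<mu> \<bullet> \<alpha> + neg_ind (v \<circ> z) \<alpha>\<bar> = - (\<mu> \<bullet> \<alpha> + neg_ind (v \<circ> z) \<alpha>)" by linarith
  qed
  ultimately show ?thesis using aff_len_split[OF v z(1,2)] by simp
qed

end


section \<open>Edges and covers\<close>

context based_roots
begin

lemma par_roots_empty: "par_roots \<Phi> {} = {}"
  using zero_notin by (auto simp: par_roots_def int_span_def)

lemma par_pos_roots_empty: "par_pos_roots \<Phi> \<Delta> {} = {}"
  by (simp add: par_pos_roots_def par_roots_empty)

lemma par_Weyl_empty: "u \<in> par_Weyl {} \<Longrightarrow> u = id"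
  unfolding par_Weyl_def by (induction rule: generated_induct) auto

lemma min_reps_empty: "min_reps \<Phi> \<Delta> {} = Weyl \<Phi>"
  using par_Weyl_empty by (fastforce simp: min_reps_def)

lemma min_rep_empty: "w \<in> Weyl \<Phi> \<Longrightarrow> min_rep \<Phi> \<Delta> {} w = w"
  unfolding min_rep_def
proof (rule the_equality)
  assume "w \<in> Weyl \<Phi>"
  moreover have "id \<in> par_Weyl {}" unfolding par_Weyl_def by (rule generated_id)
  moreover have "w = w \<circ> id" by simp
  ultimately show "w \<in> min_reps \<Phi> \<Delta> {} \<and> (\<exists>u\<in>par_Weyl {}. w = w \<circ> u)" unfolding min_reps_empty by blast
  fix w' assume "w' \<in> min_reps \<Phi> \<Delta> {} \<and> (\<exists>u\<in>par_Weyl {}. w' = w \<circ> u)"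
  then show "w' = w" using par_Weyl_empty comp_id by metis
qed

lemma QB_bruhat_edge_empty:
  assumes "u \<in> Weyl \<Phi>" "\<beta> \<in> P" "v = u \<circ> refl_root \<beta>" "lenW v = Suc (lenW u)"
  shows "QB_bruhat_edge \<Phi> \<Delta> {} u \<beta> v"
  using assms Weyl_comp[OF assms(1) refl_Weyl[OF pos_root[OF assms(2)]]]
  unfolding QB_bruhat_edge_def Weyl_cover_iff min_reps_empty par_pos_roots_empty
  by (metis Diff_empty min_rep_empty)

lemma QB_quantum_edge_empty:
  assumes "u \<in> Weyl \<Phi>" "\<beta> \<in> P" "v = u \<circ> refl_root \<beta>"
    "real (lenW v) = real (lenW u) + 1 - coroot \<beta> \<bullet> (2 *\<^sub>R rho \<Phi> \<Delta>)"
  shows "QB_quantum_edge \<Phi> \<Delta> {} u \<beta> v"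
proof -
  have "par_rho \<Phi> \<Delta> {} = 0" by (simp add: par_rho_def par_pos_roots_empty)
  moreover have "v = min_rep \<Phi> \<Delta> {} v"
    using min_rep_empty Weyl_comp[OF assms(1) refl_Weyl[OF pos_root[OF assms(2)]]] assms(3) by simp
  ultimately show ?thesis
    unfolding QB_quantum_edge_def min_reps_empty par_pos_roots_empty using assms by simp
qed

end

context parabolic_roots
begin

text \<open>If \<open>w \<circ> refl_root \<alpha>\<close> made some \<open>j\<close> in
  \<open>J\<close> negative, the lengths of \<open>w\<close>, \<open>w \<circ> refl_root j\<close>,
  \<open>w \<circ> refl_root \<alpha> \<circ> refl_root j\<close> and
  \<open>w \<circ> refl_root \<alpha>\<close> would strictly increase, too much for a cover.
  Positivity on \<open>J\<close> extends to all positive roots of \<Phi>_J by additivity.\<close>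

lemma Bruhat_cover_min_reps:
  assumes w: "w \<in> MJ" and \<alpha>: "\<alpha> \<in> P - PJ"
    and len: "lenW (w \<circ> refl_root \<alpha>) = Suc (lenW w)"
  shows "w \<circ> refl_root \<alpha> \<in> MJ"
proof -
  let ?y = "w \<circ> refl_root \<alpha>"
  have W: "w \<in> Weyl \<Phi>" using w min_reps_Weyl by blast
  have \<alpha>P: "\<alpha> \<in> P" and y: "?y \<in> Weyl \<Phi>" using \<alpha> W Weyl_comp refl_Weyl pos_root by blast+
  have w\<alpha>: "w \<alpha> \<in> P" using Weyl_length_refl(2)[OF W \<alpha>P] len by simp
  have simple: "?y j \<in> P" if j: "j \<in> J" for j
  proof (rule ccontr)
    assume n: "?y j \<notin> P"
    have jP: "j \<in> \<Delta>" "j \<in> P" "j \<in> PJ" using j J simple_pos J.base by (auto simp: par_pos_roots_def)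
    then have "\<alpha> \<noteq> j" using \<alpha> by blast
    then have "lenW (w \<circ> refl_root j) < lenW (?y \<circ> refl_root j)"
      using fin.edge_shift[of w \<alpha> j] W \<alpha>P w\<alpha> jP(1) unfolding Weyl_length_def Weyl_eq by blast
    moreover have "lenW (?y \<circ> refl_root j) < lenW ?y"
      using Weyl_length_refl(1)[OF y jP(2)] n by blast
    moreover have "lenW w < lenW (w \<circ> refl_root j)"
      using Weyl_length_refl(2)[OF W jP(2)] w jP(3) min_reps_iff by blast
    ultimately show False using len by linarith
  qed
  have "?y \<beta> \<in> P" if \<beta>: "\<beta> \<in> PJ" for \<beta>
  proof -
    have "\<beta> \<in> nat_span J" using par_pos_nat_span \<beta> .
    then have "?y \<beta> \<in> nat_span \<Delta>"
    proof (induction rule: nat_span_induct)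
      case (base s)
      then show ?case using simple by (simp add: pos_roots_def)
    next
      case (add a b)
      then show ?case using nat_span_add linear_add[OF Weyl_linear[OF y]] by metis
    qed (simp add: nat_span_0 linear_0[OF Weyl_linear[OF W]] linear_0[OF linear_refl_root])
    then show ?thesis using Weyl_root[OF y] \<beta> PJ_root pos_root by (simp add: pos_roots_def)
  qed
  then show ?thesis using y min_reps_iff by blast
qed

end

context irreducible_parabolic_roots
begin

text \<open>The element z t_\<mu> sends the affine root of the reflection to \<alpha> + c\<delta>,
  so the reflection can be moved to its left. The first form is the one of the theorem; the second
  separates the linear part from the translation.\<close>

lemma refl_formula:
  assumes z: "z \<in> WJ"
  shows "(w \<circ> z \<circ> transl \<mu>) \<circ> aff_refl (inv z \<alpha>, c + \<mu> \<bullet> inv z \<alpha>) =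
      w \<circ> refl_root \<alpha> \<circ> transl (c *\<^sub>R coroot \<alpha>) \<circ> z \<circ> transl \<mu>"
    and "(w \<circ> z \<circ> transl \<mu>) \<circ> aff_refl (inv z \<alpha>, c + \<mu> \<bullet> inv z \<alpha>) =
      (w \<circ> refl_root \<alpha> \<circ> z) \<circ> transl (\<mu> + c *\<^sub>R coroot (inv z \<alpha>))"
proof -
  let ?l = "(w \<circ> z \<circ> transl \<mu>) \<circ> aff_refl (inv z \<alpha>, c + \<mu> \<bullet> inv z \<alpha>)"
  let ?m = "w \<circ> refl_root \<alpha> \<circ> transl (c *\<^sub>R coroot \<alpha>) \<circ> z \<circ> transl \<mu>"
  have zW: "z \<in> Weyl \<Phi>" using z par_Weyl_subset by blast
  have "aff_act z \<mu> (inv z \<alpha>, c + \<mu> \<bullet> inv z \<alpha>) = (\<alpha>, c)"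
    by (simp add: aff_act_def Weyl_inv(4)[OF zW])
  then have "(z \<circ> transl \<mu>) \<circ> aff_refl (inv z \<alpha>, c + \<mu> \<bullet> inv z \<alpha>) = aff_refl (\<alpha>, c) \<circ> (z \<circ> transl \<mu>)"
    using aff_refl_conj[OF Weyl_orthogonal[OF zW]] by simp
  then have "?l = w \<circ> (aff_refl (\<alpha>, c) \<circ> (z \<circ> transl \<mu>))" by (simp only: comp_assoc)
  then show l: "?l = ?m" by (simp only: aff_refl_def fst_conv snd_conv comp_assoc)
  have "inv z (c *\<^sub>R coroot \<alpha>) = c *\<^sub>R coroot (inv z \<alpha>)"
    using Weyl_coroot[OF Weyl_inv(1)[OF zW], of \<alpha>] linear_scale[OF Weyl_linear[OF Weyl_inv(1)[OF zW]]] by simp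
  then have t: "transl (c *\<^sub>R coroot \<alpha>) \<circ> z = z \<circ> transl (c *\<^sub>R coroot (inv z \<alpha>))"
    using transl_comp_Weyl[OF zW] by metis
  have "?m = w \<circ> refl_root \<alpha> \<circ> (transl (c *\<^sub>R coroot \<alpha>) \<circ> z) \<circ> transl \<mu>" by (simp only: comp_assoc)
  also have "\<dots> = w \<circ> refl_root \<alpha> \<circ> z \<circ> (transl (c *\<^sub>R coroot (inv z \<alpha>)) \<circ> transl \<mu>)"
    unfolding t by (simp only: comp_assoc)
  finally show "?l = (w \<circ> refl_root \<alpha> \<circ> z) \<circ> transl (\<mu> + c *\<^sub>R coroot (inv z \<alpha>))"
    unfolding l transl_comp by (simp only: add.commute)
qed

text \<open>Connecting roots come out negative, while \<open>aff_cover_iff\<close> asks for positive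
  ones; both define the same reflection.\<close>

lemma aff_coverI:
  assumes x: "x \<in> WA" and \<gamma>: "- \<gamma> \<in> PA" and len: "aff_len x = Suc (aff_len (x \<circ> aff_refl \<gamma>))"
  shows "aff_cover \<Phi> \<Delta> (x \<circ> aff_refl \<gamma>) x"
proof -
  have g: "aff_refl (- \<gamma>) = aff_refl \<gamma>" by (rule aff_refl_uminus)
  have "x \<circ> aff_refl \<gamma> \<in> WA"
    using aff_Weyl_comp[OF x aff_refl_in[OF aff_pos_root[OF \<gamma>]]] unfolding g .
  moreover have "x = x \<circ> aff_refl \<gamma> \<circ> aff_refl (- \<gamma>)" unfolding g comp_assoc aff_refl_invol by simp
  ultimately show ?thesis unfolding aff_cover_iff using \<gamma> len by blast
qed

text \<open>\<open>x\<close> sends the connecting root to the pair of \<open>w \<alpha>\<close> and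
  \<open>c\<close>. As the connecting root is negative, reflecting in it shortens \<open>x\<close>
  exactly if its image is positive.\<close>

lemma lift_descent:
  assumes w: "w \<in> Weyl \<Phi>" and z: "z \<in> WJ" and \<mu>: "\<mu> \<in> QL"
    and \<gamma>: "- (inv z \<alpha>, c + \<mu> \<bullet> inv z \<alpha>) \<in> PA"
  shows "aff_len ((w \<circ> z \<circ> transl \<mu>) \<circ> aff_refl (inv z \<alpha>, c + \<mu> \<bullet> inv z \<alpha>)) < aff_len (w \<circ> z \<circ> transl \<mu>)
    \<longleftrightarrow> (w \<alpha>, c) \<in> PA"
proof -
  let ?\<gamma> = "(inv z \<alpha>, c + \<mu> \<bullet> inv z \<alpha>)" and ?x = "w \<circ> z \<circ> transl \<mu>"
  have zW: "z \<in> Weyl \<Phi>" using z par_Weyl_subset by blast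
  have wz: "w \<circ> z \<in> Weyl \<Phi>" using Weyl_comp[OF w zW] .
  have x: "?x \<in> WA" using aff_WeylI[OF wz \<mu>] .
  have a: "aff_action ?x ?\<gamma> = (w \<alpha>, c)"
    unfolding aff_action_Weyl[OF wz] by (simp add: aff_act_def Weyl_inv(4)[OF zW])
  have "?\<gamma> \<in> aff_roots \<Phi>" using aff_pos_root[OF \<gamma>] unfolding aff_root_uminus_iff .
  then have r: "(w \<alpha>, c) \<in> aff_roots \<Phi>" using aff_action_root[OF x] a by metis
  have "aff_len (?x \<circ> aff_refl (- ?\<gamma>)) < aff_len ?x \<longleftrightarrow> - (w \<alpha>, c) \<notin> PA"
    unfolding aff_len_refl(1)[OF x \<gamma>] aff_action_uminus[OF x] a ..
  then show ?thesis unfolding aff_refl_uminus using aff_root_cases[OF r] aff_pos_not_neg by blast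
qed

lemma inv_outer: "z \<in> WJ \<Longrightarrow> \<alpha> \<in> P - PJ \<Longrightarrow> inv z \<alpha> \<in> P - PJ"
  using par_Weyl_outer par_Weyl_inv by blast

text \<open>
  For a quantum edge the length of \<open>y\<close> is at least \<open>\<ell>(x) - 1 + E\<close>, where \<open>E\<close> is the number of affine
  \<open>\<Phi>\<^sub>J\<close>-inversions of \<open>y\<close>. As \<open>y < x\<close>, this forces \<open>E = 0\<close>, so \<open>y\<close> is a minimal representative.
\<close>

lemma edge_lifts:
  assumes N: "N \<ge> 2" and d: "\<And>\<alpha> \<beta>. \<alpha> \<in> \<Phi> \<Longrightarrow> \<beta> \<in> \<Phi> \<Longrightarrow> coroot \<alpha> \<bullet> \<beta> \<le> real d"
    and edge: "c = 0 \<and> QB_bruhat_edge \<Phi> \<Delta> J w \<alpha> v \<or> c = 1 \<and> QB_quantum_edge \<Phi> \<Delta> J w \<alpha> v"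
    and sup: "J_superantidominant \<Phi> \<Delta> J (N + d) \<mu>" and adj: "adjusted z \<mu>"
  shows "Omega_cover \<Phi> \<Delta> J N ((w \<circ> z \<circ> transl \<mu>) \<circ> aff_refl (inv z \<alpha>, c + \<mu> \<bullet> inv z \<alpha>)) (w \<circ> z \<circ> transl \<mu>)"
    and "(inv z \<alpha>, c + \<mu> \<bullet> inv z \<alpha>) \<in> aff_neg_roots \<Phi> \<Delta>"
proof -
  let ?\<beta> = "inv z \<alpha>"
  let ?\<gamma> = "(?\<beta>, c + \<mu> \<bullet> ?\<beta>)" and ?x = "w \<circ> z \<circ> transl \<mu>"
  let ?y = "?x \<circ> aff_refl ?\<gamma>"
  have w: "w \<in> MJ" and \<alpha>: "\<alpha> \<in> P - PJ" and c: "c = 0 \<or> c = 1"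
    using edge by (auto simp: QB_bruhat_edge_def QB_quantum_edge_def)
  have z: "z \<in> WJ" and \<mu>: "\<mu> \<in> QL" using adj by (auto simp: adjusted_def)
  have W: "w \<in> Weyl \<Phi>" and zW: "z \<in> Weyl \<Phi>" using w min_reps_Weyl z par_Weyl_subset by blast+
  have \<beta>: "?\<beta> \<in> P - PJ" using inv_outer[OF z \<alpha>] .
  have \<beta>r: "?\<beta> \<in> \<Phi>" using \<beta> pos_root by blast
  have far: "\<mu> \<bullet> \<delta> \<le> - real (N + d)" if "\<delta> \<in> P - PJ" for \<delta>
    using sup that by (simp add: J_superantidominant_def)
  have sup0: "J_superantidominant \<Phi> \<Delta> J N \<mu>"
    using sup by (force simp: J_superantidominant_def)
  have i: "\<mu> \<bullet> ?\<beta> \<in> \<int>" using lattice_pairing[OF \<mu> \<beta>r] .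
  \<comment> \<open>The level is at most \<open>1 - N\<close>, hence negative for
    \<open>N \<ge> 2\<close>.\<close>
  have neg: "- ?\<gamma> \<in> PA"
    using far[OF \<beta>] c i \<beta>r N by (auto simp: aff_pos_iff)
  then show "?\<gamma> \<in> aff_neg_roots \<Phi> \<Delta>" using aff_neg_iff[of ?\<beta> "c + \<mu> \<bullet> ?\<beta>"] by simp
  have x: "?x \<in> WA" using aff_WeylI[OF Weyl_comp[OF W zW] \<mu>] .
  have xO: "?x \<in> Omega \<Phi> \<Delta> J N" using Omega_iff w adj sup0 by blast
  have lx: "real (aff_len ?x) = - (\<mu> \<bullet> outer_sum) - real (lenW w)"
  proof (rule aff_len_adjusted[OF w adj])
    fix \<delta> assume "\<delta> \<in> P - PJ"
    then show "\<mu> \<bullet> \<delta> \<le> - 1" using far[of \<delta>] N by simp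
  qed
  have yf: "?y = (w \<circ> refl_root \<alpha> \<circ> z) \<circ> transl (\<mu> + c *\<^sub>R coroot ?\<beta>)" by (rule refl_formula(2)[OF z])
  have "?y \<in> Omega \<Phi> \<Delta> J N \<and> aff_len ?x = Suc (aff_len ?y)"
    using edge
  proof (elim disjE conjE)
    assume c0: "c = 0" and e: "QB_bruhat_edge \<Phi> \<Delta> J w \<alpha> v"
    have "Weyl_cover \<Phi> \<Delta> w (w \<circ> refl_root \<alpha>)" using e by (simp add: QB_bruhat_edge_def)
    then have l: "lenW (w \<circ> refl_root \<alpha>) = Suc (lenW w)" by (simp add: Weyl_cover_iff)
    have m: "w \<circ> refl_root \<alpha> \<in> MJ" using Bruhat_cover_min_reps[OF w \<alpha> l] .
    have y: "?y = (w \<circ> refl_root \<alpha>) \<circ> z \<circ> transl \<mu>" using yf unfolding c0 scaleR_zero_left add_0_right .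
    have "real (aff_len ?y) = - (\<mu> \<bullet> outer_sum) - real (lenW (w \<circ> refl_root \<alpha>))"
      unfolding y
    proof (rule aff_len_adjusted[OF m adj])
      fix \<delta> assume "\<delta> \<in> P - PJ"
      then show "\<mu> \<bullet> \<delta> \<le> - 1" using far[of \<delta>] N by simp
    qed
    then have "aff_len ?x = Suc (aff_len ?y)" using lx l by linarith
    moreover have "?y \<in> Omega \<Phi> \<Delta> J N" unfolding y using Omega_iff m adj sup0 by blast
    ultimately show ?thesis by blast
  next
    assume c1: "c = 1" and e: "QB_quantum_edge \<Phi> \<Delta> J w \<alpha> v"
    let ?\<mu> = "\<mu> + coroot ?\<beta>"
    have lv: "real (lenW v) = real (lenW w) + 1 - coroot \<alpha> \<bullet> outer_sum"
      using e unfolding QB_quantum_edge_def two_rho_diff by blast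
    have "w \<circ> refl_root \<alpha> \<in> Weyl \<Phi>" using W Weyl_comp refl_Weyl pos_root \<alpha> by blast
    then obtain u where u: "u \<in> WJ" "v \<in> MJ" "w \<circ> refl_root \<alpha> = v \<circ> u"
      using min_rep e by (metis QB_quantum_edge_def)
    let ?z = "u \<circ> z"
    have z': "?z \<in> WJ" using par_Weyl_comp u(1) z by blast
    have y: "?y = v \<circ> ?z \<circ> transl ?\<mu>" using yf unfolding c1 u(3) by (simp only: comp_assoc scaleR_one)
    have \<mu>': "?\<mu> \<in> QL" using coroot_lattice_add[OF \<mu> coroot_in_lattice[OF \<beta>r]] .
    have "coroot ?\<beta> = inv z (coroot \<alpha>)" using Weyl_coroot[OF Weyl_inv(1)[OF zW]] .
    \<comment> \<open>2\<rho> - 2\<rho>_J is fixed by W_J, so carrying the coroot across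
      \<open>z\<close> does not affect the length count.\<close>
    then have cs: "coroot ?\<beta> \<bullet> outer_sum = coroot \<alpha> \<bullet> outer_sum"
      using inner_outer_sum[OF par_Weyl_inv[OF z]] by simp
    let ?E = "\<Sum>\<gamma>\<in>PJ. \<bar>?\<mu> \<bullet> \<gamma> + neg_ind ?z \<gamma>\<bar>"
    have low: "real (aff_len ?y) \<ge> - (?\<mu> \<bullet> outer_sum) - real (lenW v) + ?E"
      unfolding y by (rule aff_len_lower[OF u(2) z' \<mu>'])
    have "w \<alpha> \<in> \<Phi>" using Weyl_root[OF W] \<alpha> pos_root by blast
    then have "(w \<alpha>, c) \<in> PA" using c1 by (simp add: aff_pos_iff)
    then have less: "aff_len ?y < aff_len ?x" using lift_descent[OF W z \<mu> neg] by blast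
    have "?E \<ge> 0" by (intro sum_nonneg) simp
    moreover have "real (aff_len ?y) \<ge> real (aff_len ?x) - 1 + ?E"
      using low lx lv cs by (simp add: inner_add_left)
    ultimately have E: "?E = 0" and len: "aff_len ?x = Suc (aff_len ?y)" using less by linarith+
    have z0: "?\<mu> \<bullet> \<gamma> + neg_ind ?z \<gamma> = 0" if "\<gamma> \<in> PJ" for \<gamma>
      using E that sum_nonneg_eq_0_iff[OF finite_PJ, of "\<lambda>\<gamma>. \<bar>?\<mu> \<bullet> \<gamma> + neg_ind ?z \<gamma>\<bar>"] by auto
    then have adj': "adjusted ?z ?\<mu>" unfolding adjusted_def using z' \<mu>' by (auto simp: eq_neg_iff_add_eq_0)
    \<comment> \<open>Adding the coroot raises the pairing by at most \<open>d\<close>, which the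
      stronger threshold \<open>N + d\<close> on \<mu> allows for.\<close>
    have far': "?\<mu> \<bullet> \<delta> \<le> - real N" if \<delta>: "\<delta> \<in> P - PJ" for \<delta>
    proof -
      have "coroot ?\<beta> \<bullet> \<delta> \<le> real d" using d \<beta>r \<delta> pos_root by blast
      then show ?thesis using far[OF \<delta>] by (simp add: inner_add_left)
    qed
    \<comment> \<open>Within \<Phi>_J antidominance is a consequence of adjustedness: the pairing is
      minus an indicator.\<close>
    have "?\<mu> \<bullet> \<delta> \<le> 0" if "\<delta> \<in> P" for \<delta>
    proof (cases "\<delta> \<in> PJ")
      case True
      have "neg_ind ?z \<delta> \<ge> 0" by simp
      then show ?thesis using z0[OF True] by linarith
    next
      case False
      then show ?thesis using far'[of \<delta>] that by simp
    qed
    then have "J_superantidominant \<Phi> \<Delta> J N ?\<mu>"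
      unfolding J_superantidominant_def using \<mu>' far' by blast
    then have "?y \<in> Omega \<Phi> \<Delta> J N" unfolding y using Omega_iff u(2) adj' by blast
    then show ?thesis using len by blast
  qed
  then have yO: "?y \<in> Omega \<Phi> \<Delta> J N" and len: "aff_len ?x = Suc (aff_len ?y)" by blast+
  have "aff_cover \<Phi> \<Delta> ?y ?x" using aff_coverI[OF x neg len] .
  moreover have "?\<gamma> \<in> aff_roots \<Phi>" using aff_pos_root[OF neg] unfolding aff_root_uminus_iff .
  moreover have "fst ?\<gamma> \<in> \<Phi> - RJ" using \<beta> \<beta>r outer_iff by simp
  ultimately show "Omega_cover \<Phi> \<Delta> J N ?y ?x" unfolding Omega_cover_def using xO yO by blast
qed

text \<open>The reflection determines the connecting root up to sign, so its classical part \<beta>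
  may be taken positive; \<alpha> is then \<open>z \<beta>\<close>, again positive and outside
  \<Phi>_J.\<close>

lemma Omega_cover_normal_form:
  assumes "Omega_cover \<Phi> \<Delta> J N y x"
  obtains w z \<mu> \<alpha> n where "w \<in> MJ" "adjusted z \<mu>" "J_superantidominant \<Phi> \<Delta> J N \<mu>"
    "x = w \<circ> z \<circ> transl \<mu>" "\<alpha> \<in> P - PJ" "n \<in> \<int>" "y = x \<circ> aff_refl (inv z \<alpha>, n)"
proof -
  from assms obtain w z \<mu> where x: "w \<in> MJ" "adjusted z \<mu>" "J_superantidominant \<Phi> \<Delta> J N \<mu>"
    "x = w \<circ> z \<circ> transl \<mu>" unfolding Omega_cover_def Omega_iff by blast
  from assms obtain \<gamma> where \<gamma>: "\<gamma> \<in> aff_roots \<Phi>" "y = x \<circ> aff_refl \<gamma>" "fst \<gamma> \<in> \<Phi> - RJ"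
    unfolding Omega_cover_def by blast
  have z: "z \<in> WJ" using x(2) by (simp add: adjusted_def)
  then have zW: "z \<in> Weyl \<Phi>" using par_Weyl_subset by blast
  obtain \<beta> n where \<beta>: "\<beta> \<in> P - PJ" "n \<in> \<int>" "y = x \<circ> aff_refl (\<beta>, n)"
  proof (cases "fst \<gamma> \<in> P")
    case True
    then have "fst \<gamma> \<in> P - PJ" using \<gamma>(3) outer_iff by blast
    moreover have "snd \<gamma> \<in> \<int>" using \<gamma>(1) by (auto simp: aff_roots_def)
    moreover have "y = x \<circ> aff_refl (fst \<gamma>, snd \<gamma>)" using \<gamma>(2) by simp
    ultimately show ?thesis using that by blast
  next
    case False
    then have "- fst \<gamma> \<in> P" using pos_or_neg \<gamma>(3) by blast
    moreover have "- fst \<gamma> \<notin> RJ" using \<gamma>(3) J.uminus_root_iff by blast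
    ultimately have "- fst \<gamma> \<in> P - PJ" using outer_iff by blast
    moreover have "- snd \<gamma> \<in> \<int>" using \<gamma>(1) by (auto simp: aff_roots_def)
    moreover have "y = x \<circ> aff_refl (- fst \<gamma>, - snd \<gamma>)"
      using \<gamma>(2) aff_refl_uminus[of \<gamma>] by (simp add: uminus_prod_def)
    ultimately show ?thesis using that by blast
  qed
  have "z \<beta> \<in> P - PJ" using par_Weyl_outer[OF z \<beta>(1)] .
  moreover have "y = x \<circ> aff_refl (inv z (z \<beta>), n)" using \<beta>(3) Weyl_inv(3)[OF zW] by simp
  ultimately show ?thesis using that x \<beta>(2) by blast
qed

text \<open>
  The case \<open>\<chi> \<ge> 2\<close> is excluded by comparing with the reflection of \<open>x\<close> for \<open>\<chi> = 1\<close>, which is already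
  below \<open>x\<close>: its length bounds \<open>\<ell>(w) - \<ell>(\<lfloor>wr\<^sub>\<alpha>\<rfloor>)\<close> from above.
\<close>

lemma cover_projects:
  assumes N: "N \<ge> 2" and cov: "Omega_cover \<Phi> \<Delta> J N y x"
    and w: "w \<in> MJ" and adj: "adjusted z \<mu>" and sup: "J_superantidominant \<Phi> \<Delta> J N \<mu>"
    and x: "x = w \<circ> z \<circ> transl \<mu>" and \<alpha>: "\<alpha> \<in> P - PJ" and n: "n \<in> \<int>"
    and y: "y = x \<circ> aff_refl (inv z \<alpha>, n)" and c: "c = n - \<mu> \<bullet> inv z \<alpha>"
  shows "c \<in> {0, 1}" and "(inv z \<alpha>, n) \<in> aff_neg_roots \<Phi> \<Delta>"
    and "c = 0 \<Longrightarrow> QB_bruhat_edge \<Phi> \<Delta> {} (w \<circ> z) (inv z \<alpha>) (w \<circ> refl_root \<alpha> \<circ> z) \<and>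
      QB_bruhat_edge \<Phi> \<Delta> J w \<alpha> (min_rep \<Phi> \<Delta> J (w \<circ> refl_root \<alpha>))"
    and "c = 1 \<Longrightarrow> QB_quantum_edge \<Phi> \<Delta> {} (w \<circ> z) (inv z \<alpha>) (w \<circ> refl_root \<alpha> \<circ> z) \<and>
      QB_quantum_edge \<Phi> \<Delta> J w \<alpha> (min_rep \<Phi> \<Delta> J (w \<circ> refl_root \<alpha>))"
proof -
  let ?\<beta> = "inv z \<alpha>"
  have z: "z \<in> WJ" and \<mu>: "\<mu> \<in> QL" using adj by (auto simp: adjusted_def)
  have W: "w \<in> Weyl \<Phi>" and zW: "z \<in> Weyl \<Phi>" using w min_reps_Weyl z par_Weyl_subset by blast+
  have \<beta>: "?\<beta> \<in> P - PJ" using inv_outer[OF z \<alpha>] .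
  have \<beta>r: "?\<beta> \<in> \<Phi>" and \<beta>P: "?\<beta> \<in> P" and \<alpha>r: "\<alpha> \<in> \<Phi>" using \<beta> \<alpha> pos_root by blast+
  have nc: "n = c + \<mu> \<bullet> ?\<beta>" using c by simp
  have i: "\<mu> \<bullet> ?\<beta> \<in> \<int>" using lattice_pairing[OF \<mu> \<beta>r] .
  have ci: "c \<in> \<int>" using c n i by simp
  let ?\<mu> = "\<mu> + c *\<^sub>R coroot ?\<beta>"
  have yf: "y = (w \<circ> refl_root \<alpha> \<circ> z) \<circ> transl ?\<mu>" unfolding y x nc by (rule refl_formula(2)[OF z])
  obtain v z' \<mu>' where v: "v \<in> MJ" "adjusted z' \<mu>'" "J_superantidominant \<Phi> \<Delta> J N \<mu>'"
    "y = v \<circ> z' \<circ> transl \<mu>'" using cov unfolding Omega_cover_def Omega_iff by blast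
  have z': "z' \<in> WJ" and z'W: "z' \<in> Weyl \<Phi>" and V: "v \<in> Weyl \<Phi>"
    using v(1,2) par_Weyl_subset min_reps_Weyl by (auto simp: adjusted_def)
  have wrz: "w \<circ> refl_root \<alpha> \<circ> z \<in> Weyl \<Phi>" and vz': "v \<circ> z' \<in> Weyl \<Phi>"
    using W zW V z'W \<alpha>r Weyl_comp refl_Weyl by blast+
  have e: "w \<circ> refl_root \<alpha> \<circ> z = v \<circ> z'" "(w \<circ> refl_root \<alpha> \<circ> z) ?\<mu> = (v \<circ> z') \<mu>'"
    using linear_transl_eq[OF Weyl_linear[OF wrz] Weyl_linear[OF vz']] yf v(4) by metis+
  then have \<mu>': "\<mu>' = ?\<mu>" using Weyl_inv(3)[OF vz'] by metis
  have far: "\<mu> \<bullet> \<delta> \<le> - real N" "?\<mu> \<bullet> \<delta> \<le> - real N" if "\<delta> \<in> P - PJ" for \<delta>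
    using sup v(3) that unfolding \<mu>' J_superantidominant_def by blast+
  have far1: "\<mu> \<bullet> \<delta> \<le> - 1" "\<mu>' \<bullet> \<delta> \<le> - 1" if "\<delta> \<in> P - PJ" for \<delta>
    using far[OF that] N unfolding \<mu>' by linarith+
  \<comment> \<open>\<open>n\<close> is the mean of the pairings of \<open>?\<beta>\<close> with
    \<mu> and with \<open>?\<mu>\<close>, both at most \<open>- N\<close>. No bound on
    \<open>c\<close> is available at this point.\<close>
  have "?\<mu> \<bullet> ?\<beta> = \<mu> \<bullet> ?\<beta> + 2 * c"
    using inner_coroot_self[OF nonzero[OF \<beta>r]] by (simp add: inner_add_left inner_commute[of "coroot ?\<beta>"])
  then have "n < 0" using far[OF \<beta>] N nc by linarith
  then have neg: "- (?\<beta>, n) \<in> PA" using n \<beta>r by (simp add: aff_pos_iff)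
  then show "(?\<beta>, n) \<in> aff_neg_roots \<Phi> \<Delta>" using aff_neg_iff[of ?\<beta> n] by simp
  have len: "aff_len x = Suc (aff_len y)" using cov by (simp add: Omega_cover_def aff_cover_iff)
  then have pos: "(w \<alpha>, c) \<in> PA"
    using lift_descent[OF W z \<mu>, of \<alpha> c] neg y unfolding x nc by simp
  then have c0: "c \<ge> 0" by (auto simp: aff_pos_iff)
  let ?s = "coroot \<alpha> \<bullet> outer_sum"
  have s: "?s > 0" using outer_sum_pos[OF \<alpha>] .
  have "coroot ?\<beta> = inv z (coroot \<alpha>)" using Weyl_coroot[OF Weyl_inv(1)[OF zW]] .
  then have cs: "coroot ?\<beta> \<bullet> outer_sum = ?s" using inner_outer_sum[OF par_Weyl_inv[OF z]] by simp
  have lx: "real (aff_len x) = - (\<mu> \<bullet> outer_sum) - real (lenW w)"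
    unfolding x using aff_len_adjusted[OF w adj far1(1)] .
  have ly: "real (aff_len y) = - (\<mu>' \<bullet> outer_sum) - real (lenW v)"
    unfolding v(4) using aff_len_adjusted[OF v(1,2) far1(2)] .
  have lv: "real (lenW v) = real (lenW w) + 1 - c * ?s"
    using lx ly len cs unfolding \<mu>' by (simp add: inner_add_left)
  have "c \<le> 1"
  proof -
    let ?n = "1 + \<mu> \<bullet> ?\<beta>" and ?\<nu> = "\<mu> + coroot ?\<beta>"
    have "?n < 0" using far(1)[OF \<beta>] N by linarith
    then have neg1: "- (?\<beta>, ?n) \<in> PA" using i \<beta>r by (simp add: aff_pos_iff)
    have "(w \<alpha>, 1) \<in> PA" using Weyl_root[OF W \<alpha>r] by (simp add: aff_pos_iff)
    then have less: "aff_len (x \<circ> aff_refl (?\<beta>, ?n)) < aff_len x"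
      unfolding x using lift_descent[OF W z \<mu> neg1] by blast
    \<comment> \<open>The linear part does not depend on \<chi>, so the same \<open>v\<close> and
      \<open>z'\<close> occur as for \<open>y\<close>; since adjustedness of \<open>?\<nu>\<close>
      with \<open>z'\<close> is not known, only the lower bound applies.\<close>
    have xv: "x \<circ> aff_refl (?\<beta>, ?n) = v \<circ> z' \<circ> transl ?\<nu>"
      unfolding x refl_formula(2)[OF z] e(1) by (simp only: scaleR_one)
    have "?\<nu> \<in> QL" using coroot_lattice_add[OF \<mu> coroot_in_lattice[OF \<beta>r]] .
    note low = aff_len_lower[OF v(1) z' this, folded xv]
    have "(\<Sum>\<gamma>\<in>PJ. \<bar>?\<nu> \<bullet> \<gamma> + neg_ind z' \<gamma>\<bar>) \<ge> 0" by (intro sum_nonneg) simp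
    then have "real (aff_len (x \<circ> aff_refl (?\<beta>, ?n))) \<ge> - (?\<nu> \<bullet> outer_sum) - real (lenW v)"
      using low by linarith
    then have "real (lenW v) \<ge> real (lenW w) + 1 - ?s"
      using less lx cs by (simp add: inner_add_left)
    then have "c * ?s \<le> 1 * ?s" using lv by simp
    then show ?thesis using s by (simp add: mult_le_cancel_right)
  qed
  then show "c \<in> {0, 1}" using c0 ci by (auto elim!: Ints_cases)
  have mr: "min_rep \<Phi> \<Delta> J (w \<circ> refl_root \<alpha>) = v"
  proof (rule min_rep_eqI[OF v(1)])
    show "z \<circ> inv z' \<in> WJ" using z z' par_Weyl_comp par_Weyl_inv by blast
    have "(w \<circ> refl_root \<alpha>) \<circ> (z \<circ> inv z') = (v \<circ> z') \<circ> inv z'" unfolding e(1)[symmetric] by (simp only: comp_assoc)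
    also have "\<dots> = v" unfolding comp_assoc Weyl_inv(5)[OF z'W] by simp
    finally show "v = (w \<circ> refl_root \<alpha>) \<circ> (z \<circ> inv z')" ..
  qed
  have wz: "w \<circ> z \<in> Weyl \<Phi>" using W zW Weyl_comp by blast
  have "z \<circ> refl_root ?\<beta> = refl_root \<alpha> \<circ> z" using Weyl_comp_refl[OF zW, of ?\<beta>] Weyl_inv(4)[OF zW] by simp
  then have wzr: "w \<circ> refl_root \<alpha> \<circ> z = (w \<circ> z) \<circ> refl_root ?\<beta>" by (simp only: comp_assoc)
  \<comment> \<open>The lengths of \<open>z\<close> and \<open>z'\<close> are minus the pairings of
    \<mu> and \<mu>' with 2\<rho>_J. Adding them turns the term with 2\<rho> - 2\<rho>_J into one
    with 2\<rho>, which is the edge condition in QB(W).\<close>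
  have lwz: "real (lenW (w \<circ> z)) = real (lenW w) - \<mu> \<bullet> inner_sum"
    using length_min_comp[OF w z] adjusted_length[OF adj] by simp
  have lvz: "real (lenW (w \<circ> refl_root \<alpha> \<circ> z)) = real (lenW v) - \<mu>' \<bullet> inner_sum"
    unfolding e(1) using length_min_comp[OF v(1) z'] adjusted_length[OF v(2)] by simp
  show "c = 0 \<Longrightarrow> QB_bruhat_edge \<Phi> \<Delta> {} (w \<circ> z) ?\<beta> (w \<circ> refl_root \<alpha> \<circ> z) \<and>
      QB_bruhat_edge \<Phi> \<Delta> J w \<alpha> (min_rep \<Phi> \<Delta> J (w \<circ> refl_root \<alpha>))"
  proof
    assume c: "c = 0"
    then have mm: "\<mu>' = \<mu>" using \<mu>' by simp
    have "lenW (w \<circ> refl_root \<alpha> \<circ> z) = Suc (lenW (w \<circ> z))"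
      using lwz lvz lv unfolding mm c by simp
    then show "QB_bruhat_edge \<Phi> \<Delta> {} (w \<circ> z) ?\<beta> (w \<circ> refl_root \<alpha> \<circ> z)"
      by (rule QB_bruhat_edge_empty[OF wz \<beta>P wzr])
    \<comment> \<open>The translation parts agree, and the projection of \<open>transl \<mu>\<close>
      determines \<open>z\<close>. So \<open>w \<circ> refl_root \<alpha>\<close> is
      \<open>v\<close> itself, already minimal.\<close>
    have "z' = z" using adjustedI(2)[OF adj] adjustedI(2)[OF v(2)] transl_cancel unfolding mm by metis
    then have "v = w \<circ> refl_root \<alpha> \<circ> (z \<circ> inv z)"
      using e(1) Weyl_inv(5)[OF z'W] by (metis comp_assoc comp_id)
    then have vr: "v = w \<circ> refl_root \<alpha>" unfolding Weyl_inv(5)[OF zW] by simp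
    have "lenW v = Suc (lenW w)" using lv c by simp
    then have "Weyl_cover \<Phi> \<Delta> w (w \<circ> refl_root \<alpha>)" unfolding Weyl_cover_iff vr using W \<alpha> by blast
    then show "QB_bruhat_edge \<Phi> \<Delta> J w \<alpha> (min_rep \<Phi> \<Delta> J (w \<circ> refl_root \<alpha>))"
      unfolding QB_bruhat_edge_def using w \<alpha> by blast
  qed
  show "c = 1 \<Longrightarrow> QB_quantum_edge \<Phi> \<Delta> {} (w \<circ> z) ?\<beta> (w \<circ> refl_root \<alpha> \<circ> z) \<and>
      QB_quantum_edge \<Phi> \<Delta> J w \<alpha> (min_rep \<Phi> \<Delta> J (w \<circ> refl_root \<alpha>))"
  proof
    assume c: "c = 1"
    have "real (lenW (w \<circ> refl_root \<alpha> \<circ> z)) =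
        real (lenW (w \<circ> z)) + 1 - coroot ?\<beta> \<bullet> (2 *\<^sub>R rho \<Phi> \<Delta>)"
      using lwz lvz lv cs unfolding two_rho \<mu>' c by (simp add: inner_add_left inner_add_right)
    then show "QB_quantum_edge \<Phi> \<Delta> {} (w \<circ> z) ?\<beta> (w \<circ> refl_root \<alpha> \<circ> z)"
      by (rule QB_quantum_edge_empty[OF wz \<beta>P wzr])
    show "QB_quantum_edge \<Phi> \<Delta> J w \<alpha> (min_rep \<Phi> \<Delta> J (w \<circ> refl_root \<alpha>))"
      unfolding QB_quantum_edge_def mr two_rho_diff using w \<alpha> lv c by simp
  qed
qed

end

theorem proposition3p1:
  fixes \<Phi> \<Delta> J :: "'a::euclidean_space set" and lam :: 'a
  assumes "irreducible_root_system \<Phi>"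
    and "simple_system \<Phi> \<Delta>"
    and "lam \<in> weight_lattice \<Phi>"
    and "dominant \<Delta> lam"
    and "J = {\<alpha> \<in> \<Delta>. coroot \<alpha> \<bullet> lam = 0}"
  shows "\<exists>(N0 :: nat) (d :: nat). \<forall>N\<ge>N0.
    (\<forall>w \<alpha> v \<mu> z (c :: real).
       (c = 0 \<and> QB_bruhat_edge \<Phi> \<Delta> J w \<alpha> v \<or> c = 1 \<and> QB_quantum_edge \<Phi> \<Delta> J w \<alpha> v) \<and>
       J_superantidominant \<Phi> \<Delta> J (N + d) \<mu> \<and> J_adjusted \<Phi> \<Delta> J \<mu> \<and>
       aff_proj \<Phi> \<Delta> J (transl \<mu>) = z \<circ> transl \<mu>
       \<longrightarrow>
       (let x = w \<circ> z \<circ> transl \<mu>;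
            \<alpha>' = (inv z \<alpha>, c + \<mu> \<bullet> inv z \<alpha>);
            y = x \<circ> aff_refl \<alpha>'
        in Omega_cover \<Phi> \<Delta> J N y x \<and>
           y = w \<circ> refl_root \<alpha> \<circ> transl (c *\<^sub>R coroot \<alpha>) \<circ> z \<circ> transl \<mu> \<and>
           \<alpha>' \<in> aff_neg_roots \<Phi> \<Delta>))
    \<and>
    (\<forall>x y. Omega_cover \<Phi> \<Delta> J N y x \<longrightarrow>
       (\<exists>w z \<mu> \<alpha> (n :: int).
          w \<in> min_reps \<Phi> \<Delta> J \<and>
          J_superantidominant \<Phi> \<Delta> J N \<mu> \<and> J_adjusted \<Phi> \<Delta> J \<mu> \<and>
          aff_proj \<Phi> \<Delta> J (transl \<mu>) = z \<circ> transl \<mu> \<and> z \<in> par_Weyl J \<and>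
          x = w \<circ> z \<circ> transl \<mu> \<and>
          \<alpha> \<in> pos_roots \<Phi> \<Delta> - par_pos_roots \<Phi> \<Delta> J \<and>
          (let \<gamma> = (inv z \<alpha>, real_of_int n);
               c = real_of_int n - \<mu> \<bullet> inv z \<alpha>
           in \<gamma> \<in> aff_roots \<Phi> \<and> y = x \<circ> aff_refl \<gamma> \<and>
              c \<in> {0, 1} \<and>
              \<gamma> = (inv z \<alpha>, c + \<mu> \<bullet> inv z \<alpha>) \<and> \<gamma> \<in> aff_neg_roots \<Phi> \<Delta> \<and>
              (c = 0 \<longrightarrow>
                 QB_bruhat_edge \<Phi> \<Delta> {} (w \<circ> z) (inv z \<alpha>) (w \<circ> refl_root \<alpha> \<circ> z) \<and>
                 QB_bruhat_edge \<Phi> \<Delta> J w \<alpha> (min_rep \<Phi> \<Delta> J (w \<circ> refl_root \<alpha>))) \<and>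
              (c = 1 \<longrightarrow>
                 QB_quantum_edge \<Phi> \<Delta> {} (w \<circ> z) (inv z \<alpha>) (w \<circ> refl_root \<alpha> \<circ> z) \<and>
                 QB_quantum_edge \<Phi> \<Delta> J w \<alpha> (min_rep \<Phi> \<Delta> J (w \<circ> refl_root \<alpha>))))))"
proof -
  have rs: "root_system \<Phi>" and ne: "\<Phi> \<noteq> {}"
    and irr: "\<And>A B. A \<noteq> {} \<Longrightarrow> B \<noteq> {} \<Longrightarrow> A \<union> B = \<Phi> \<Longrightarrow> \<exists>\<alpha>\<in>A. \<exists>\<beta>\<in>B. \<alpha> \<bullet> \<beta> \<noteq> 0"
    using assms(1) unfolding irreducible_root_system_def by blast+
  interpret irreducible_parabolic_roots \<Phi> \<Delta> J
  proof unfold_locales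
    show "J \<subseteq> \<Delta>" using assms(5) by blast
  qed (use rs ne irr assms(2) in \<open>simp_all add: root_system_def simple_system_def\<close>)
  \<comment> \<open>The largest amount, rounded up, by which adding a coroot can raise a pairing
    with a root.\<close>
  define d where "d = nat \<lceil>Max ((\<lambda>(\<alpha>, \<beta>). coroot \<alpha> \<bullet> \<beta>) ` (\<Phi> \<times> \<Phi>))\<rceil>"
  have d: "coroot \<alpha> \<bullet> \<beta> \<le> real d" if "\<alpha> \<in> \<Phi>" "\<beta> \<in> \<Phi>" for \<alpha> \<beta>
  proof -
    have "coroot \<alpha> \<bullet> \<beta> \<le> Max ((\<lambda>(\<alpha>, \<beta>). coroot \<alpha> \<bullet> \<beta>) ` (\<Phi> \<times> \<Phi>))"
      using that fin by (intro Max_ge) auto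
    then show ?thesis unfolding d_def by linarith
  qed
  show ?thesis
  proof (rule exI[of _ 2], rule exI[of _ d], intro allI impI conjI, goal_cases)
    case (1 N w \<alpha> v \<mu> z c)
    then have adj: "adjusted z \<mu>" using adjustedD by blast
    then have z: "z \<in> par_Weyl J" by (simp add: adjusted_def)
    have "c = 0 \<and> QB_bruhat_edge \<Phi> \<Delta> J w \<alpha> v \<or> c = 1 \<and> QB_quantum_edge \<Phi> \<Delta> J w \<alpha> v"
      and "J_superantidominant \<Phi> \<Delta> J (N + d) \<mu>" using 1(2) by blast+
    note lift = edge_lifts[OF 1(1) d this adj]
    show ?case unfolding Let_def by (intro conjI lift refl_formula(1)[OF z])
  next
    case (2 N x y)
    obtain w z \<mu> \<alpha> n where nf: "w \<in> min_reps \<Phi> \<Delta> J" "adjusted z \<mu>" "J_superantidominant \<Phi> \<Delta> J N \<mu>"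
        "x = w \<circ> z \<circ> transl \<mu>" "\<alpha> \<in> P - PJ" "n \<in> \<int>" "y = x \<circ> aff_refl (inv z \<alpha>, n)"
      using 2(2) by (rule Omega_cover_normal_form)
    obtain k where k: "n = real_of_int k" using nf(6) by (auto elim: Ints_cases)
    note p = cover_projects[OF 2 nf refl, unfolded k]
    have z: "z \<in> par_Weyl J" using nf(2) by (simp add: adjusted_def)
    then have "inv z \<alpha> \<in> \<Phi>" using inv_outer nf(5) pos_root by blast
    then have "(inv z \<alpha>, real_of_int k) \<in> aff_roots \<Phi>" by (simp add: aff_roots_def)
    moreover have "(inv z \<alpha>, real_of_int k) = (inv z \<alpha>, (real_of_int k - \<mu> \<bullet> inv z \<alpha>) + \<mu> \<bullet> inv z \<alpha>)" by simp
    ultimately show ?case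
      unfolding Let_def
      by (intro exI[of _ w] exI[of _ z] exI[of _ \<mu>] exI[of _ \<alpha>] exI[of _ k] conjI impI)
        (rule nf(1) nf(3-5) nf(7)[unfolded k] z adjustedI[OF nf(2)] p(1,2)
        | assumption
        | erule p(3)[THEN conjunct1] p(3)[THEN conjunct2] p(4)[THEN conjunct1] p(4)[THEN conjunct2])+
  qed
qed

end
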